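(* Let $M$ be a connected smooth manifold of dimension $n\ge 2$, let $F$ be an essentially Berwald Finsler metric on $M$, and let $\Gamma$ be its associated connection. Suppose that a Riemannian or pseudo-Riemannian metric $g$ on $M$ is geodesically equivalent to $F$ but is not affine equivalent to $F$. Then there exist a constant $\mu\in\mathbb{R}$, a symmetric $(2,0)$-tensor field $a^{ij}$ on $M$ and a nonzero (i.e. not identically zero) vector field $\lambda^i$ on $M$ such that $$a^{ij}_{\ \ ,k}=\lambda^i\delta^j_k+\lambda^j\delta^i_k,\qquad \lambda^i_{\ ,j}=\mu\,\delta^i_j,$$ where the comma denotes the covariant derivative with respect to $\Gamma$.
   Context: A Finsler metric on $M$ is a function $F:TM\to\mathbb{R}_{\ge 0}$ that is smooth on the complement of the zero section of $TM$ and such that for every $x\in M$, all $\xi,\eta\in T_xM$ and all real $\lambda\ge 0$: $F(\lambda\xi)=\lambda F(\xi)$; $F(\xi+\eta)\le F(\xi)+F(\eta)$; and $F(\xi)=0$ implies $\xi=0$. Neither strict convexity of $F$ nor $F(-\xi)=F(\xi)$ is required. A Finsler metric $F$ is Berwald if there exists a symmetric (torsion-free) affine connection $\Gamma$ on $M$ whose parallel transport along curves preserves the function $F$; $\Gamma$ is then called the associated connection. $F$ is essentially Berwald if it is Berwald but not Riemannian, i.e. not of the form $F(x,\xi)=\sqrt{g_{(x)}(\xi,\xi)}$ for a Riemannian metric $g$. A parametrized $F$-geodesic is a smooth curve with nonvanishing velocity satisfying the Euler–Lagrange equations of the Lagrangian $\frac12F^2$. An unparametrized $F$-geodesic is such a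 curve up to orientation-preserving reparametrization. Geodesics of a Riemannian or pseudo-Riemannian metric are the nonconstant affinely parametrized geodesics of its Levi-Civita connection (and likewise up to reparametrization in the unparametrized case). A metric $g$ is geodesically equivalent to $F$ if every $g$-geodesic, considered as an unparametrized curve, is also an $F$-geodesic. It is affine equivalent to $F$ if every $g$-geodesic, considered as a parametrized curve, is also an $F$-geodesic. These relations are not a priori symmetric. $\delta^i_j$ is the Kronecker delta. *)

theory Defs
  imports "HOL-Analysis.Analysis"
begin

section \<open>Smooth maps between open subsets of normed spaces\<close>

text \<open>
  Only used on open sets \<open>S\<close>; all iterated directional derivatives exist and are continuous.
  On finite-dimensional spaces this is the usual class of \<open>C\<^sup>k\<close> maps.
\<close>

primrec Ck_on :: "nat \<Rightarrow> 'a::real_normed_vector set \<Rightarrow> ('a \<Rightarrow> 'b::real_normed_vector) \<Rightarrow> bool" where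
  "Ck_on 0 S f \<longleftrightarrow> continuous_on S f"
| "Ck_on (Suc k) S f \<longleftrightarrow>
     (\<forall>x\<in>S. f differentiable (at x)) \<and> (\<forall>v. Ck_on k S (\<lambda>x. frechet_derivative f (at x) v))"

definition smooth_on :: "'a::real_normed_vector set \<Rightarrow> ('a \<Rightarrow> 'b::real_normed_vector) \<Rightarrow> bool" where
  "smooth_on S f \<longleftrightarrow> (\<forall>k. Ck_on k S f)"

definition partial :: "'n::finite \<Rightarrow> (real^'n \<Rightarrow> real) \<Rightarrow> real^'n \<Rightarrow> real" where
  "partial i f x = frechet_derivative f (at x) (axis i 1)"


section \<open>Manifolds\<close>

text \<open>
  The manifold is the whole space \<open>'a\<close>, with a smooth structure given by a (not necessarily
  maximal) atlas. A chart is a pair of its domain and its coordinate map; the coordinate map is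
  irrelevant outside the domain. The dimension is \<open>CARD('n)\<close>.
\<close>

type_synonym ('a, 'n) chart = "'a set \<times> ('a \<Rightarrow> real^'n)"

abbreviation source :: "('a, 'n) chart \<Rightarrow> 'a set" where
  "source c \<equiv> fst c"

abbreviation coord :: "('a, 'n) chart \<Rightarrow> 'a \<Rightarrow> real^'n" where
  "coord c \<equiv> snd c"

abbreviation target :: "('a, 'n) chart \<Rightarrow> (real^'n) set" where
  "target c \<equiv> coord c ` source c"

abbreviation pt :: "('a, 'n) chart \<Rightarrow> real^'n \<Rightarrow> 'a" where
  "pt c \<equiv> inv_into (source c) (coord c)"

definition is_chart :: "('a::topological_space, 'n::finite) chart \<Rightarrow> bool" where
  "is_chart c \<longleftrightarrow> open (source c) \<and> open (target c) \<and>
     homeomorphism (source c) (target c) (coord c) (pt c)"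

definition smooth_manifold ::
    "('a::{t2_space,second_countable_topology}, 'n::finite) chart set \<Rightarrow> bool" where
  "smooth_manifold A \<longleftrightarrow>
     (\<forall>c\<in>A. is_chart c) \<and> (\<Union>c\<in>A. source c) = UNIV \<and>
     (\<forall>c\<in>A. \<forall>d\<in>A. smooth_on (coord c ` (source c \<inter> source d)) (coord d \<circ> pt c))"

definition jac :: "('a, 'n::finite) chart \<Rightarrow> ('a, 'n) chart \<Rightarrow> 'a \<Rightarrow> real^'n^'n" where
  "jac c d p = jacobian (coord d \<circ> pt c) (at (coord c p))"


section \<open>Tangent vectors, tensor fields and connections\<close>

text \<open>
  A tangent vector at \<open>p\<close> is the family of its components with respect to all charts
  around \<open>p\<close>, which are related by the Jacobians of the coordinate changes. For charts that do
  not contain \<open>p\<close> the value is fixed to be 0, so that equal tangent vectors are equal functions.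
\<close>

type_synonym ('a, 'n) tangent = "('a, 'n) chart \<Rightarrow> real^'n"

definition tangent_space ::
    "('a, 'n::finite) chart set \<Rightarrow> 'a \<Rightarrow> ('a, 'n) tangent set" where
  "tangent_space A p = {\<xi>.
     (\<forall>c\<in>A. \<forall>d\<in>A. p \<in> source c \<inter> source d \<longrightarrow> \<xi> d = jac c d p *v \<xi> c) \<and>
     (\<forall>c. \<not> (c \<in> A \<and> p \<in> source c) \<longrightarrow> \<xi> c = 0)}"

text \<open>The tangent vector at \<open>p\<close> whose components in the chart \<open>c\<close> are \<open>v\<close>.\<close>

definition tvec ::
    "('a, 'n::finite) chart set \<Rightarrow> ('a, 'n) chart \<Rightarrow> 'a \<Rightarrow> real^'n \<Rightarrow> ('a, 'n) tangent" where
  "tvec A c p v = (\<lambda>d. if d \<in> A \<and> p \<in> source d then jac c d p *v v else 0)"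

definition vector_field ::
    "('a, 'n::finite) chart set \<Rightarrow> ('a \<Rightarrow> ('a, 'n) tangent) \<Rightarrow> bool" where
  "vector_field A X \<longleftrightarrow>
     (\<forall>p. X p \<in> tangent_space A p) \<and> (\<forall>c\<in>A. smooth_on (target c) (\<lambda>x. X (pt c x) c))"

text \<open>Second-order tensor fields are likewise given by their component matrices
  \<open>T p c\<close> at \<open>p\<close> in the chart \<open>c\<close>.\<close>

definition tensor20 ::
    "('a, 'n::finite) chart set \<Rightarrow> ('a \<Rightarrow> ('a, 'n) chart \<Rightarrow> real^'n^'n) \<Rightarrow> bool" where
  "tensor20 A a \<longleftrightarrow>
     (\<forall>c\<in>A. \<forall>d\<in>A. \<forall>p \<in> source c \<inter> source d.
        a p d = jac c d p ** a p c ** transpose (jac c d p)) \<and>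
     (\<forall>c\<in>A. smooth_on (target c) (\<lambda>x. a (pt c x) c))"

definition tensor02 ::
    "('a, 'n::finite) chart set \<Rightarrow> ('a \<Rightarrow> ('a, 'n) chart \<Rightarrow> real^'n^'n) \<Rightarrow> bool" where
  "tensor02 A g \<longleftrightarrow>
     (\<forall>c\<in>A. \<forall>d\<in>A. \<forall>p \<in> source c \<inter> source d.
        g p c = transpose (jac c d p) ** g p d ** jac c d p) \<and>
     (\<forall>c\<in>A. smooth_on (target c) (\<lambda>x. g (pt c x) c))"

definition symmetric_tensor ::
    "('a, 'n::finite) chart set \<Rightarrow> ('a \<Rightarrow> ('a, 'n) chart \<Rightarrow> real^'n^'n) \<Rightarrow> bool" where
  "symmetric_tensor A T \<longleftrightarrow> (\<forall>c\<in>A. \<forall>p \<in> source c. transpose (T p c) = T p c)"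

text \<open>Pseudo-Riemannian metrics may have any signature, so Riemannian metrics are included.\<close>

definition pseudo_riemannian_metric ::
    "('a, 'n::finite) chart set \<Rightarrow> ('a \<Rightarrow> ('a, 'n) chart \<Rightarrow> real^'n^'n) \<Rightarrow> bool" where
  "pseudo_riemannian_metric A g \<longleftrightarrow>
     tensor02 A g \<and> symmetric_tensor A g \<and> (\<forall>c\<in>A. \<forall>p \<in> source c. invertible (g p c))"

definition riemannian_metric ::
    "('a, 'n::finite) chart set \<Rightarrow> ('a \<Rightarrow> ('a, 'n) chart \<Rightarrow> real^'n^'n) \<Rightarrow> bool" where
  "riemannian_metric A g \<longleftrightarrow>
     tensor02 A g \<and> symmetric_tensor A g \<and>
     (\<forall>c\<in>A. \<forall>p \<in> source c. \<forall>v. v \<noteq> 0 \<longrightarrow> v \<bullet> (g p c *v v) > 0)"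

text \<open>
  An affine connection is given by its Christoffel symbols: \<open>\<Gamma> p c i j k\<close> is the
  coefficient with upper index \<open>i\<close> and lower indices \<open>j\<close>, \<open>k\<close> at \<open>p\<close> in the chart \<open>c\<close>, i.e. the
  \<open>i\<close>-th component of the derivative of the \<open>k\<close>-th coordinate field in direction \<open>j\<close>.
\<close>

type_synonym ('a, 'n) connection = "'a \<Rightarrow> ('a, 'n) chart \<Rightarrow> 'n \<Rightarrow> 'n \<Rightarrow> 'n \<Rightarrow> real"

definition affine_connection ::
    "('a, 'n::finite) chart set \<Rightarrow> ('a, 'n) connection \<Rightarrow> bool" where
  "affine_connection A \<Gamma> \<longleftrightarrow>
     (\<forall>c\<in>A. \<forall>d\<in>A. \<forall>p \<in> source c \<inter> source d. \<forall>r i j.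
        (\<Sum>k\<in>UNIV. jac c d p $ r $ k * \<Gamma> p c k i j) =
        partial i (partial j (\<lambda>x. coord d (pt c x) $ r)) (coord c p) +
        (\<Sum>s\<in>UNIV. \<Sum>t\<in>UNIV. \<Gamma> p d r s t * jac c d p $ s $ i * jac c d p $ t $ j)) \<and>
     (\<forall>c\<in>A. \<forall>i j k. smooth_on (target c) (\<lambda>x. \<Gamma> (pt c x) c i j k))"

definition symmetric_connection ::
    "('a, 'n::finite) chart set \<Rightarrow> ('a, 'n) connection \<Rightarrow> bool" where
  "symmetric_connection A \<Gamma> \<longleftrightarrow> affine_connection A \<Gamma> \<and>
     (\<forall>c\<in>A. \<forall>p \<in> source c. \<forall>i j k. \<Gamma> p c i j k = \<Gamma> p c i k j)"

text \<open>\<open>cov_vec \<Gamma> X p c i j\<close> and \<open>cov_tensor20 \<Gamma> a p c i j k\<close> are the components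
  \<open>X\<^sup>i\<^sub>,\<^sub>j\<close> and \<open>a\<^sup>i\<^sup>j\<^sub>,\<^sub>k\<close> of the covariant derivatives at \<open>p\<close> in the chart \<open>c\<close>.\<close>

definition cov_vec ::
    "('a, 'n::finite) connection \<Rightarrow> ('a \<Rightarrow> ('a, 'n) tangent) \<Rightarrow>
     'a \<Rightarrow> ('a, 'n) chart \<Rightarrow> 'n \<Rightarrow> 'n \<Rightarrow> real" where
  "cov_vec \<Gamma> X p c i j =
     partial j (\<lambda>x. X (pt c x) c $ i) (coord c p) + (\<Sum>s\<in>UNIV. \<Gamma> p c i j s * X p c $ s)"

definition cov_tensor20 ::
    "('a, 'n::finite) connection \<Rightarrow> ('a \<Rightarrow> ('a, 'n) chart \<Rightarrow> real^'n^'n) \<Rightarrow>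
     'a \<Rightarrow> ('a, 'n) chart \<Rightarrow> 'n \<Rightarrow> 'n \<Rightarrow> 'n \<Rightarrow> real" where
  "cov_tensor20 \<Gamma> a p c i j k =
     partial k (\<lambda>x. a (pt c x) c $ i $ j) (coord c p) +
     (\<Sum>s\<in>UNIV. \<Gamma> p c i k s * a p c $ s $ j) + (\<Sum>s\<in>UNIV. \<Gamma> p c j k s * a p c $ i $ s)"

text \<open>\<open>dmetric g p c k i j\<close> is the \<open>k\<close>-th partial derivative of the component \<open>g\<^sub>i\<^sub>j\<close>.\<close>

definition dmetric ::
    "('a \<Rightarrow> ('a, 'n::finite) chart \<Rightarrow> real^'n^'n) \<Rightarrow> 'a \<Rightarrow> ('a, 'n) chart \<Rightarrow>
     'n \<Rightarrow> 'n \<Rightarrow> 'n \<Rightarrow> real" where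
  "dmetric g p c k i j = partial k (\<lambda>x. g (pt c x) c $ i $ j) (coord c p)"

definition levi_civita ::
    "('a \<Rightarrow> ('a, 'n::finite) chart \<Rightarrow> real^'n^'n) \<Rightarrow> ('a, 'n) connection" where
  "levi_civita g p c i j k =
     (\<Sum>l\<in>UNIV. matrix_inv (g p c) $ i $ l *
        (dmetric g p c j l k + dmetric g p c k l j - dmetric g p c l j k)) / 2"


section \<open>Curves, parallel transport and affine geodesics\<close>

definition open_interval :: "real set \<Rightarrow> bool" where
  "open_interval I \<longleftrightarrow> open I \<and> is_interval I \<and> I \<noteq> {}"

definition smooth_curve ::
    "('a::topological_space, 'n::finite) chart set \<Rightarrow> (real \<Rightarrow> 'a) \<Rightarrow> real set \<Rightarrow> bool" where
  "smooth_curve A \<gamma> I \<longleftrightarrow> open_interval I \<and> continuous_on I \<gamma> \<and>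
     (\<forall>c\<in>A. smooth_on {t\<in>I. \<gamma> t \<in> source c} (coord c \<circ> \<gamma>))"

definition velocity ::
    "(real \<Rightarrow> 'a) \<Rightarrow> ('a, 'n::finite) chart \<Rightarrow> real \<Rightarrow> real^'n" where
  "velocity \<gamma> c t = vector_derivative (coord c \<circ> \<gamma>) (at t)"

definition parallel_along ::
    "('a, 'n::finite) chart set \<Rightarrow> ('a, 'n) connection \<Rightarrow> (real \<Rightarrow> 'a) \<Rightarrow> real set \<Rightarrow>
     (real \<Rightarrow> ('a, 'n) tangent) \<Rightarrow> bool" where
  "parallel_along A \<Gamma> \<gamma> I \<xi> \<longleftrightarrow>
     (\<forall>t\<in>I. \<xi> t \<in> tangent_space A (\<gamma> t)) \<and>
     (\<forall>c\<in>A. \<forall>t\<in>I. \<gamma> t \<in> source c \<longrightarrow>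
        ((\<lambda>s. \<xi> s c) has_vector_derivative
          (\<chi> i. - (\<Sum>j\<in>UNIV. \<Sum>k\<in>UNIV. \<Gamma> (\<gamma> t) c i j k * velocity \<gamma> c t $ j * \<xi> t c $ k)))
        (at t))"

definition affine_geodesic ::
    "('a::topological_space, 'n::finite) chart set \<Rightarrow> ('a, 'n) connection \<Rightarrow>
     (real \<Rightarrow> 'a) \<Rightarrow> real set \<Rightarrow> bool" where
  "affine_geodesic A \<Gamma> \<gamma> I \<longleftrightarrow> smooth_curve A \<gamma> I \<and>
     (\<forall>c\<in>A. \<forall>t\<in>I. \<gamma> t \<in> source c \<longrightarrow>
        (velocity \<gamma> c has_vector_derivative
          (\<chi> i. - (\<Sum>j\<in>UNIV. \<Sum>k\<in>UNIV.
                    \<Gamma> (\<gamma> t) c i j k * velocity \<gamma> c t $ j * velocity \<gamma> c t $ k)))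
        (at t))"

definition metric_geodesic ::
    "('a::topological_space, 'n::finite) chart set \<Rightarrow> ('a \<Rightarrow> ('a, 'n) chart \<Rightarrow> real^'n^'n) \<Rightarrow>
     (real \<Rightarrow> 'a) \<Rightarrow> real set \<Rightarrow> bool" where
  "metric_geodesic A g \<gamma> I \<longleftrightarrow>
     affine_geodesic A (levi_civita g) \<gamma> I \<and> \<not> (\<exists>p. \<forall>t\<in>I. \<gamma> t = p)"


section \<open>Finsler metrics\<close>

type_synonym ('a, 'n) finsler = "'a \<Rightarrow> ('a, 'n) tangent \<Rightarrow> real"

text \<open>The function \<open>F\<close> in the coordinates of the tangent bundle induced by the chart \<open>c\<close>.\<close>

definition in_coord ::
    "('a, 'n::finite) chart set \<Rightarrow> ('a, 'n) finsler \<Rightarrow> ('a, 'n) chart \<Rightarrow>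
     real^'n \<Rightarrow> real^'n \<Rightarrow> real" where
  "in_coord A F c x v = F (pt c x) (tvec A c (pt c x) v)"

definition finsler_metric ::
    "('a, 'n::finite) chart set \<Rightarrow> ('a, 'n) finsler \<Rightarrow> bool" where
  "finsler_metric A F \<longleftrightarrow>
     (\<forall>c\<in>A. smooth_on (target c \<times> (- {0})) (\<lambda>(x, v). in_coord A F c x v)) \<and>
     (\<forall>p. \<forall>\<xi> \<in> tangent_space A p.
        F p \<xi> \<ge> 0 \<and>
        (\<forall>r\<ge>0. F p (\<lambda>c. r *\<^sub>R \<xi> c) = r * F p \<xi>) \<and>
        (\<forall>\<eta> \<in> tangent_space A p. F p (\<lambda>c. \<xi> c + \<eta> c) \<le> F p \<xi> + F p \<eta>) \<and>
        (F p \<xi> = 0 \<longrightarrow> \<xi> = (\<lambda>c. 0)))"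

definition transport_preserves ::
    "('a::topological_space, 'n::finite) chart set \<Rightarrow> ('a, 'n) connection \<Rightarrow>
     ('a, 'n) finsler \<Rightarrow> bool" where
  "transport_preserves A \<Gamma> F \<longleftrightarrow>
     (\<forall>\<gamma> I \<xi>. smooth_curve A \<gamma> I \<and> parallel_along A \<Gamma> \<gamma> I \<xi> \<longrightarrow>
        (\<forall>s\<in>I. \<forall>t\<in>I. F (\<gamma> s) (\<xi> s) = F (\<gamma> t) (\<xi> t)))"

definition associated_connection ::
    "('a::topological_space, 'n::finite) chart set \<Rightarrow> ('a, 'n) finsler \<Rightarrow>
     ('a, 'n) connection \<Rightarrow> bool" where
  "associated_connection A F \<Gamma> \<longleftrightarrow> symmetric_connection A \<Gamma> \<and> transport_preserves A \<Gamma> F"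

definition berwald :: "('a::topological_space, 'n::finite) chart set \<Rightarrow> ('a, 'n) finsler \<Rightarrow> bool" where
  "berwald A F \<longleftrightarrow> finsler_metric A F \<and> (\<exists>\<Gamma>. associated_connection A F \<Gamma>)"

definition riemannian :: "('a, 'n::finite) chart set \<Rightarrow> ('a, 'n) finsler \<Rightarrow> bool" where
  "riemannian A F \<longleftrightarrow>
     (\<exists>g. riemannian_metric A g \<and>
        (\<forall>p. \<forall>\<xi> \<in> tangent_space A p. \<forall>c\<in>A. p \<in> source c \<longrightarrow>
           F p \<xi> = sqrt (\<xi> c \<bullet> (g p c *v \<xi> c))))"

definition essentially_berwald ::
    "('a::topological_space, 'n::finite) chart set \<Rightarrow> ('a, 'n) finsler \<Rightarrow> bool" where
  "essentially_berwald A F \<longleftrightarrow> berwald A F \<and> \<not> riemannian A F"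

definition lagrangian ::
    "('a, 'n::finite) chart set \<Rightarrow> ('a, 'n) finsler \<Rightarrow> ('a, 'n) chart \<Rightarrow>
     real^'n \<Rightarrow> real^'n \<Rightarrow> real" where
  "lagrangian A F c x v = (in_coord A F c x v)\<^sup>2 / 2"

definition finsler_geodesic ::
    "('a::topological_space, 'n::finite) chart set \<Rightarrow> ('a, 'n) finsler \<Rightarrow>
     (real \<Rightarrow> 'a) \<Rightarrow> real set \<Rightarrow> bool" where
  "finsler_geodesic A F \<gamma> I \<longleftrightarrow> smooth_curve A \<gamma> I \<and>
     (\<forall>c\<in>A. \<forall>t\<in>I. \<gamma> t \<in> source c \<longrightarrow> velocity \<gamma> c t \<noteq> 0 \<and>
        (\<forall>i. ((\<lambda>s. partial i (\<lambda>v. lagrangian A F c (coord c (\<gamma> s)) v) (velocity \<gamma> c s))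
               has_real_derivative
               partial i (\<lambda>x. lagrangian A F c x (velocity \<gamma> c t)) (coord c (\<gamma> t)))
             (at t)))"

text \<open>The curve \<open>\<gamma>\<close> on \<open>I\<close> becomes a geodesic of \<open>F\<close> after an orientation-preserving smooth change
  of parameter \<open>\<tau>\<close> (whose inverse is automatically smooth).\<close>

definition unparam_finsler_geodesic ::
    "('a::topological_space, 'n::finite) chart set \<Rightarrow> ('a, 'n) finsler \<Rightarrow>
     (real \<Rightarrow> 'a) \<Rightarrow> real set \<Rightarrow> bool" where
  "unparam_finsler_geodesic A F \<gamma> I \<longleftrightarrow>
     (\<exists>J \<tau>. open_interval J \<and> smooth_on J \<tau> \<and> (\<forall>t\<in>J. deriv \<tau> t > 0) \<and> \<tau> ` J = I \<and>
        finsler_geodesic A F (\<gamma> \<circ> \<tau>) J)"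

definition geodesically_equivalent ::
    "('a::topological_space, 'n::finite) chart set \<Rightarrow> ('a \<Rightarrow> ('a, 'n) chart \<Rightarrow> real^'n^'n) \<Rightarrow>
     ('a, 'n) finsler \<Rightarrow> bool" where
  "geodesically_equivalent A g F \<longleftrightarrow>
     (\<forall>\<gamma> I. metric_geodesic A g \<gamma> I \<longrightarrow> unparam_finsler_geodesic A F \<gamma> I)"

definition affine_equivalent ::
    "('a::topological_space, 'n::finite) chart set \<Rightarrow> ('a \<Rightarrow> ('a, 'n) chart \<Rightarrow> real^'n^'n) \<Rightarrow>
     ('a, 'n) finsler \<Rightarrow> bool" where
  "affine_equivalent A g F \<longleftrightarrow>
     (\<forall>\<gamma> I. metric_geodesic A g \<gamma> I \<longrightarrow> finsler_geodesic A F \<gamma> I)"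

text \<open>The explicit Christoffel symbols above are those of the torsion-free connection for which
  the metric is parallel.\<close>

lemma levi_civita_lower:
  assumes "invertible (g p c)"
  shows "(\<Sum>i\<in>UNIV. g p c $ m $ i * levi_civita g p c i j k) =
         (dmetric g p c j m k + dmetric g p c k m j - dmetric g p c m j k) / 2"
proof -
  let ?D = "\<lambda>l. dmetric g p c j l k + dmetric g p c k l j - dmetric g p c l j k"
  have "(\<Sum>i\<in>UNIV. g p c $ m $ i * levi_civita g p c i j k) =
      (\<Sum>i\<in>UNIV. \<Sum>l\<in>UNIV. g p c $ m $ i * matrix_inv (g p c) $ i $ l * (?D l / 2))"
    by (simp add: levi_civita_def sum_distrib_left sum_divide_distrib mult.assoc)
  also have "\<dots> = (\<Sum>l\<in>UNIV. \<Sum>i\<in>UNIV. g p c $ m $ i * matrix_inv (g p c) $ i $ l * (?D l / 2))"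
    by (rule sum.swap)
  also have "\<dots> = (\<Sum>l\<in>UNIV. (g p c ** matrix_inv (g p c)) $ m $ l * (?D l / 2))"
    by (simp only: matrix_matrix_mult_def vec_lambda_beta sum_distrib_right)
  also have "g p c ** matrix_inv (g p c) = mat 1"
    using assms unfolding invertible_def matrix_inv_def by (metis (mono_tags, lifting) someI_ex)
  also have "(\<Sum>l\<in>UNIV. mat 1 $ m $ l * (?D l / 2)) = (\<Sum>l\<in>UNIV. if l = m then ?D l / 2 else 0)"
    by (intro sum.cong) (auto simp: mat_def)
  finally show ?thesis by simp
qed

lemma levi_civita_metric:
  fixes A :: "('a::{t2_space,second_countable_topology}, 'n::finite) chart set"
  assumes "smooth_manifold A" "pseudo_riemannian_metric A g" "c \<in> A" "p \<in> source c"
  shows "levi_civita g p c i j k = levi_civita g p c i k j"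
    and "dmetric g p c k i j = (\<Sum>l\<in>UNIV. g p c $ l $ j * levi_civita g p c l k i) +
           (\<Sum>l\<in>UNIV. g p c $ i $ l * levi_civita g p c l k j)"
proof -
  have gs: "g q c $ a $ b = g q c $ b $ a" if "q \<in> source c" for q a b
  proof -
    have "transpose (g q c) = g q c"
      using assms that by (auto simp: pseudo_riemannian_metric_def symmetric_tensor_def)
    then show ?thesis by (metis transpose_def vec_lambda_beta)
  qed
  have opn: "open (target c)" and xp: "coord c p \<in> target c"
    using assms by (auto simp: smooth_manifold_def is_chart_def)
  have comp: "(\<lambda>x. g (pt c x) c $ a $ b) differentiable (at (coord c p))" for a b
  proof -
    have "smooth_on (target c) (\<lambda>x. g (pt c x) c)"
      using assms by (auto simp: pseudo_riemannian_metric_def tensor02_def)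
    then have "Ck_on (Suc 0) (target c) (\<lambda>x. g (pt c x) c)"
      unfolding smooth_on_def by blast
    then have "(\<lambda>x. g (pt c x) c) differentiable (at (coord c p))"
      using xp unfolding Ck_on.simps by blast
    then obtain D where D: "((\<lambda>x. g (pt c x) c) has_derivative D) (at (coord c p))"
      by (auto simp: differentiable_def)
    have "((\<lambda>x. g (pt c x) c $ a $ b) has_derivative (\<lambda>h. D h $ a $ b)) (at (coord c p))"
      by (intro bounded_linear.has_derivative[OF bounded_linear_vec_nth] D)
    then show ?thesis by (auto simp: differentiable_def)
  qed
  have ds: "dmetric g p c m a b = dmetric g p c m b a" for m a b
  proof -
    have eq: "g (pt c x) c $ a $ b = g (pt c x) c $ b $ a" if "x \<in> target c" for x
      using gs[OF inv_into_into[OF that]] .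
    have "((\<lambda>x. g (pt c x) c $ b $ a) has_derivative
        frechet_derivative (\<lambda>x. g (pt c x) c $ a $ b) (at (coord c p))) (at (coord c p))"
      by (rule has_derivative_transform_within_open[OF
            comp[of a b, unfolded frechet_derivative_works] opn xp eq])
    then show ?thesis
      unfolding dmetric_def partial_def by (metis frechet_derivative_at)
  qed
  show "levi_civita g p c i j k = levi_civita g p c i k j"
    unfolding levi_civita_def by (simp add: ds[of _ j k] algebra_simps)
  have inv: "invertible (g p c)"
    using assms by (auto simp: pseudo_riemannian_metric_def)
  have "(\<Sum>l\<in>UNIV. g p c $ l $ j * levi_civita g p c l k i) =
      (\<Sum>l\<in>UNIV. g p c $ j $ l * levi_civita g p c l k i)"
    using gs assms(4) by (intro sum.cong) auto
  then show "dmetric g p c k i j = (\<Sum>l\<in>UNIV. g p c $ l $ j * levi_civita g p c l k i) +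
      (\<Sum>l\<in>UNIV. g p c $ i $ l * levi_civita g p c l k j)"
    using levi_civita_lower[of g p c j k i, OF inv] levi_civita_lower[of g p c i k j, OF inv]
      ds[of k j i] ds[of i j k] ds[of j i k] by simp
qed

end

theory Submission
  imports Defs
begin

text \<open>
  Parallel transport along coordinate lines gives \<open>\<partial>L/\<partial>x\<^sup>k = \<Gamma>\<^sup>i\<^sub>k\<^sub>j v\<^sup>j \<partial>L/\<partial>v\<^sup>i\<close> for \<open>L = F\<^sup>2/2\<close>, so \<open>L\<close> is
  invariant under the curvature operators \<open>R(u,w)\<close>. These are skew for an inner product invariant
  under the linear isometries of \<open>F\<^sub>p\<close>, and the pair symmetry of \<open>R\<close> turns the invariance into
  \<open>R(\<xi>,\<eta>) = 0\<close>, where \<open>\<eta>\<close> is the gradient of \<open>L\<close> at \<open>\<xi>\<close>. If \<open>\<xi>\<close> and \<open>\<eta>\<close> were parallel for all \<open>\<xi>\<close>,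
  then \<open>F\<^sub>p\<close> would be quadratic, and by parallel transport \<open>F\<close> would be Riemannian.

  The vertical Hessian of \<open>L\<close> is nondegenerate on an open cone. There the geodesics of \<open>g\<close> force
  \<open>\<Gamma>\<close> and the Levi-Civita connection of \<open>g\<close> to be projectively equivalent with respect to a
  1-form \<open>\<phi>\<close>. It is exact, \<open>\<phi> = d\<psi>\<close>: compare \<open>det g\<close> with the \<open>\<Gamma>\<close>-parallel volume
  given by the largest determinant of a frame of \<open>F\<close>-unit vectors. Then \<open>a = exp(2\<psi>) g\<^sup>-\<^sup>1\<close> and
  \<open>\<lambda> = -a\<phi>\<close> satisfy the first equation. Its Ricci identity, contracted with independent \<open>\<xi>\<close> and
  \<open>\<eta>\<close> for which \<open>R(\<xi>,\<eta>) = 0\<close>, gives \<open>\<nabla>\<lambda> = \<mu> Id\<close> with \<open>\<mu>\<close> constant.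
\<close>

subsection \<open>Smooth maps\<close>

text \<open>The obstacle is that \<open>F\<close> may fail to be strictly convex: where the vertical
  Hessian is singular, the Euler-Lagrange equations do not determine the acceleration. The remedy is
  polynomial. The relation between the two connections is cubic in the velocity, so once it holds on
  an open cone it holds everywhere. Pair symmetry works as follows: invariance of \<open>L\<close>
  says that R(u,w)\<xi> is orthogonal to \<eta> for all u, w; hence R(\<xi>,\<eta>)u is orthogonal
  to every w. The inner product is used at one point at a time. It arises as the unique minimizer of
  an invariant convex problem, which takes the place of averaging over the isometry group. The
  potential \<psi> is a function on the whole manifold, since under a change of chart the density of
  the metric and the determinant of frames change by inverse factors. Therefore a and \<lambda> are
  global tensor fields. Finally, a is invertible, so \<lambda> = 0 would give \<phi> = 0: the
  connections would coincide and every geodesic of g would be an extremal of \<open>F\<close> in its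
  own parameter, contrary to the assumption.\<close>

lemma frechet_derivative_cong_open:
  assumes "open S" "x \<in> S" "\<And>y. y \<in> S \<Longrightarrow> f y = g y"
  shows "frechet_derivative f (at x) = frechet_derivative g (at x)"
proof -
  have "(f has_derivative D) (at x) \<longleftrightarrow> (g has_derivative D) (at x)" for D
    using assms by (metis has_derivative_transform_within_open)
  then show ?thesis unfolding frechet_derivative_def by simp
qed

lemma differentiable_cong_open:
  assumes "open S" "x \<in> S" "\<And>y. y \<in> S \<Longrightarrow> f y = g y"
  shows "f differentiable (at x) \<longleftrightarrow> g differentiable (at x)"
  using assms unfolding differentiable_def by (metis has_derivative_transform_within_open)

lemma Ck_on_cong:
  assumes "open S" "\<And>y. y \<in> S \<Longrightarrow> f y = g y"
  shows "Ck_on k S f \<longleftrightarrow> Ck_on k S g"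
  using assms(2)
proof (induction k arbitrary: f g)
  case 0
  then show ?case using continuous_on_cong[of S S f g] by simp
next
  case (Suc k)
  have "f differentiable (at x) \<longleftrightarrow> g differentiable (at x)" if "x \<in> S" for x
    using differentiable_cong_open[OF assms(1) that] Suc.prems by blast
  moreover have "Ck_on k S (\<lambda>x. frechet_derivative f (at x) v) \<longleftrightarrow>
      Ck_on k S (\<lambda>x. frechet_derivative g (at x) v)" for v
    by (rule Suc.IH) (metis frechet_derivative_cong_open[OF assms(1)] Suc.prems)
  ultimately show ?case by simp
qed

lemma smooth_on_cong:
  assumes "open S" "\<And>y. y \<in> S \<Longrightarrow> f y = g y"
  shows "smooth_on S f \<longleftrightarrow> smooth_on S g"
  using Ck_on_cong[of S f g] assms unfolding smooth_on_def by blast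

lemma Ck_on_Suc_imp:
  "Ck_on (Suc k) S f \<Longrightarrow> Ck_on k S f"
proof (induction k arbitrary: f)
  case 0
  then show ?case
    by (auto intro!: continuous_at_imp_continuous_on differentiable_imp_continuous_within)
next
  case (Suc k)
  then show ?case by (metis Ck_on.simps(2))
qed

lemma Ck_on_subset: "Ck_on k S f \<Longrightarrow> T \<subseteq> S \<Longrightarrow> Ck_on k T f"
  by (induction k arbitrary: f) (auto intro: continuous_on_subset)

lemma smooth_on_subset: "smooth_on S f \<Longrightarrow> T \<subseteq> S \<Longrightarrow> smooth_on T f"
  unfolding smooth_on_def using Ck_on_subset by blast

text \<open>The entry point of all smoothness inductions: on an open set any explicit formula for
  the derivative may replace the chosen value \<open>frechet_derivative\<close>.\<close>

lemma Ck_on_SucI: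
  assumes "open S" "\<And>x. x \<in> S \<Longrightarrow> (f has_derivative f' x) (at x)" "\<And>v. Ck_on k S (\<lambda>x. f' x v)"
  shows "Ck_on (Suc k) S f"
proof -
  have "Ck_on k S (\<lambda>x. frechet_derivative f (at x) v)" for v
  proof -
    have "frechet_derivative f (at x) v = f' x v" if "x \<in> S" for x
      using frechet_derivative_at[OF assms(2)[OF that]] by simp
    then show ?thesis
      using assms(3)[of v] Ck_on_cong[OF assms(1), of "\<lambda>x. frechet_derivative f (at x) v" "\<lambda>x. f' x v"]
      by blast
  qed
  then show ?thesis using assms by (auto simp: differentiable_def)
qed

lemma Ck_on_SucD:
  assumes "Ck_on (Suc k) S f"
  shows "x \<in> S \<Longrightarrow> (f has_derivative frechet_derivative f (at x)) (at x)"
    and "Ck_on k S (\<lambda>x. frechet_derivative f (at x) v)"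
  using assms by (auto simp: frechet_derivative_works)

lemma smooth_on_derivative:
  "smooth_on S f \<Longrightarrow> x \<in> S \<Longrightarrow> (f has_derivative frechet_derivative f (at x)) (at x)"
  unfolding smooth_on_def by (metis Ck_on_SucD(1))

lemma smooth_on_frechet: "smooth_on S f \<Longrightarrow> smooth_on S (\<lambda>x. frechet_derivative f (at x) v)"
  unfolding smooth_on_def by (metis Ck_on_SucD(2))

lemma smooth_onI_derivative:
  assumes "open S" "\<And>x. x \<in> S \<Longrightarrow> (f has_derivative f' x) (at x)" "\<And>v. smooth_on S (\<lambda>x. f' x v)"
  shows "smooth_on S f"
  unfolding smooth_on_def
proof
  fix k show "Ck_on k S f"
    using Ck_on_SucI[of S f f' k] assms Ck_on_Suc_imp unfolding smooth_on_def by blast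
qed

lemma smooth_on_continuous: "smooth_on S f \<Longrightarrow> continuous_on S f"
  unfolding smooth_on_def by (metis Ck_on.simps(1))

lemma smooth_on_linear_frechet:
  "smooth_on S f \<Longrightarrow> x \<in> S \<Longrightarrow> linear (frechet_derivative f (at x))"
  using smooth_on_derivative has_derivative_linear by blast

lemma Ck_on_const: "Ck_on k S (\<lambda>x. c)"
  by (induction k arbitrary: c) (auto simp: frechet_derivative_const)

lemma Ck_on_bounded_linear:
  assumes "bounded_linear h" "Ck_on k S f" "open S"
  shows "Ck_on k S (\<lambda>x. h (f x))"
  using assms(2)
proof (induction k arbitrary: f)
  case 0
  then show ?case
    using assms(1) by (auto intro: bounded_linear.continuous_on)
next
  case (Suc k)
  show ?case
  proof (rule Ck_on_SucI[OF assms(3)])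
    show "((\<lambda>x. h (f x)) has_derivative (\<lambda>v. h (frechet_derivative f (at x) v))) (at x)"
      if "x \<in> S" for x
      using Ck_on_SucD(1)[OF Suc.prems that] bounded_linear.has_derivative[OF assms(1)] by blast
    show "Ck_on k S (\<lambda>x. h (frechet_derivative f (at x) v))" for v
      using Suc.IH Ck_on_SucD(2)[OF Suc.prems] by blast
  qed
qed

lemma Ck_on_id: "open S \<Longrightarrow> Ck_on k S (\<lambda>x. x)"
proof (cases k)
  case (Suc m)
  assume "open S"
  then show ?thesis
    unfolding Suc by (rule Ck_on_SucI) (auto intro!: Ck_on_const has_derivative_ident)
qed auto

lemma Ck_on_add:
  assumes "Ck_on k S f" "Ck_on k S g" "open S"
  shows "Ck_on k S (\<lambda>x. f x + g x)"
  using assms(1,2)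
proof (induction k arbitrary: f g)
  case 0
  then show ?case by (auto intro: continuous_on_add)
next
  case (Suc k)
  show ?case
  proof (rule Ck_on_SucI[OF assms(3)])
    show "((\<lambda>x. f x + g x) has_derivative
        (\<lambda>v. frechet_derivative f (at x) v + frechet_derivative g (at x) v)) (at x)"
      if "x \<in> S" for x
      using Ck_on_SucD(1)[OF Suc.prems(1) that] Ck_on_SucD(1)[OF Suc.prems(2) that]
      by (rule has_derivative_add)
    show "Ck_on k S (\<lambda>x. frechet_derivative f (at x) v + frechet_derivative g (at x) v)" for v
      using Suc.IH Ck_on_SucD(2) Suc.prems by blast
  qed
qed

lemma Ck_on_sum:
  assumes "\<And>i. i \<in> I \<Longrightarrow> Ck_on k S (f i)" "open S"
  shows "Ck_on k S (\<lambda>x. \<Sum>i\<in>I. f i x)"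
  using assms(1)
proof (induction I rule: infinite_finite_induct)
  case (insert i I)
  have "Ck_on k S (\<lambda>x. f i x + (\<Sum>j\<in>I. f j x))"
    using insert by (intro Ck_on_add assms(2)) auto
  then show ?case using insert by simp
qed (auto intro: Ck_on_const)

lemma Ck_on_bilinear:
  assumes "bounded_bilinear prd" "Ck_on k S f" "Ck_on k S g" "open S"
  shows "Ck_on k S (\<lambda>x. prd (f x) (g x))"
  using assms(2,3)
proof (induction k arbitrary: f g)
  case 0
  then show ?case using bounded_bilinear.continuous_on[OF assms(1)] by auto
next
  case (Suc k)
  show ?case
  proof (rule Ck_on_SucI[OF assms(4)])
    show "((\<lambda>x. prd (f x) (g x)) has_derivative
        (\<lambda>v. prd (f x) (frechet_derivative g (at x) v) + prd (frechet_derivative f (at x) v) (g x))) (at x)"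
      if "x \<in> S" for x
      using Ck_on_SucD(1)[OF Suc.prems(1) that] Ck_on_SucD(1)[OF Suc.prems(2) that]
      by (rule bounded_bilinear.FDERIV[OF assms(1)])
    show "Ck_on k S (\<lambda>x. prd (f x) (frechet_derivative g (at x) v) + prd (frechet_derivative f (at x) v) (g x))" for v
      by (intro Ck_on_add assms(4) Suc.IH Ck_on_SucD(2)[OF Suc.prems(1)] Ck_on_SucD(2)[OF Suc.prems(2)]
          Ck_on_Suc_imp[OF Suc.prems(1)] Ck_on_Suc_imp[OF Suc.prems(2)])
  qed
qed

lemma linear_Basis_expand:
  fixes f :: "'a::euclidean_space \<Rightarrow> 'b::real_vector"
  assumes "linear f"
  shows "f w = (\<Sum>b\<in>Basis. (w \<bullet> b) *\<^sub>R f b)"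
proof -
  have "f (\<Sum>b\<in>Basis. (w \<bullet> b) *\<^sub>R b) = (\<Sum>b\<in>Basis. (w \<bullet> b) *\<^sub>R f b)"
    using assms by (simp add: linear_sum linear_cmul)
  then show ?thesis by (simp only: euclidean_representation)
qed

text \<open>The chain rule produces a derivative of f in a direction that itself depends on x, while
  the induction hypothesis speaks of fixed directions. Expanding the direction in
  \<open>Basis\<close> turns it into a finite sum of products; this is why the middle space is
  Euclidean.\<close>

lemma Ck_on_compose:
  fixes f :: "'b::euclidean_space \<Rightarrow> 'c::real_normed_vector" and g :: "'a::real_normed_vector \<Rightarrow> 'b"
  assumes "Ck_on k T f" "Ck_on k S g" "open S" "open T" "g ` S \<subseteq> T"
  shows "Ck_on k S (\<lambda>x. f (g x))"
  using assms(1,2)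
proof (induction k arbitrary: f)
  case 0
  then show ?case using continuous_on_compose2[OF _ _ assms(5)] by auto
next
  case (Suc k)
  show ?case
  proof (rule Ck_on_SucI[OF assms(3)])
    fix x assume x: "x \<in> S"
    let ?D = "frechet_derivative g (at x)"
    have g: "(g has_derivative ?D) (at x)" using Ck_on_SucD(1)[OF Suc.prems(2) x] .
    have f: "(f has_derivative frechet_derivative f (at (g x))) (at (g x))"
      using Ck_on_SucD(1)[OF Suc.prems(1)] x assms(5) by blast
    have "(\<lambda>v. frechet_derivative f (at (g x)) (?D v)) =
        (\<lambda>v. \<Sum>b\<in>Basis. (?D v \<bullet> b) *\<^sub>R frechet_derivative f (at (g x)) b)"
      by (rule ext) (rule linear_Basis_expand[OF has_derivative_linear[OF f]])
    with has_derivative_compose[OF g f] show "((\<lambda>x. f (g x)) has_derivative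
        (\<lambda>v. \<Sum>b\<in>Basis. (?D v \<bullet> b) *\<^sub>R frechet_derivative f (at (g x)) b)) (at x)"
      by (rule back_subst[where P="\<lambda>D. ((\<lambda>x. f (g x)) has_derivative D) (at x)"])
  next
    show "Ck_on k S (\<lambda>x. \<Sum>b\<in>Basis. (frechet_derivative g (at x) v \<bullet> b) *\<^sub>R frechet_derivative f (at (g x)) b)" for v
    proof (intro Ck_on_sum assms(3) Ck_on_bilinear[OF bounded_bilinear_scaleR])
      fix b
      show "Ck_on k S (\<lambda>x. frechet_derivative f (at (g x)) b)"
        by (rule Suc.IH[OF Ck_on_SucD(2)[OF Suc.prems(1)] Ck_on_Suc_imp[OF Suc.prems(2)]])
      show "Ck_on k S (\<lambda>x. frechet_derivative g (at x) v \<bullet> b)"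
        by (rule Ck_on_bounded_linear[OF bounded_linear_inner_left Ck_on_SucD(2)[OF Suc.prems(2)] assms(3)])
    qed
  qed
qed

lemma smooth_on_const: "smooth_on S (\<lambda>x. c)"
  unfolding smooth_on_def by (simp add: Ck_on_const)
lemma smooth_on_id: "open S \<Longrightarrow> smooth_on S (\<lambda>x. x)"
  unfolding smooth_on_def by (simp add: Ck_on_id)
lemma smooth_on_bounded_linear:
  "bounded_linear h \<Longrightarrow> smooth_on S f \<Longrightarrow> open S \<Longrightarrow> smooth_on S (\<lambda>x. h (f x))"
  unfolding smooth_on_def using Ck_on_bounded_linear[of h _ S f] by blast
lemma smooth_on_add:
  "smooth_on S f \<Longrightarrow> smooth_on S g \<Longrightarrow> open S \<Longrightarrow> smooth_on S (\<lambda>x. f x + g x)"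
  unfolding smooth_on_def using Ck_on_add[of _ S f g] by blast
lemma smooth_on_sum:
  "(\<And>i. i \<in> I \<Longrightarrow> smooth_on S (f i)) \<Longrightarrow> open S \<Longrightarrow> smooth_on S (\<lambda>x. \<Sum>i\<in>I. f i x)"
  unfolding smooth_on_def using Ck_on_sum[of I _ S f] by blast
lemma smooth_on_bilinear:
  "bounded_bilinear prd \<Longrightarrow> smooth_on S f \<Longrightarrow> smooth_on S g \<Longrightarrow> open S \<Longrightarrow> smooth_on S (\<lambda>x. prd (f x) (g x))"
  unfolding smooth_on_def using Ck_on_bilinear[of prd _ S f g] by blast
lemmas smooth_on_scaleR = smooth_on_bilinear[OF bounded_bilinear_scaleR]
  and smooth_on_mult = smooth_on_bilinear[OF bounded_bilinear_mult]
  and smooth_on_inner = smooth_on_bilinear[OF bounded_bilinear_inner]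
  and smooth_on_nth = smooth_on_bounded_linear[OF bounded_linear_vec_nth]
lemma smooth_on_compose:
  fixes f :: "'b::euclidean_space \<Rightarrow> 'c::real_normed_vector" and g :: "'a::real_normed_vector \<Rightarrow> 'b"
  shows "smooth_on T f \<Longrightarrow> smooth_on S g \<Longrightarrow> open S \<Longrightarrow> open T \<Longrightarrow> g ` S \<subseteq> T \<Longrightarrow> smooth_on S (\<lambda>x. f (g x))"
  unfolding smooth_on_def using Ck_on_compose[of _ T f S g] by blast

lemma smooth_on_uminus: "smooth_on S f \<Longrightarrow> open S \<Longrightarrow> smooth_on S (\<lambda>x. - f x)"
  by (rule smooth_on_bounded_linear[OF bounded_linear_minus[OF bounded_linear_ident]])
lemma smooth_on_diff:
  "smooth_on S f \<Longrightarrow> smooth_on S g \<Longrightarrow> open S \<Longrightarrow> smooth_on S (\<lambda>x. f x - g x)"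
  using smooth_on_add[of S f "\<lambda>x. - g x"] smooth_on_uminus[of S g] by simp

lemma smooth_on_Pair:
  assumes "smooth_on S f" "smooth_on S g" "open S"
  shows "smooth_on S (\<lambda>x. (f x, g x))"
proof -
  have 1: "bounded_linear (\<lambda>x. (x, 0))" and 2: "bounded_linear (\<lambda>x. (0, x))"
    by (auto intro: bounded_linear_Pair bounded_linear_ident bounded_linear_zero)
  have "smooth_on S (\<lambda>x. (f x, 0) + (0, g x))"
    by (rule smooth_on_add[OF smooth_on_bounded_linear[OF 1 assms(1,3)]
          smooth_on_bounded_linear[OF 2 assms(2,3)] assms(3)])
  then show ?thesis by simp
qed

lemma smooth_on_vec_lambda:
  fixes f :: "'n::finite \<Rightarrow> 'a::real_normed_vector \<Rightarrow> 'b::euclidean_space"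
  assumes "\<And>i. smooth_on S (f i)" "open S"
  shows "smooth_on S (\<lambda>x. \<chi> i. f i x)"
proof -
  have bl: "bounded_linear (axis i :: 'b \<Rightarrow> 'b^'n)" for i
    unfolding linear_conv_bounded_linear[symmetric]
    by (rule linearI) (auto simp: axis_def vec_eq_iff)
  have "smooth_on S (\<lambda>x. \<Sum>i\<in>UNIV. axis i (f i x))"
    by (rule smooth_on_sum[OF smooth_on_bounded_linear[OF bl assms] assms(2)])
  moreover have "(\<Sum>i\<in>UNIV. axis i (f i x)) = (\<chi> i. f i x)" for x
    by (simp add: vec_eq_iff axis_def if_distrib cong: if_cong)
  ultimately show ?thesis by simp
qed

lemma smooth_on_prod:
  fixes f :: "'i \<Rightarrow> 'a::real_normed_vector \<Rightarrow> real"
  assumes "\<And>i. i \<in> I \<Longrightarrow> smooth_on S (f i)" "open S"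
  shows "smooth_on S (\<lambda>x. \<Prod>i\<in>I. f i x)"
  using assms(1)
proof (induction I rule: infinite_finite_induct)
  case (insert i I)
  have "smooth_on S (\<lambda>x. f i x * (\<Prod>j\<in>I. f j x))"
    using insert by (intro smooth_on_mult assms(2)) auto
  then show ?case using insert by simp
qed (auto intro: smooth_on_const)

lemma smooth_on_det:
  fixes f :: "'a::real_normed_vector \<Rightarrow> real^'n^'n"
  assumes "\<And>i j. smooth_on S (\<lambda>x. f x $ i $ j)" "open S"
  shows "smooth_on S (\<lambda>x. det (f x))"
proof -
  have 1: "smooth_on S (\<lambda>x. \<Prod>i\<in>UNIV. f x $ i $ p i)" for p
    by (rule smooth_on_prod[OF assms])
  show ?thesis
    unfolding det_def by (rule smooth_on_sum[OF smooth_on_mult[OF smooth_on_const 1 assms(2)] assms(2)])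
qed

text \<open>The derivative is a product of two copies of the function itself, so the induction on k
  closes.\<close>

lemma smooth_on_inverse: "smooth_on (- {0::real}) inverse"
  unfolding smooth_on_def
proof
  fix k show "Ck_on k (- {0::real}) inverse"
  proof (induction k)
    case 0
    then show ?case by (auto intro!: continuous_intros)
  next
    case (Suc k)
    show ?case
    proof (rule Ck_on_SucI[where f'="\<lambda>x v. - (inverse x * (v * inverse x))"])
      show "Ck_on k (- {0::real}) (\<lambda>x. - (inverse x * (v * inverse x)))" for v
        by (intro Ck_on_bounded_linear[OF bounded_linear_minus[OF bounded_linear_ident]]
            Ck_on_bilinear[OF bounded_bilinear_mult] Suc Ck_on_const) auto
      show "(inverse has_derivative (\<lambda>v. - (inverse x * (v * inverse x)))) (at x)" if "x \<in> - {0}" for x::real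
        using that has_derivative_inverse'[of x UNIV] by (simp add: mult.assoc)
    qed auto
  qed
qed

lemma smooth_on_exp: "smooth_on (UNIV :: real set) exp"
  unfolding smooth_on_def
proof
  fix k show "Ck_on k (UNIV :: real set) exp"
  proof (induction k)
    case 0
    then show ?case by (auto intro!: continuous_intros)
  next
    case (Suc k)
    show ?case
    proof (rule Ck_on_SucI[where f'="\<lambda>x v. v * exp x"])
      show "Ck_on k UNIV (\<lambda>x. v * exp x)" for v :: real
        by (intro Ck_on_bilinear[OF bounded_bilinear_mult] Suc Ck_on_const) auto
      show "(exp has_derivative (\<lambda>v. v * exp x)) (at x)" for x::real
        using DERIV_exp[of x] by (simp add: has_field_derivative_def mult_commute_abs)
    qed auto
  qed
qed

lemma smooth_on_divide:
  fixes f g :: "'a::real_normed_vector \<Rightarrow> real"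
  assumes "smooth_on S f" "smooth_on S g" "open S" "\<And>x. x \<in> S \<Longrightarrow> g x \<noteq> 0"
  shows "smooth_on S (\<lambda>x. f x / g x)"
  unfolding divide_inverse
  by (intro smooth_on_mult smooth_on_compose[OF smooth_on_inverse] assms) (use assms(4) in auto)

section \<open>Smooth dependence of the inverse matrix\<close>

lemma matrix_inv_right: "invertible (M::real^'n^'n) \<Longrightarrow> M ** matrix_inv M = mat 1"
  and matrix_inv_left: "invertible (M::real^'n^'n) \<Longrightarrow> matrix_inv M ** M = mat 1"
  unfolding invertible_def matrix_inv_def by (metis (mono_tags, lifting) someI_ex)+

text \<open>Column l of the inverse solves a linear system with right-hand side
  \<open>axis l 1\<close>. Cramer's rule writes its entries as quotients of determinants, which are
  visibly smooth in M.\<close>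

lemma matrix_inv_cramer:
  fixes M :: "real^'n^'n"
  assumes "det M \<noteq> 0"
  shows "matrix_inv M $ k $ l = det (\<chi> i j. if j = k then axis l 1 $ i else M $ i $ j) / det M"
proof -
  have "invertible M" using assms invertible_det_nz by blast
  then have "M *v (matrix_inv M *v axis l 1) = axis l 1"
    using matrix_inv_right[OF \<open>invertible M\<close>] by (simp add: matrix_vector_mul_assoc)
  then have "matrix_inv M *v axis l 1 = (\<chi> k. det (\<chi> i j. if j = k then axis l 1 $ i else M $ i $ j) / det M)"
    using cramer[OF assms] by blast
  then show ?thesis
    by (metis (no_types, lifting) column_def matrix_vector_mult_basis vec_lambda_beta)
qed

lemma smooth_on_matrix_inv:
  fixes f :: "'a::real_normed_vector \<Rightarrow> real^'n^'n"
  assumes "\<And>i j. smooth_on S (\<lambda>x. f x $ i $ j)" "open S" "\<And>x. x \<in> S \<Longrightarrow> invertible (f x)"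
  shows "smooth_on S (\<lambda>x. matrix_inv (f x) $ k $ l)"
proof -
  have nz: "det (f x) \<noteq> 0" if "x \<in> S" for x using assms(3)[OF that] invertible_det_nz by blast
  have 1: "smooth_on S (\<lambda>x. (\<chi> i j. if j = k then axis l 1 $ i else f x $ i $ j) $ i $ j)" for i j
    using assms(1)[of i j] by (cases "j = k") (simp_all add: smooth_on_const)
  have "smooth_on S (\<lambda>x. det (\<chi> i j. if j = k then axis l 1 $ i else f x $ i $ j) / det (f x))"
    by (rule smooth_on_divide[OF smooth_on_det[OF 1 assms(2)] smooth_on_det[OF assms(1,2)] assms(2) nz])
  then show ?thesis
    using smooth_on_cong[OF assms(2), of "\<lambda>x. matrix_inv (f x) $ k $ l"
        "\<lambda>x. det (\<chi> i j. if j = k then axis l 1 $ i else f x $ i $ j) / det (f x)"]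
      matrix_inv_cramer[OF nz] by blast
qed

section \<open>Mean values, mixed second derivatives and differentiability from directional
  derivatives\<close>

lemma frechet_derivative_linear:
  assumes "bounded_linear h" "f differentiable (at x)"
  shows "frechet_derivative (\<lambda>y. h (f y)) (at x) v = h (frechet_derivative f (at x) v)"
proof -
  have "((\<lambda>y. h (f y)) has_derivative (\<lambda>v. h (frechet_derivative f (at x) v))) (at x)"
    by (rule bounded_linear.has_derivative[OF assms(1) frechet_derivative_works[THEN iffD1, OF assms(2)]])
  from frechet_derivative_at[OF this] show ?thesis by metis
qed

lemma has_derivative_along_line:
  fixes f :: "'a::real_normed_vector \<Rightarrow> 'b::real_normed_vector"
  assumes "(f has_derivative D) (at (p + a *\<^sub>R u))"
  shows "((\<lambda>a. f (p + a *\<^sub>R u)) has_derivative (\<lambda>h. h *\<^sub>R D u)) (at a)"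
proof -
  have "((\<lambda>a. p + a *\<^sub>R u) has_derivative (\<lambda>h. h *\<^sub>R u)) (at a)"
    by (auto intro!: derivative_eq_intros)
  from has_derivative_compose[OF this assms] show ?thesis
    by (simp add: linear_cmul[OF has_derivative_linear[OF assms]])
qed

lemma mvt_from_0:
  fixes f :: "real \<Rightarrow> real"
  assumes s: "0 < s" and "\<And>t. 0 \<le> t \<Longrightarrow> t \<le> s \<Longrightarrow> (f has_derivative (\<lambda>h. h * f' t)) (at t)"
  obtains t where "0 < t" "t < s" "f s - f 0 = s * f' t"
proof -
  have "(f has_derivative (\<lambda>h. h * f' t)) (at t within {0..s})" if "0 \<le> t" "t \<le> s" for t
    by (rule has_derivative_at_withinI[OF assms(2)[OF that]])
  from mvt_simple[OF s this] obtain t where "t \<in> {0<..<s}" "f s - f 0 = (s - 0) * f' t" by blast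
  then show ?thesis by (intro that[of t]) auto
qed

text \<open>The second difference of f over a small parallelogram is symmetric in u and v. The mean
  value theorem, applied in either order, makes it s * s times one or the other mixed derivative at
  a nearby point; continuity of both then forces equality at x.\<close>

lemma schwarz_real:
  fixes f :: "'a::real_normed_vector \<Rightarrow> real"
  assumes "Ck_on 2 S f" "open S" "x \<in> S"
  shows "frechet_derivative (\<lambda>y. frechet_derivative f (at y) u) (at x) v =
         frechet_derivative (\<lambda>y. frechet_derivative f (at y) v) (at x) u"
proof -
  let ?D = "\<lambda>u y. frechet_derivative f (at y) u"
  let ?D2 = "\<lambda>u v y. frechet_derivative (?D u) (at y) v"
  have C2: "Ck_on (Suc (Suc 0)) S f" using assms(1) by (simp only: numeral_2_eq_2)
  have d1: "(f has_derivative frechet_derivative f (at y)) (at y)" if "y \<in> S" for y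
    using Ck_on_SucD(1)[OF C2 that] .
  have d2: "(?D u has_derivative frechet_derivative (?D u) (at y)) (at y)" if "y \<in> S" for y u
    using Ck_on_SucD(1)[OF Ck_on_SucD(2)[OF C2] that] .
  have cont: "continuous_on S (?D2 u v)" for u v
    using Ck_on_SucD(2)[OF Ck_on_SucD(2)[OF C2]] by simp
  \<comment> \<open>Mean value theorem twice: for the difference of f between two opposite sides, as
    a function of the u-parameter, and then for the u-derivative as a function of the
    v-parameter.\<close>
  have key: "\<exists>s1 t1. 0 < s1 \<and> s1 < s \<and> 0 < t1 \<and> t1 < s \<and>
      f (x + s *\<^sub>R u + s *\<^sub>R v) - f (x + s *\<^sub>R u) - f (x + s *\<^sub>R v) + f x =
      s * s * ?D2 u v (x + s1 *\<^sub>R u + t1 *\<^sub>R v)"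
    if s: "0 < s" and sq: "\<And>a b. 0 \<le> a \<Longrightarrow> a \<le> s \<Longrightarrow> 0 \<le> b \<Longrightarrow> b \<le> s \<Longrightarrow> x + a *\<^sub>R u + b *\<^sub>R v \<in> S"
    for s u v
  proof -
    have inS: "x + a *\<^sub>R u + b *\<^sub>R v \<in> S" if "0 \<le> a" "a \<le> s" "0 \<le> b" "b \<le> s" for a b
      using sq that by blast
    have inS0: "x + a *\<^sub>R u \<in> S" if "0 \<le> a" "a \<le> s" for a
      using inS[OF that, of 0] s by simp
    have inS1: "x + s *\<^sub>R v + a *\<^sub>R u \<in> S" if "0 \<le> a" "a \<le> s" for a
      using inS[OF that, of s] s by (simp add: algebra_simps)
    define \<phi> where "\<phi> a = f (x + s *\<^sub>R v + a *\<^sub>R u) - f (x + a *\<^sub>R u)" for a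
    have d\<phi>: "(\<phi> has_derivative (\<lambda>h. h * (?D u (x + s *\<^sub>R v + a *\<^sub>R u) - ?D u (x + a *\<^sub>R u)))) (at a)"
      if "0 \<le> a" "a \<le> s" for a
      using has_derivative_diff[OF has_derivative_along_line[OF d1[OF inS1[OF that]]]
          has_derivative_along_line[OF d1[OF inS0[OF that]]]]
      unfolding \<phi>_def by (simp add: right_diff_distrib)
    obtain s1 where s1: "0 < s1" "s1 < s"
      and "\<phi> s - \<phi> 0 = s * (?D u (x + s *\<^sub>R v + s1 *\<^sub>R u) - ?D u (x + s1 *\<^sub>R u))"
      using mvt_from_0[OF s, of \<phi> "\<lambda>a. ?D u (x + s *\<^sub>R v + a *\<^sub>R u) - ?D u (x + a *\<^sub>R u)"] d\<phi>
      by blast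
    then have e1: "\<phi> s - \<phi> 0 = s * (?D u (x + s1 *\<^sub>R u + s *\<^sub>R v) - ?D u (x + s1 *\<^sub>R u))"
      by (simp add: add.commute add.left_commute)
    have d\<chi>: "((\<lambda>b. ?D u (x + s1 *\<^sub>R u + b *\<^sub>R v)) has_derivative (\<lambda>h. h * ?D2 u v (x + s1 *\<^sub>R u + b *\<^sub>R v))) (at b)"
      if "0 \<le> b" "b \<le> s" for b
      using has_derivative_along_line[OF d2[OF inS[of s1 b]]] that s1 by simp
    obtain t1 where t1: "0 < t1" "t1 < s"
      and e2: "?D u (x + s1 *\<^sub>R u + s *\<^sub>R v) - ?D u (x + s1 *\<^sub>R u + 0 *\<^sub>R v) =
        s * ?D2 u v (x + s1 *\<^sub>R u + t1 *\<^sub>R v)"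
      using mvt_from_0[OF s, of "\<lambda>b. ?D u (x + s1 *\<^sub>R u + b *\<^sub>R v)"
          "\<lambda>b. ?D2 u v (x + s1 *\<^sub>R u + b *\<^sub>R v)"] d\<chi>
      by blast
    have "f (x + s *\<^sub>R u + s *\<^sub>R v) - f (x + s *\<^sub>R u) - f (x + s *\<^sub>R v) + f x = \<phi> s - \<phi> 0"
      by (simp add: \<phi>_def add.commute add.left_commute)
    also have "\<dots> = s * s * ?D2 u v (x + s1 *\<^sub>R u + t1 *\<^sub>R v)"
      using e1 e2 by simp
    finally show ?thesis using s1 t1 by blast
  qed
  have "\<bar>?D2 u v x - ?D2 v u x\<bar> < e" if "e > 0" for e
  proof -
    have "\<exists>d>0. \<forall>y\<in>S. dist y x < d \<longrightarrow> dist (?D2 u v y) (?D2 u v x) < e / 2" for u v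
      using cont[of u v] assms(3) \<open>e > 0\<close> unfolding continuous_on_iff by (metis half_gt_zero)
    then obtain d1 d2 where d: "d1 > 0" "d2 > 0"
      and D1: "\<And>y. y \<in> S \<Longrightarrow> dist y x < d1 \<Longrightarrow> dist (?D2 u v y) (?D2 u v x) < e / 2"
      and D2: "\<And>y. y \<in> S \<Longrightarrow> dist y x < d2 \<Longrightarrow> dist (?D2 v u y) (?D2 v u x) < e / 2"
      by metis
    obtain r where r: "r > 0" "ball x r \<subseteq> S" using assms(2,3) open_contains_ball by blast
    define m where "m = min r (min d1 d2)"
    have m: "m > 0" using r d by (simp add: m_def)
    \<comment> \<open>Small enough that the whole parallelogram lies within distance m of x; the
      summand 1 keeps the denominator positive when u = v = 0.\<close>
    define s where "s = m / (2 * (norm u + norm v + 1))"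
    have s: "s > 0" using m by (simp add: s_def add_nonneg_pos)
    have near: "dist (x + a *\<^sub>R u + b *\<^sub>R v) x < m" if "0 \<le> a" "a \<le> s" "0 \<le> b" "b \<le> s" for a b
    proof -
      have "dist (x + a *\<^sub>R u + b *\<^sub>R v) x = norm (a *\<^sub>R u + b *\<^sub>R v)" by (simp add: dist_norm algebra_simps)
      also have "\<dots> \<le> a * norm u + b * norm v"
        using that norm_triangle_ineq[of "a *\<^sub>R u" "b *\<^sub>R v"] by simp
      also have "\<dots> \<le> s * norm u + s * norm v" using that by (intro add_mono mult_right_mono) auto
      also have "\<dots> < s * (2 * (norm u + norm v + 1))"
      proof -
        have "0 \<le> s * norm u" "0 \<le> s * norm v" using s by auto
        then show ?thesis using s unfolding distrib_left by linarith
      qed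
      also have "\<dots> = m"
      proof -
        have "2 * (norm u + norm v + 1) > 0" by (simp add: add_nonneg_pos)
        then have "2 * (norm u + norm v + 1) \<noteq> 0" by simp
        then show ?thesis unfolding s_def by simp
      qed
      finally show ?thesis .
    qed
    have inS: "x + a *\<^sub>R u + b *\<^sub>R v \<in> S" if "0 \<le> a" "a \<le> s" "0 \<le> b" "b \<le> s" for a b
      using near[OF that] r by (auto simp: m_def dist_commute subset_iff)
    obtain s1 t1 where 1: "0 < s1" "s1 < s" "0 < t1" "t1 < s"
        "f (x + s *\<^sub>R u + s *\<^sub>R v) - f (x + s *\<^sub>R u) - f (x + s *\<^sub>R v) + f x =
      s * s * ?D2 u v (x + s1 *\<^sub>R u + t1 *\<^sub>R v)"
      using key[OF s, of u v] inS by blast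
    have inS': "x + b *\<^sub>R v + a *\<^sub>R u \<in> S" if "0 \<le> a" "a \<le> s" "0 \<le> b" "b \<le> s" for a b
      using inS[OF that] by (simp add: algebra_simps)
    obtain s2 t2 where 2: "0 < s2" "s2 < s" "0 < t2" "t2 < s"
        "f (x + s *\<^sub>R v + s *\<^sub>R u) - f (x + s *\<^sub>R v) - f (x + s *\<^sub>R u) + f x =
      s * s * ?D2 v u (x + s2 *\<^sub>R v + t2 *\<^sub>R u)"
      using key[OF s, of v u] inS' by blast
    have "s * s * ?D2 u v (x + s1 *\<^sub>R u + t1 *\<^sub>R v) = s * s * ?D2 v u (x + s2 *\<^sub>R v + t2 *\<^sub>R u)"
      using 1(5) 2(5) by (simp add: algebra_simps)
    then have eq: "?D2 u v (x + s1 *\<^sub>R u + t1 *\<^sub>R v) = ?D2 v u (x + t2 *\<^sub>R u + s2 *\<^sub>R v)"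
      using s by (simp add: algebra_simps)
    have "dist (?D2 u v (x + s1 *\<^sub>R u + t1 *\<^sub>R v)) (?D2 u v x) < e / 2"
      by (rule D1) (use 1 near[of s1 t1] inS[of s1 t1] in \<open>auto simp: m_def\<close>)
    moreover have "dist (?D2 v u (x + t2 *\<^sub>R u + s2 *\<^sub>R v)) (?D2 v u x) < e / 2"
      by (rule D2) (use 2 near[of t2 s2] inS[of t2 s2] in \<open>auto simp: m_def\<close>)
    ultimately show ?thesis using eq unfolding dist_real_def by linarith
  qed
  then have "\<not> \<bar>?D2 u v x - ?D2 v u x\<bar> > 0" by blast
  then show ?thesis by simp
qed

lemma schwarz:
  fixes f :: "'a::real_normed_vector \<Rightarrow> 'b::euclidean_space"
  assumes "smooth_on S f" "open S" "x \<in> S"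
  shows "frechet_derivative (\<lambda>y. frechet_derivative f (at y) u) (at x) v =
         frechet_derivative (\<lambda>y. frechet_derivative f (at y) v) (at x) u"
proof (rule euclidean_eqI)
  fix b :: 'b
  have bl: "bounded_linear (\<lambda>y. y \<bullet> b)" by (rule bounded_linear_inner_left)
  have diff: "f differentiable (at y)" if "y \<in> S" for y
    using smooth_on_derivative[OF assms(1) that] differentiable_def by blast
  have 1: "frechet_derivative (\<lambda>y. frechet_derivative (\<lambda>y. f y \<bullet> b) (at y) u) (at x) v =
      frechet_derivative (\<lambda>y. frechet_derivative f (at y) u) (at x) v \<bullet> b" for u v
  proof -
    have "frechet_derivative (\<lambda>y. frechet_derivative (\<lambda>y. f y \<bullet> b) (at y) u) (at x) =
        frechet_derivative (\<lambda>y. frechet_derivative f (at y) u \<bullet> b) (at x)"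
      by (rule frechet_derivative_cong_open[OF assms(2,3)])
        (simp add: frechet_derivative_linear[OF bl] diff)
    moreover have "(\<lambda>y. frechet_derivative f (at y) u) differentiable (at x)"
      using smooth_on_derivative[OF smooth_on_frechet[OF assms(1)] assms(3)] differentiable_def by blast
    ultimately show ?thesis by (simp add: frechet_derivative_linear[OF bl])
  qed
  have "Ck_on 2 S (\<lambda>y. f y \<bullet> b)"
    using smooth_on_bounded_linear[OF bl assms(1,2)] unfolding smooth_on_def by blast
  from schwarz_real[OF this assms(2,3), of u v]
  show "frechet_derivative (\<lambda>y. frechet_derivative f (at y) u) (at x) v \<bullet> b =
      frechet_derivative (\<lambda>y. frechet_derivative f (at y) v) (at x) u \<bullet> b"
    unfolding 1 .
qed

text \<open>Product rule for a derivative taken along a moving direction \<open>W y\<close>. The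
  basis expansion separates the two dependences on y.\<close>

lemma has_derivative_frechet_apply:
  fixes f :: "'a::euclidean_space \<Rightarrow> 'b::real_normed_vector"
  assumes f: "smooth_on S f" and S: "open S" and x: "x \<in> S" and W: "(W has_derivative W') (at x)"
  shows "((\<lambda>y. frechet_derivative f (at y) (W y)) has_derivative
     (\<lambda>h. frechet_derivative (\<lambda>y. frechet_derivative f (at y) (W x)) (at x) h +
          frechet_derivative f (at x) (W' h))) (at x)"
proof -
  let ?D = "\<lambda>b y. frechet_derivative f (at y) b"
  let ?D2 = "\<lambda>b. frechet_derivative (?D b) (at x)"
  have d2: "(?D b has_derivative ?D2 b) (at x)" for b
    using smooth_on_derivative[OF smooth_on_frechet[OF f] x] .
  have rep: "?D w y = (\<Sum>b\<in>Basis. (w \<bullet> b) *\<^sub>R ?D b y)" if "y \<in> S" for w y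
    using linear_Basis_expand[OF smooth_on_linear_frechet[OF f that]] .
  have D2: "?D2 w h = (\<Sum>b\<in>Basis. (w \<bullet> b) *\<^sub>R ?D2 b h)" for w h
  proof -
    have "((\<lambda>y. \<Sum>b\<in>Basis. (w \<bullet> b) *\<^sub>R ?D b y) has_derivative (\<lambda>h. \<Sum>b\<in>Basis. (w \<bullet> b) *\<^sub>R ?D2 b h)) (at x)"
      by (intro has_derivative_sum has_derivative_scaleR_right d2)
    then have "(?D w has_derivative (\<lambda>h. \<Sum>b\<in>Basis. (w \<bullet> b) *\<^sub>R ?D2 b h)) (at x)"
      by (rule has_derivative_transform_within_open[OF _ S x]) (rule rep[symmetric])
    then show ?thesis by (rule fun_cong[OF frechet_derivative_at, symmetric])
  qed
  have "((\<lambda>y. \<Sum>b\<in>Basis. (W y \<bullet> b) *\<^sub>R ?D b y) has_derivative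
      (\<lambda>h. \<Sum>b\<in>Basis. (W x \<bullet> b) *\<^sub>R ?D2 b h + (W' h \<bullet> b) *\<^sub>R ?D b x)) (at x)"
    by (intro has_derivative_sum has_derivative_scaleR d2 has_derivative_inner_left W)
  then have "((\<lambda>y. ?D (W y) y) has_derivative
      (\<lambda>h. \<Sum>b\<in>Basis. (W x \<bullet> b) *\<^sub>R ?D2 b h + (W' h \<bullet> b) *\<^sub>R ?D b x)) (at x)"
    by (rule has_derivative_transform_within_open[OF _ S x]) (rule rep[symmetric])
  then show ?thesis
    by (simp add: sum.distrib D2[of "W x"] rep[OF x, of "W' _"])
qed

text \<open>Apply the mean value theorem along the coordinate directions.\<close>

lemma has_derivative_directional:
  fixes f :: "'a::euclidean_space \<Rightarrow> real"
  assumes S: "open S" and x: "x \<in> S"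
    and d: "\<And>y v. y \<in> S \<Longrightarrow> ((\<lambda>t. f (y + t *\<^sub>R v)) has_real_derivative W y v) (at 0)"
    and lin: "\<And>y. y \<in> S \<Longrightarrow> linear (W y)"
    and cont: "\<And>v. continuous_on S (\<lambda>y. W y v)"
  shows "(f has_derivative W x) (at x)"
proof -
  have bl: "bounded_linear (W x)" using lin[OF x] linear_conv_bounded_linear by blast
  have rep: "W y v = (\<Sum>b\<in>Basis. (v \<bullet> b) * W y b)" if "y \<in> S" for y v
    using linear_Basis_expand[OF lin[OF that], of v] by simp
  obtain r where r: "r > 0" "ball x r \<subseteq> S" using S x open_contains_ball by blast
  have "\<exists>d>0. \<forall>h. norm h < d \<longrightarrow> norm (f (x + h) - f x - W x h) \<le> e * norm h" if e: "e > 0" for e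
  proof -
    have "\<exists>d>0. \<forall>y. dist y x < d \<longrightarrow> y \<in> S \<longrightarrow> \<bar>W y b - W x b\<bar> < e / DIM('a)" for b
    proof -
      have "e / DIM('a) > 0" using e by simp
      then show ?thesis
        using cont[of b] x unfolding continuous_on_iff dist_real_def by meson
    qed
    then obtain \<delta> where \<delta>: "\<And>b. \<delta> b > 0" "\<And>b y. dist y x < \<delta> b \<Longrightarrow> y \<in> S \<Longrightarrow> \<bar>W y b - W x b\<bar> < e / DIM('a)"
      by metis
    define m where "m = min r (Min (\<delta> ` (Basis :: 'a set)))"
    have m: "m > 0" using r \<delta>(1) by (auto simp: m_def)
    show ?thesis
    proof (intro exI[of _ m] conjI m allI impI)
      fix h :: 'a assume h: "norm h < m"
      have in_ball: "x + t *\<^sub>R h \<in> S" "dist (x + t *\<^sub>R h) x < m" if "0 \<le> t" "t \<le> 1" for t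
      proof -
        have "norm (t *\<^sub>R h) \<le> norm h" using that by (simp add: mult_left_le_one_le)
        then show "dist (x + t *\<^sub>R h) x < m" using h by (simp add: dist_norm)
        then show "x + t *\<^sub>R h \<in> S" using r by (auto simp: m_def dist_commute subset_iff)
      qed
      have "((\<lambda>t. f (x + t *\<^sub>R h)) has_derivative (\<lambda>s. s * W (x + t *\<^sub>R h) h)) (at t)"
        if "0 \<le> t" "t \<le> 1" for t
      proof -
        have "((\<lambda>s. f (x + t *\<^sub>R h + s *\<^sub>R h)) has_real_derivative W (x + t *\<^sub>R h) h) (at 0)"
          using d[OF in_ball(1)[OF that]] .
        then have "((\<lambda>s. f (x + (s + t) *\<^sub>R h)) has_real_derivative W (x + t *\<^sub>R h) h) (at 0)"
          by (simp add: algebra_simps)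
        then have "((\<lambda>s. f (x + s *\<^sub>R h)) has_real_derivative W (x + t *\<^sub>R h) h) (at t)"
          using DERIV_shift[of "\<lambda>s. f (x + s *\<^sub>R h)" "W (x + t *\<^sub>R h) h" 0 t] by simp
        then show ?thesis by (simp add: has_field_derivative_def mult_commute_abs)
      qed
      then obtain t where t: "0 < t" "t < 1" "f (x + 1 *\<^sub>R h) - f (x + 0 *\<^sub>R h) = 1 * W (x + t *\<^sub>R h) h"
        using mvt_from_0[of 1 "\<lambda>t. f (x + t *\<^sub>R h)" "\<lambda>t. W (x + t *\<^sub>R h) h"] zero_less_one by blast
      have in_t: "x + t *\<^sub>R h \<in> S" "dist (x + t *\<^sub>R h) x < m" using in_ball[of t] t by auto
      have "f (x + h) - f x - W x h = (\<Sum>b\<in>Basis. (h \<bullet> b) * (W (x + t *\<^sub>R h) b - W x b))"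
        using t(3) rep[OF in_t(1), of h] rep[OF x, of h] by (simp add: right_diff_distrib sum_subtractf)
      also have "norm \<dots> \<le> (\<Sum>b\<in>(Basis::'a set). norm h * (e / DIM('a)))"
      proof (rule sum_norm_le)
        fix b :: 'a assume b: "b \<in> Basis"
        have "m \<le> \<delta> b" using b by (auto simp: m_def intro!: min.coboundedI2 Min_le)
        then have "\<bar>W (x + t *\<^sub>R h) b - W x b\<bar> < e / DIM('a)" using \<delta>(2) in_t by force
        then show "norm ((h \<bullet> b) * (W (x + t *\<^sub>R h) b - W x b)) \<le> norm h * (e / DIM('a))"
          unfolding real_norm_def abs_mult
          by (intro mult_mono Basis_le_norm b) auto
      qed
      also have "\<dots> = e * norm h" by simp
      finally show "norm (f (x + h) - f x - W x h) \<le> e * norm h" .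
    qed
  qed
  then have *: "\<exists>d>0. \<forall>h. norm h < d \<longrightarrow> norm (f (x + h) - f x - W x h) \<le> e * norm h" if "e > 0" for e
    using that by blast
  show ?thesis unfolding has_derivative_at_alt
  proof (intro conjI bl allI impI)
    fix e :: real assume "e > 0"
    from *[OF this] obtain d where "d > 0"
      "\<And>h. norm h < d \<Longrightarrow> norm (f (x + h) - f x - W x h) \<le> e * norm h" by blast
    then show "\<exists>d>0. \<forall>y. norm (y - x) < d \<longrightarrow> norm (f y - f x - W x (y - x)) \<le> e * norm (y - x)"
      by (metis add.commute diff_add_cancel)
  qed
qed

subsection \<open>Ordinary differential equations\<close>

text \<open>Banach's fixed point theorem for the integral operator, on bounded continuous functions
  on the whole line. Boundedness of f keeps the operator inside that space.\<close>

lemma picard_lipschitz: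
  fixes f :: "'a::euclidean_space \<Rightarrow> 'a"
  assumes lip: "\<And>x y. norm (f x - f y) \<le> K * norm (x - y)" and K: "K \<ge> 0"
    and B: "\<And>x. norm (f x) \<le> B"
  obtains e x where "e > 0" "x 0 = x0"
    "\<And>t::real. \<bar>t\<bar> < e \<Longrightarrow> (x has_vector_derivative f (x t)) (at t)"
proof -
  \<comment> \<open>The contraction estimate involves an integral over length at most 2 * e and
    another over length e, each with constant K. The choice makes 3 * e * K at most 1/2.\<close>
  define e where "e = 1 / (6 * (K + 1))"
  have e: "e > 0" and eK: "3 * e * K \<le> 1/2" using K by (auto simp: e_def field_simps)
  have contf: "continuous_on UNIV f"
    unfolding continuous_on_iff
  proof (intro ballI allI impI)
    fix x :: 'a and r :: real assume r: "r > 0"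
    show "\<exists>d>0. \<forall>y\<in>UNIV. dist y x < d \<longrightarrow> dist (f y) (f x) < r"
    proof (intro exI[of _ "r / (K + 1)"] conjI ballI impI)
      show "r / (K + 1) > 0" using r K by simp
      fix y assume "dist y x < r / (K + 1)"
      then have "(K + 1) * norm (y - x) < r" using K by (simp add: dist_norm field_simps)
      moreover have "norm (f y - f x) \<le> K * norm (y - x)" by (rule lip)
      moreover have "K * norm (y - x) \<le> (K + 1) * norm (y - x)" by (intro mult_right_mono) auto
      ultimately show "dist (f y) (f x) < r" unfolding dist_norm by linarith
    qed
  qed
  \<comment> \<open>Time is clamped to [-e, e], so that candidate solutions are defined and bounded
    on all of the line; the equation is claimed only inside.\<close>
  define cl where "cl t = max (-e) (min e t)" for t
  have cl: "cl t \<in> {-e..e}" for t using e by (auto simp: cl_def)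
  define J where "J \<phi> t = integral {-e..t} (\<lambda>s. f (\<phi> s))" for \<phi> :: "real \<Rightarrow> 'a" and t
  \<comment> \<open>The integral from 0 to t is written as a difference of integrals starting at -e,
    because \<open>integral {0..t}\<close> would be an integral over the empty set for negative
    t.\<close>
  define T where "T \<phi> t = x0 + (J \<phi> (cl t) - J \<phi> 0)" for \<phi> t
  have cf: "continuous_on S (\<lambda>s. f (\<phi> s))" if "continuous_on UNIV \<phi>" for \<phi> :: "real \<Rightarrow> 'a" and S
    by (rule continuous_on_compose2[OF contf continuous_on_subset[OF that]]) auto
  have bJ: "norm (J \<phi> t) \<le> 2 * e * B" if "continuous_on UNIV \<phi>" "t \<in> {-e..e}" for \<phi> t
  proof -
    have "B \<ge> 0" using B[of 0] norm_ge_zero order_trans by blast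
    have "norm (J \<phi> t) \<le> B * (t - (-e))" unfolding J_def
      by (rule integral_bound) (use that B cf[OF that(1)] in auto)
    also have "\<dots> \<le> B * (2 * e)" using that \<open>B \<ge> 0\<close> by (intro mult_left_mono) auto
    finally show ?thesis by (simp add: mult.commute)
  qed
  have bcT: "T \<phi> \<in> bcontfun" if \<phi>: "continuous_on UNIV \<phi>" for \<phi>
  proof (rule bcontfun_normI)
    have "continuous_on {-e..e} (J \<phi>)" unfolding J_def
      by (rule indefinite_integral_continuous_1[OF integrable_continuous_real[OF cf[OF \<phi>]]])
    moreover have "continuous_on UNIV cl" unfolding cl_def by (intro continuous_intros)
    ultimately have "continuous_on UNIV (\<lambda>t. J \<phi> (cl t))"
      by (rule continuous_on_compose2) (use cl in auto)
    then show "continuous_on UNIV (T \<phi>)" unfolding T_def by (intro continuous_intros)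
    show "norm (T \<phi> t) \<le> norm x0 + (2 * e * B + 2 * e * B)" for t
      unfolding T_def
      by (intro norm_triangle_le add_mono order_refl norm_triangle_le_diff bJ \<phi> cl) (use e in auto)
  qed
  define TT where "TT \<phi> = Bcontfun (T (apply_bcontfun \<phi>))" for \<phi> :: "real \<Rightarrow>\<^sub>C 'a"
  have TT: "apply_bcontfun (TT \<phi>) = T (apply_bcontfun \<phi>)" for \<phi>
    unfolding TT_def by (rule Bcontfun_inverse) (rule bcT, simp)
  have dJ: "norm (J \<phi> t - J \<psi> t) \<le> K * d * (t + e)"
    if c: "continuous_on UNIV \<phi>" "continuous_on UNIV \<psi>" and d: "\<And>s. norm (\<phi> s - \<psi> s) \<le> d" and t: "t \<in> {-e..e}"
    for \<phi> \<psi> t d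
  proof -
    have "J \<phi> t - J \<psi> t = integral {-e..t} (\<lambda>s. f (\<phi> s) - f (\<psi> s))"
      unfolding J_def
      by (rule integral_diff[symmetric]; rule integrable_continuous_real; rule cf; rule c)
    also have "norm \<dots> \<le> K * d * (t - (-e))"
    proof (rule integral_bound)
      show "continuous_on {-e..t} (\<lambda>s. f (\<phi> s) - f (\<psi> s))" by (intro continuous_intros cf c)
      fix s
      have "norm (f (\<phi> s) - f (\<psi> s)) \<le> K * norm (\<phi> s - \<psi> s)" by (rule lip)
      also have "\<dots> \<le> K * d" by (rule mult_left_mono[OF d K])
      finally show "norm (f (\<phi> s) - f (\<psi> s)) \<le> K * d" .
    qed (use t in auto)
    finally show ?thesis by simp
  qed
  have "dist (TT \<phi>) (TT \<psi>) \<le> (1/2) * dist \<phi> \<psi>" for \<phi> \<psi>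
  proof (rule dist_bound)
    fix t
    let ?d = "dist \<phi> \<psi>"
    have d: "norm (apply_bcontfun \<phi> s - apply_bcontfun \<psi> s) \<le> ?d" for s
      using dist_bounded[of \<phi> s \<psi>] by (simp add: dist_norm)
    have Kd: "K * ?d \<ge> 0" using K by simp
    let ?\<phi> = "apply_bcontfun \<phi>" and ?\<psi> = "apply_bcontfun \<psi>"
    have 1: "norm (J ?\<phi> (cl t) - J ?\<psi> (cl t)) \<le> K * ?d * (cl t + e)"
      by (rule dJ[OF _ _ d cl]) auto
    have 2: "norm (J ?\<phi> 0 - J ?\<psi> 0) \<le> K * ?d * e"
      using dJ[of ?\<phi> ?\<psi> ?d 0, OF _ _ d] e by simp
    have 3: "K * ?d * (cl t + e) \<le> K * ?d * (2 * e)" using cl[of t] by (intro mult_left_mono Kd) auto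
    have "dist (TT \<phi> t) (TT \<psi> t) = norm ((J ?\<phi> (cl t) - J ?\<psi> (cl t)) - (J ?\<phi> 0 - J ?\<psi> 0))"
      unfolding TT T_def dist_norm by (simp add: algebra_simps)
    also have "\<dots> \<le> K * ?d * (2 * e) + K * ?d * e"
      using norm_triangle_ineq4[of "J ?\<phi> (cl t) - J ?\<psi> (cl t)" "J ?\<phi> 0 - J ?\<psi> 0"] 1 2 3
      by linarith
    also have "\<dots> = (3 * e * K) * ?d" by (simp add: algebra_simps)
    also have "\<dots> \<le> (1/2) * ?d" by (rule mult_right_mono[OF eK]) simp
    finally show "dist (TT \<phi> t) (TT \<psi> t) \<le> (1/2) * ?d" .
  qed
  then have "\<exists>!\<phi>. TT \<phi> = \<phi>" by (intro banach_fix_type[of "1/2"]) auto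
  then obtain \<phi> where \<phi>: "TT \<phi> = \<phi>" by blast
  let ?x = "apply_bcontfun \<phi>"
  have x: "?x t = x0 + (J ?x (cl t) - J ?x 0)" for t
    using TT[of \<phi>] unfolding \<phi> T_def by (rule fun_cong)
  show thesis
  proof (rule that[OF e, of ?x])
    have "cl 0 = 0" using e by (simp add: cl_def)
    then show "?x 0 = x0" using x[of 0] by simp
    fix t :: real assume t: "\<bar>t\<bar> < e"
    have "(J ?x has_vector_derivative f (?x t)) (at t within {-e..e})"
      unfolding J_def by (rule integral_has_vector_derivative) (use t in \<open>auto intro: cf\<close>)
    moreover have "at t within {-e..e} = at t"
      using t by (intro at_within_Icc_at) auto
    ultimately have "(J ?x has_vector_derivative f (?x t)) (at t)" by simp
    then have "((\<lambda>t. x0 + (J ?x t - J ?x 0)) has_vector_derivative f (?x t)) (at t)"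
      by (auto intro!: derivative_eq_intros)
    then show "(?x has_vector_derivative f (?x t)) (at t)"
    proof (rule has_vector_derivative_transform_within_open[where S="{-e<..<e}"])
      show "x0 + (J ?x s - J ?x 0) = ?x s" if "s \<in> {-e<..<e}" for s
        using x[of s] that by (simp add: cl_def)
    qed (use t in auto)
  qed
qed

text \<open>On a closed ball in U the field is bounded and Lipschitz. Composing it with the
  nearest-point projection onto the ball gives a global field with the same bounds, and for a short
  time the solution cannot leave the ball, where the two fields agree.\<close>

lemma picard:
  fixes f :: "'a::euclidean_space \<Rightarrow> 'a"
  assumes U: "open U" and f: "smooth_on U f" and x0: "x0 \<in> U"
  obtains e x where "e > 0" "x 0 = x0"
    "\<And>t::real. \<bar>t\<bar> < e \<Longrightarrow> x t \<in> U" "\<And>t. \<bar>t\<bar> < e \<Longrightarrow> (x has_vector_derivative f (x t)) (at t)"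
proof -
  obtain r where r: "r > 0" "cball x0 r \<subseteq> U" using U x0 open_contains_cball by blast
  let ?C = "cball x0 r"
  have "\<exists>k. \<forall>y\<in>?C. norm (frechet_derivative f (at y) b) \<le> k" for b
  proof -
    have "continuous_on ?C (\<lambda>y. frechet_derivative f (at y) b)"
      by (rule continuous_on_subset[OF smooth_on_continuous[OF smooth_on_frechet[OF f]] r(2)])
    then have "bounded ((\<lambda>y. frechet_derivative f (at y) b) ` ?C)"
      by (intro compact_imp_bounded compact_continuous_image) auto
    then show ?thesis unfolding bounded_iff by auto
  qed
  then obtain k where k: "\<And>b y. y \<in> ?C \<Longrightarrow> norm (frechet_derivative f (at y) b) \<le> k b" by metis
  define K where "K = (\<Sum>b\<in>(Basis::'a set). k b)"
  have k0: "k b \<ge> 0" for b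
  proof -
    have "norm (frechet_derivative f (at x0) b) \<le> k b" using r by (intro k) auto
    then show ?thesis using norm_ge_zero order_trans by blast
  qed
  then have K: "K \<ge> 0" unfolding K_def by (intro sum_nonneg) auto
  have lip: "norm (f y - f z) \<le> K * norm (y - z)" if "y \<in> ?C" "z \<in> ?C" for y z
  proof (rule differentiable_bound[OF convex_cball[of x0 r] _ _ that])
    fix y assume y: "y \<in> ?C"
    then have yU: "y \<in> U" using r by blast
    show "(f has_derivative frechet_derivative f (at y)) (at y within ?C)"
      by (rule has_derivative_at_withinI[OF smooth_on_derivative[OF f yU]])
    show "onorm (frechet_derivative f (at y)) \<le> K"
    proof (rule onorm_le)
      fix v
      have "frechet_derivative f (at y) v = (\<Sum>b\<in>Basis. (v \<bullet> b) *\<^sub>R frechet_derivative f (at y) b)"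
        by (rule linear_Basis_expand[OF smooth_on_linear_frechet[OF f yU]])
      also have "norm \<dots> \<le> (\<Sum>b\<in>Basis. k b * norm v)"
      proof (rule sum_norm_le)
        fix b :: 'a assume b: "b \<in> Basis"
        have "norm ((v \<bullet> b) *\<^sub>R frechet_derivative f (at y) b) \<le> norm v * k b"
          unfolding norm_scaleR by (intro mult_mono Basis_le_norm b k y) auto
        then show "norm ((v \<bullet> b) *\<^sub>R frechet_derivative f (at y) b) \<le> k b * norm v"
          by (simp add: mult.commute)
      qed
      finally show "norm (frechet_derivative f (at y) v) \<le> K * norm v"
        by (simp add: K_def sum_distrib_right)
    qed
  qed
  have "bounded (f ` ?C)"
    by (intro compact_imp_bounded compact_continuous_image continuous_on_subset[OF smooth_on_continuous[OF f] r(2)]) auto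
  then obtain B where B: "\<And>y. y \<in> ?C \<Longrightarrow> norm (f y) \<le> B" unfolding bounded_iff by blast
  \<comment> \<open>The projection onto a closed convex set does not increase distances, so the
    Lipschitz constant of f on the ball survives.\<close>
  define h where "h y = f (closest_point ?C y)" for y
  have C: "closed ?C" "?C \<noteq> {}" "convex ?C" using r by auto
  have cp: "closest_point ?C y \<in> ?C" for y by (rule closest_point_in_set) (use C in auto)
  have hB: "norm (h y) \<le> B" for y unfolding h_def by (rule B[OF cp])
  have hL: "norm (h y - h z) \<le> K * norm (y - z)" for y z
  proof -
    have "norm (h y - h z) \<le> K * norm (closest_point ?C y - closest_point ?C z)"
      unfolding h_def by (rule lip[OF cp cp])
    also have "\<dots> \<le> K * norm (y - z)"
      using closest_point_lipschitz[OF C(3) C(1,2), of y z] by (intro mult_left_mono K) (simp add: dist_norm)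
    finally show ?thesis .
  qed
  obtain e x where e: "e > 0" and x: "x 0 = x0"
    and dx: "\<And>t::real. \<bar>t\<bar> < e \<Longrightarrow> (x has_vector_derivative h (x t)) (at t)"
    using picard_lipschitz[of h K B x0] hL K hB by metis
  have B0: "B \<ge> 0" using hB[of x0] norm_ge_zero order_trans by blast
  \<comment> \<open>The speed is at most B, so up to time r / (B + 1) the solution stays within
    distance r of its start; adding 1 avoids division by 0.\<close>
  define d where "d = min e (r / (B + 1))"
  have d: "d > 0" using e r B0 by (simp add: d_def)
  have inC: "x t \<in> ?C" if t: "\<bar>t\<bar> < d" for t
  proof -
    have "norm (x t - x 0) \<le> B * norm (t - 0)"
    proof (rule differentiable_bound[of "{-d<..<d}" x "\<lambda>t s. s *\<^sub>R h (x t)"])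
      show "(x has_derivative (\<lambda>s. s *\<^sub>R h (x t))) (at t within {-d<..<d})" if "t \<in> {-d<..<d}" for t
        using dx[of t] that by (auto simp: d_def has_vector_derivative_def intro: has_derivative_at_withinI)
      show "onorm (\<lambda>s. s *\<^sub>R h (x t)) \<le> B" for t
        by (rule onorm_le) (simp add: mult.commute[of B] mult_left_mono hB)
    qed (use t in auto)
    also have "\<dots> \<le> B * d" using t B0 by (intro mult_left_mono) auto
    also have "\<dots> \<le> B * (r / (B + 1))" using B0 by (intro mult_left_mono) (auto simp: d_def)
    also have "\<dots> \<le> r" using B0 r by (simp add: field_simps)
    finally show ?thesis using x by (simp add: dist_norm norm_minus_commute)
  qed
  show thesis
  proof (rule that[of d x, OF d x])
    fix t :: real assume t: "\<bar>t\<bar> < d"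
    show "x t \<in> U" using inC[OF t] r by blast
    have "h (x t) = f (x t)" unfolding h_def closest_point_self[OF inC[OF t]] ..
    then show "(x has_vector_derivative f (x t)) (at t)"
      using dx[of t] t by (simp add: d_def)
  qed
qed

lemma smooth_on_vector_derivativeI:
  assumes "open I" "\<And>t. t \<in> I \<Longrightarrow> (x has_vector_derivative x' t) (at t)" "smooth_on I x'"
  shows "smooth_on I x"
proof (rule smooth_onI_derivative[OF assms(1)])
  show "(x has_derivative (\<lambda>s. s *\<^sub>R x' t)) (at t)" if "t \<in> I" for t
    using assms(2)[OF that] unfolding has_vector_derivative_def .
  show "smooth_on I (\<lambda>t. v *\<^sub>R x' t)" for v
    by (rule smooth_on_scaleR[OF smooth_on_const assms(3,1)])
qed

text \<open>Bootstrapping: if x is of class k, then so is the right-hand side f(x(t)), which is the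
  derivative of x.\<close>

lemma smooth_on_solution:
  fixes f :: "'a::euclidean_space \<Rightarrow> 'a"
  assumes U: "open U" and f: "smooth_on U f" and I: "open I"
    and xU: "x ` I \<subseteq> U" and x: "\<And>t::real. t \<in> I \<Longrightarrow> (x has_vector_derivative f (x t)) (at t)"
  shows "smooth_on I x"
  unfolding smooth_on_def
proof
  fix k show "Ck_on k I x"
  proof (induction k)
    case 0
    then show ?case
      using has_vector_derivative_continuous[OF x] by (auto intro: continuous_at_imp_continuous_on)
  next
    case (Suc k)
    show ?case
    proof (rule Ck_on_SucI[OF I])
      show "(x has_derivative (\<lambda>s. s *\<^sub>R f (x t))) (at t)" if "t \<in> I" for t
        using x[OF that] unfolding has_vector_derivative_def .
      have "Ck_on k U f" using f unfolding smooth_on_def by blast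
      then have "Ck_on k I (\<lambda>t. f (x t))" by (rule Ck_on_compose[OF _ Suc I U xU])
      then show "Ck_on k I (\<lambda>t. v *\<^sub>R f (x t))" for v
        by (rule Ck_on_bilinear[OF bounded_bilinear_scaleR Ck_on_const _ I])
    qed
  qed
qed

subsection \<open>Linear algebra\<close>

text \<open>Values at 0, s, -s and 2 * s determine a cubic. The lemma carries identities from an
  open set of vectors to all vectors, by restricting them to lines.\<close>

lemma cubic_zero:
  fixes a b c d :: real
  assumes "e > 0" and z: "\<And>t. \<bar>t\<bar> < e \<Longrightarrow> a + b * t + c * t^2 + d * t^3 = 0"
  shows "a = 0" "b = 0" "c = 0" "d = 0"
proof -
  define s where "s = e / 4"
  have s: "s > 0" "2 * s < e" using assms(1) by (auto simp: s_def)
  show a: "a = 0" using z[of 0] assms(1) by simp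
  have 1: "b * s + c * s^2 + d * s^3 = 0" and 2: "- b * s + c * s^2 - d * s^3 = 0"
    and 3: "2 * b * s + 4 * c * s^2 + 8 * d * s^3 = 0"
    using z[of s] z[of "-s"] z[of "2 * s"] s a by (auto simp: power_mult_distrib)
  have "c * s^2 = 0" "d * s^3 = 0" "b * s = 0" using 1 2 3 by linarith+
  then show "b = 0" "c = 0" "d = 0" using s by auto
qed

text \<open>In the Leibniz expansion only the identity permutation contributes to the first order.
  Any other permutation moves at least two indices, and after one factor has been differentiated an
  off-diagonal entry of the identity matrix remains.\<close>

lemma det_derivative_at_mat_1:
  fixes P :: "real \<Rightarrow> real^'n^'n"
  assumes P: "(P has_vector_derivative D) (at t)" and Pt: "P t = mat 1"
  shows "((\<lambda>s. det (P s)) has_real_derivative trace D) (at t)"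
proof -
  let ?S = "{p. p permutes (UNIV :: 'n set)}"
  have comp: "((\<lambda>s. P s $ i $ j) has_derivative (\<lambda>h. h * D $ i $ j)) (at t)" for i j
  proof -
    have "((\<lambda>s. P s $ i $ j) has_derivative (\<lambda>h. (h *\<^sub>R D) $ i $ j)) (at t)"
      using P unfolding has_vector_derivative_def
      by (intro bounded_linear.has_derivative[OF bounded_linear_vec_nth])
    then show ?thesis by simp
  qed
  let ?T = "\<lambda>p h. of_int (sign p) * (\<Sum>i\<in>UNIV. h * D $ i $ p i * (\<Prod>j\<in>UNIV - {i}. P t $ j $ p j))"
  have "((\<lambda>s. det (P s)) has_derivative (\<lambda>h. \<Sum>p\<in>?S. ?T p h)) (at t)"
    unfolding det_def
    by (intro has_derivative_sum has_derivative_mult_right has_derivative_prod comp)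
  moreover have "(\<Sum>p\<in>?S. ?T p h) = h * trace D" for h
  proof -
    have z: "?T p h = 0" if p: "p \<in> ?S - {id}" for p
    proof -
      \<comment> \<open>If all indices except i were fixed, injectivity would make i fixed
        too.\<close>
      have ex: "\<exists>j\<in>UNIV - {i}. p j \<noteq> j" for i
      proof (rule ccontr)
        assume "\<not> ?thesis"
        then have fx: "\<And>j. j \<noteq> i \<Longrightarrow> p j = j" by auto
        have "inj p" using p permutes_inj by blast
        then have "p i = i" using fx[of "p i"] by (metis injD)
        then have "p = id" using fx by (metis eq_id_iff)
        then show False using p by simp
      qed
      have "\<exists>j\<in>UNIV - {i}. P t $ j $ p j = 0" for i
        using ex[of i] by (force simp: Pt mat_def)
      then have "(\<Prod>j\<in>UNIV - {i}. P t $ j $ p j) = 0" for i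
        by (intro prod_zero) auto
      then show ?thesis by (simp only: mult_zero_right sum.neutral_const)
    qed
    have "(\<Sum>p\<in>?S. ?T p h) = (\<Sum>p\<in>{id}. ?T p h)"
      by (rule sum.mono_neutral_right) (use z permutes_id in auto)
    also have "\<dots> = h * trace D"
      by (simp add: Pt mat_def trace_def sum_distrib_left sign_id)
    finally show ?thesis .
  qed
  ultimately show ?thesis
    by (simp add: has_field_derivative_def mult_commute_abs)
qed

lemma symmetric_product_zero:
  fixes u v :: "real^'n"
  assumes "\<And>i j. u $ i * v $ j + u $ j * v $ i = 0" "v \<noteq> 0"
  shows "u = 0"
proof (rule ccontr)
  assume "u \<noteq> 0"
  then obtain i where i: "u $ i \<noteq> 0" by (metis vec_eq_iff zero_index)
  then have vi: "v $ i = 0" using assms(1)[of i i] by simp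
  have "v $ j = 0" for j using assms(1)[of i j] i vi by simp
  then show False using assms(2) by (metis vec_eq_iff zero_index)
qed

text \<open>To be applied with p = \<Lambda>\<eta> and q = \<Lambda>\<xi>, where \<Lambda> is the
  covariant derivative of \<lambda>. Unique factorization of symmetric products of vectors is behind
  it: if the products of p with \<xi> and of q with \<eta> agree and \<xi>, \<eta> are independent,
  then p is a multiple of \<eta> and q the same multiple of \<xi>.\<close>

lemma eigenvector_of_symmetric_product:
  fixes p q \<xi> \<eta> :: "real^'n"
  assumes eq: "\<And>i j. p $ i * \<xi> $ j + p $ j * \<xi> $ i = q $ i * \<eta> $ j + q $ j * \<eta> $ i"
    and indep: "\<And>r. \<xi> \<noteq> r *\<^sub>R \<eta>" and \<eta>: "\<eta> \<noteq> 0"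
  shows "\<exists>c. q = c *\<^sub>R \<xi>"
proof -
  \<comment> \<open>The part of \<xi> orthogonal to \<eta>: contracting with it kills \<eta> but not
    \<xi>. Contracting twice shows that p is orthogonal to \<alpha>; contracting once then gives p
    as a multiple of \<eta>.\<close>
  define \<alpha> where "\<alpha> = \<xi> - ((\<xi> \<bullet> \<eta>) / (\<eta> \<bullet> \<eta>)) *\<^sub>R \<eta>"
  have \<alpha>\<eta>: "\<alpha> \<bullet> \<eta> = 0" using \<eta> by (simp add: \<alpha>_def inner_diff_left)
  have "\<alpha> \<noteq> 0" using indep[of "(\<xi> \<bullet> \<eta>) / (\<eta> \<bullet> \<eta>)"] by (auto simp: \<alpha>_def)
  have "\<alpha> \<bullet> \<xi> = \<alpha> \<bullet> \<alpha>" using \<alpha>\<eta> by (simp add: \<alpha>_def inner_diff_right inner_commute)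
  then have \<alpha>\<xi>: "\<alpha> \<bullet> \<xi> \<noteq> 0" using \<open>\<alpha> \<noteq> 0\<close> by simp
  have c1: "p $ i * (\<alpha> \<bullet> \<xi>) + (\<alpha> \<bullet> p) * \<xi> $ i = q $ i * (\<alpha> \<bullet> \<eta>) + (\<alpha> \<bullet> q) * \<eta> $ i" for i
  proof -
    have "(\<Sum>j\<in>UNIV. \<alpha> $ j * (p $ i * \<xi> $ j + p $ j * \<xi> $ i)) =
        (\<Sum>j\<in>UNIV. \<alpha> $ j * (q $ i * \<eta> $ j + q $ j * \<eta> $ i))"
      by (simp only: eq)
    then show ?thesis
      by (simp add: inner_vec_def distrib_left sum.distrib sum_distrib_left sum_distrib_right algebra_simps)
  qed
  have "(\<alpha> \<bullet> p) * (\<alpha> \<bullet> \<xi>) + (\<alpha> \<bullet> p) * (\<alpha> \<bullet> \<xi>) = 0"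
  proof -
    have "(\<Sum>i\<in>UNIV. \<alpha> $ i * (p $ i * (\<alpha> \<bullet> \<xi>) + (\<alpha> \<bullet> p) * \<xi> $ i)) =
        (\<Sum>i\<in>UNIV. \<alpha> $ i * ((\<alpha> \<bullet> q) * \<eta> $ i))"
      by (simp add: c1 \<alpha>\<eta>)
    also have "\<dots> = (\<alpha> \<bullet> q) * (\<alpha> \<bullet> \<eta>)"
      by (simp add: inner_vec_def[of \<alpha> \<eta>] sum_distrib_left algebra_simps)
    also have "(\<Sum>i\<in>UNIV. \<alpha> $ i * (p $ i * (\<alpha> \<bullet> \<xi>) + (\<alpha> \<bullet> p) * \<xi> $ i)) =
        (\<Sum>i\<in>UNIV. \<alpha> $ i * p $ i) * (\<alpha> \<bullet> \<xi>) + (\<alpha> \<bullet> p) * (\<Sum>i\<in>UNIV. \<alpha> $ i * \<xi> $ i)"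
      by (simp add: distrib_left sum.distrib sum_distrib_left sum_distrib_right algebra_simps)
    finally show ?thesis using \<alpha>\<eta> by (simp add: inner_vec_def)
  qed
  then have ap: "\<alpha> \<bullet> p = 0" using \<alpha>\<xi> by simp
  define b where "b = (\<alpha> \<bullet> q) / (\<alpha> \<bullet> \<xi>)"
  have p: "p $ i = b * \<eta> $ i" for i
    using c1[of i] ap \<alpha>\<eta> \<alpha>\<xi> by (simp add: b_def field_simps)
  have "q - b *\<^sub>R \<xi> = 0"
  proof (rule symmetric_product_zero[OF _ \<eta>])
    fix i j
    show "(q - b *\<^sub>R \<xi>) $ i * \<eta> $ j + (q - b *\<^sub>R \<xi>) $ j * \<eta> $ i = 0"
      using eq[of i j] unfolding p by (simp add: algebra_simps)
  qed
  then show ?thesis by (intro exI[of _ b]) simp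
qed

text \<open>Polarize the identity in the two lemmas below and contract it with \<open>\<delta>\<close>.\<close>

lemma quadratic_map_parallel:
  fixes T :: "real^'n \<Rightarrow> real^'n \<Rightarrow> real^'n"
  assumes bil: "bilinear T" and sym: "\<And>u v. T u v = T v u"
    and par: "\<And>v i j. T v v $ i * v $ j = T v v $ j * v $ i"
  shows "T u v = ((\<Sum>k\<in>UNIV. T u (axis k 1) $ k) *\<^sub>R v + (\<Sum>k\<in>UNIV. T v (axis k 1) $ k) *\<^sub>R u) /\<^sub>R (CARD('n) + 1)"
proof -
  have add: "T (x + y) z = T x z + T y z" "T z (x + y) = T z x + T z y" for x y z
    using bil by (auto simp: bilinear_ladd bilinear_radd)
  have pol: "T u v $ i * w $ j + T v w $ i * u $ j + T w u $ i * v $ j =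
      T u v $ j * w $ i + T v w $ j * u $ i + T w u $ j * v $ i" for u v w i j
  proof -
    note p = par[of _ i j]
    show ?thesis
      using p[of "u + v + w"] p[of "u + v"] p[of "v + w"] p[of "u + w"] p[of u] p[of v] p[of w]
      unfolding add sym[of v u] sym[of w v] sym[of w u] vector_add_component
      by (simp add: algebra_simps)
  qed
  have "(CARD('n) + 1) * (T u v $ i) = (\<Sum>k\<in>UNIV. T u (axis k 1) $ k) * v $ i + (\<Sum>k\<in>UNIV. T v (axis k 1) $ k) * u $ i" for i
  proof -
    have s: "(\<Sum>k\<in>UNIV. x $ k * axis k (1::real) $ i) = x $ i" "(\<Sum>k\<in>UNIV. axis (k::'n) (1::real) $ k * c) = CARD('n) * c"
      for x :: "real^'n" and c :: real
      by (simp_all add: axis_def if_distrib cong: if_cong)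
    have e: "(\<Sum>k\<in>UNIV. z $ k *\<^sub>R axis k 1) = z" for z :: "real^'n"
      by (simp add: basis_expansion scalar_mult_eq_scaleR[symmetric])
    have lin: "linear (T z)" for z using bil unfolding bilinear_def by blast
    have tr: "(\<Sum>k\<in>UNIV. T z (axis k 1) $ i * y $ k) = T z y $ i" for z y :: "real^'n"
    proof -
      have "T z y = T z (\<Sum>k\<in>UNIV. y $ k *\<^sub>R axis k 1)" by (simp only: e)
      also have "\<dots> = (\<Sum>k\<in>UNIV. y $ k *\<^sub>R T z (axis k 1))"
        by (simp add: linear_sum[OF lin] linear_cmul[OF lin])
      finally show ?thesis by (simp add: mult.commute)
    qed
    have "(\<Sum>k\<in>UNIV. T u v $ i * axis k 1 $ k + T v (axis k 1) $ i * u $ k + T (axis k 1) u $ i * v $ k) =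
      (\<Sum>k\<in>UNIV. T u v $ k * axis k 1 $ i + T v (axis k 1) $ k * u $ i + T (axis k 1) u $ k * v $ i)"
      by (simp only: pol[of u v i])
    then have "CARD('n) * T u v $ i + T v u $ i + T u v $ i =
       T u v $ i + (\<Sum>k\<in>UNIV. T v (axis k 1) $ k) * u $ i + (\<Sum>k\<in>UNIV. T u (axis k 1) $ k) * v $ i"
      unfolding sum.distrib sym[of "axis _ 1" u] tr s sum_distrib_right[symmetric]
      by (simp add: axis_def)
    then show ?thesis using sym[of u v] by (simp add: algebra_simps)
  qed
  then have "(CARD('n) + 1) *\<^sub>R T u v =
      (\<Sum>k\<in>UNIV. T u (axis k 1) $ k) *\<^sub>R v + (\<Sum>k\<in>UNIV. T v (axis k 1) $ k) *\<^sub>R u"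
    by (simp add: vec_eq_iff)
  then show ?thesis
    by (metis (no_types, lifting) Suc_eq_plus1 nat.distinct(1) of_nat_eq_0_iff scaleR_left_imp_eq
        scaleR_one scaleR_scaleR right_inverse)
qed

lemma linear_map_parallel:
  fixes L :: "real^'n \<Rightarrow> real^'n"
  assumes lin: "linear L" and par: "\<And>v i j. L v $ i * v $ j = L v $ j * v $ i"
  shows "L v = ((\<Sum>k\<in>UNIV. L (axis k 1) $ k) / CARD('n)) *\<^sub>R v"
proof -
  have pol: "L u $ i * w $ j + L w $ i * u $ j = L u $ j * w $ i + L w $ j * u $ i" for u w i j
    using par[of "u + w" i j] par[of u i j] par[of w i j]
    by (simp add: linear_add[OF lin] algebra_simps)
  have "CARD('n) * (L v $ i) = (\<Sum>k\<in>UNIV. L (axis k 1) $ k) * v $ i" for i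
  proof -
    have e: "(\<Sum>k\<in>UNIV. z $ k *\<^sub>R axis k 1) = z" for z :: "real^'n"
      by (simp add: basis_expansion scalar_mult_eq_scaleR[symmetric])
    have tr: "(\<Sum>k\<in>UNIV. L (axis k 1) $ i * v $ k) = L v $ i"
    proof -
      have "L v = L (\<Sum>k\<in>UNIV. v $ k *\<^sub>R axis k 1)" by (simp only: e)
      also have "\<dots> = (\<Sum>k\<in>UNIV. v $ k *\<^sub>R L (axis k 1))"
        by (simp add: linear_sum[OF lin] linear_cmul[OF lin])
      finally show ?thesis by (simp add: mult.commute)
    qed
    have s: "(\<Sum>k\<in>UNIV. L v $ k * axis k (1::real) $ i) = L v $ i"
      by (simp add: axis_def if_distrib cong: if_cong)
    have "(\<Sum>k\<in>UNIV. L v $ i * axis k 1 $ k + L (axis k 1) $ i * v $ k) =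
      (\<Sum>k\<in>UNIV. L v $ k * axis k 1 $ i + L (axis k 1) $ k * v $ i)"
      by (simp only: pol[of v i])
    then show ?thesis
      unfolding sum.distrib tr s sum_distrib_right[symmetric] by (simp add: axis_def)
  qed
  then show ?thesis
    by (simp add: vec_eq_iff nonzero_eq_divide_eq mult.commute)
qed

subsection \<open>Gauges\<close>

lemma smooth_on_matrix_entries:
  fixes f :: "'a::real_normed_vector \<Rightarrow> real^'n^'m"
  assumes "smooth_on S f" "open S"
  shows "smooth_on S (\<lambda>x. f x $ i $ j)"
  by (rule smooth_on_nth[OF smooth_on_nth[OF assms] assms(2)])

lemma frechet_derivative_eqI: "(f has_derivative D) (at x) \<Longrightarrow> frechet_derivative f (at x) h = D h"
  by (rule fun_cong[OF frechet_derivative_at, symmetric])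

lemma second_derivative_linear:
  fixes f :: "'a::real_normed_vector \<Rightarrow> 'b::euclidean_space"
  assumes "smooth_on S f" "open S" "x \<in> S"
  shows "linear (\<lambda>e. frechet_derivative (\<lambda>y. frechet_derivative f (at y) e) (at x) h)"
  unfolding schwarz[OF assms, of _ h]
  by (rule smooth_on_linear_frechet[OF smooth_on_frechet[OF assms(1)] assms(3)])

lemma bilinear_matrix_form: "bilinear (\<lambda>u v :: real^'n. u \<bullet> (Q *v v))"
  unfolding bilinear_def
  by (auto intro!: linearI simp: inner_add_left matrix_vector_right_distrib inner_add_right
      matrix_vector_mult_scaleR)

lemma symmetric_matrix_inner: "transpose Q = Q \<Longrightarrow> u \<bullet> (Q *v v) = v \<bullet> (Q *v (u :: real^'n))"
  by (metis dot_lmul_matrix inner_commute transpose_matrix_vector)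

lemma bounded_bilinear_matrix_vector_mult:
  "bounded_bilinear ((*v) :: real^'n^'m \<Rightarrow> real^'n \<Rightarrow> real^'m)"
  unfolding bilinear_conv_bounded_bilinear[symmetric] bilinear_def
  by (auto intro!: linearI simp: matrix_vector_mult_add_rdistrib matrix_vector_right_distrib
      matrix_vector_mult_scaleR scaleR_matrix_vector_assoc)

lemma matrix_mult_linear:
  fixes A :: "real^'n^'n"
  shows "A ** (B - C) = A ** B - A ** C" "(B - C) ** A = B ** A - C ** A"
    "A ** (B + C) = A ** B + A ** C" "(B + C) ** A = B ** A + C ** A"
    "A ** (r *\<^sub>R B) = r *\<^sub>R (A ** B)" "(r *\<^sub>R B) ** A = r *\<^sub>R (B ** A)"
  by (simp_all add: vec_eq_iff matrix_matrix_mult_def sum_distrib_left algebra_simps sum_subtractf sum.distrib)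

text \<open>A density that depends on f alone. A linear map P that carries f to g carries frames of
  unit vectors to such frames, so the value is multiplied by the absolute value of det P, and no
  integral over the unit ball is involved.\<close>

definition maxdet :: "(real^'n \<Rightarrow> real) \<Rightarrow> real" where
  "maxdet f = (SUP V\<in>{V::real^'n^'n. \<forall>j. f (column j V) \<le> 1}. \<bar>det V\<bar>)"

definition quadratic :: "(real^'n \<Rightarrow> real) \<Rightarrow> bool" where
  "quadratic f \<longleftrightarrow> (\<exists>Q::real^'n^'n. \<forall>v. (f v)\<^sup>2 = v \<bullet> (Q *v v))"

locale gauge =
  fixes f :: "real^'n \<Rightarrow> real"
  assumes smooth: "smooth_on (- {0}) f"
    and hom: "\<And>r v. r \<ge> 0 \<Longrightarrow> f (r *\<^sub>R v) = r * f v"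
    and pos: "\<And>v. v \<noteq> 0 \<Longrightarrow> f v > 0"
begin

lemma at_0: "f 0 = 0"
  using hom[of 0 0] by simp

lemma bounds:
  obtains m M where "m > 0" "M > 0" "\<And>v. m * norm v \<le> f v" "\<And>v. f v \<le> M * norm v"
proof -
  let ?S = "sphere (0::real^'n) 1"
  have c: "continuous_on ?S f"
    by (rule continuous_on_subset[OF smooth_on_continuous[OF smooth]]) auto
  have ne: "?S \<noteq> {}" by simp
  obtain a where a: "a \<in> ?S" "\<And>v. v \<in> ?S \<Longrightarrow> f a \<le> f v"
    using continuous_attains_inf[OF compact_sphere ne c] by blast
  obtain b where b: "b \<in> ?S" "\<And>v. v \<in> ?S \<Longrightarrow> f v \<le> f b"
    using continuous_attains_sup[OF compact_sphere ne c] by blast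
  have v: "f a * norm v \<le> f v \<and> f v \<le> f b * norm v" for v
  proof (cases "v = 0")
    case False
    have u: "v /\<^sub>R norm v \<in> ?S" using False by simp
    have "f v = norm v * f (v /\<^sub>R norm v)" using hom[of "norm v" "v /\<^sub>R norm v"] False by simp
    then show ?thesis using a(2)[OF u] b(2)[OF u] by (simp add: mult.commute mult_left_mono)
  qed (simp add: at_0)
  have "f a > 0" "f b > 0" using a(1) b(1) by (auto intro!: pos)
  with v show thesis by (intro that[of "f a" "f b"]) auto
qed

text \<open>An invariant inner product without averaging. The linear isometries of f are uniformly
  bounded, so the supremum N of the norms along an orbit is a norm on forms that they preserve. The
  parallelogram law for the Euclidean norm makes the minimizer of N on an invariant convex set
  unique, and a unique minimizer of an invariant problem is invariant.\<close>

lemma invariant_form: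
  obtains Q :: "real^'n^'n" where "transpose Q = Q" "\<And>v. v \<noteq> 0 \<Longrightarrow> v \<bullet> (Q *v v) > 0"
    "\<And>P. (\<And>v. f (P *v v) = f v) \<Longrightarrow> transpose P ** Q ** P = Q"
proof -
  obtain m M where m: "m > 0" and M: "M > 0" and lo: "\<And>v. m * norm v \<le> f v" and hi: "\<And>v. f v \<le> M * norm v"
    using bounds by blast
  define G where "G = {P::real^'n^'n. \<forall>v. f (P *v v) = f v}"
  define act where "act P Q = transpose P ** Q ** P" for P Q :: "real^'n^'n"
  have act_diff: "act P (Q - R) = act P Q - act P R" for P Q R
    unfolding act_def by (simp add: matrix_mult_linear)
  have act_add: "act P (Q + R) = act P Q + act P R" for P Q R
    unfolding act_def by (simp add: matrix_mult_linear)
  have act_scale: "act P (c *\<^sub>R Q) = c *\<^sub>R act P Q" for P Q c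
    unfolding act_def by (simp add: matrix_mult_linear)
  have act_act: "act P' (act P Q) = act (P ** P') Q" for P P' Q
    unfolding act_def by (simp add: matrix_transpose_mul matrix_mul_assoc)
  have act_1: "act (mat 1) Q = Q" for Q unfolding act_def by simp
  have G1: "mat 1 \<in> G" by (simp add: G_def)
  have Gmul: "P ** P' \<in> G" if "P \<in> G" "P' \<in> G" for P P'
    using that by (simp add: G_def matrix_vector_mul_assoc[symmetric])
  have Ginv: "invertible P" if "P \<in> G" for P
  proof -
    have "v = 0" if "P *v v = 0" for v
    proof (rule ccontr)
      assume "v \<noteq> 0"
      then show False using pos[of v] \<open>P \<in> G\<close> that at_0 by (metis (mono_tags, lifting) G_def mem_Collect_eq less_irrefl)
    qed
    then show ?thesis by (metis invertible_left_inverse matrix_left_invertible_ker)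
  qed
  have Ginv': "matrix_inv P \<in> G" if "P \<in> G" for P
  proof -
    have "f (matrix_inv P *v v) = f (P *v (matrix_inv P *v v))" for v using that by (simp add: G_def)
    then show ?thesis
      using matrix_inv_right[OF Ginv[OF that]] by (simp add: G_def matrix_vector_mul_assoc)
  qed
  have Gcol: "norm (P *v v) \<le> M / m * norm v" if "P \<in> G" for P v
  proof -
    have "m * norm (P *v v) \<le> M * norm v" using lo[of "P *v v"] hi[of v] that by (simp add: G_def)
    then show ?thesis using m by (simp add: field_simps)
  qed
  obtain k where k: "k > 0" "\<And>(Q::real^'n^'n) v. norm (Q *v v) \<le> norm Q * norm v * k"
    using bounded_bilinear.pos_bounded[OF bounded_bilinear_matrix_vector_mult] by blast
  define C where "C = (\<Sum>i\<in>(UNIV::'n set). \<Sum>j\<in>(UNIV::'n set). M / m * (M / m * k))"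
  have C: "C > 0" using M m k by (simp add: C_def)
  have nact: "norm (act P Q) \<le> C * norm Q" if P: "P \<in> G" for P Q
  proof -
    have entry: "act P Q $ i $ j = (P *v axis i 1) \<bullet> (Q *v (P *v axis j 1))" for i j
    proof -
      have "act P Q $ i $ j = axis i 1 \<bullet> (act P Q *v axis j 1)"
        by (simp add: inner_axis' matrix_vector_mult_basis column_def)
      also have "\<dots> = axis i 1 \<bullet> (transpose P *v (Q *v (P *v axis j 1)))"
        unfolding act_def by (simp add: matrix_vector_mul_assoc matrix_mul_assoc)
      finally show ?thesis by (metis dot_lmul_matrix transpose_matrix_vector transpose_transpose inner_commute)
    qed
    have "norm (act P Q) \<le> (\<Sum>i\<in>UNIV. norm (act P Q $ i))"
      unfolding norm_vec_def by (rule L2_set_le_sum) simp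
    also have "\<dots> \<le> (\<Sum>i\<in>UNIV. \<Sum>j\<in>UNIV. \<bar>act P Q $ i $ j\<bar>)"
      by (intro sum_mono norm_le_l1_cart)
    also have "\<dots> \<le> (\<Sum>i\<in>(UNIV::'n set). \<Sum>j\<in>(UNIV::'n set). M / m * (M / m * k) * norm Q)"
    proof (intro sum_mono)
      fix i j
      have "\<bar>act P Q $ i $ j\<bar> \<le> norm (P *v axis i 1) * norm (Q *v (P *v axis j 1))"
        unfolding entry by (rule Cauchy_Schwarz_ineq2)
      also have "\<dots> \<le> (M / m) * (norm Q * (M / m) * k)"
      proof (intro mult_mono)
        show "norm (P *v axis i 1) \<le> M / m" using Gcol[OF P, of "axis i 1"] by simp
        have "norm (Q *v (P *v axis j 1)) \<le> norm Q * norm (P *v axis j 1) * k" by (rule k)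
        also have "\<dots> \<le> norm Q * (M / m) * k"
          using Gcol[OF P, of "axis j 1"] k M m by (intro mult_mono) auto
        finally show "norm (Q *v (P *v axis j 1)) \<le> norm Q * (M / m) * k" .
      qed (use M m in auto)
      finally show "\<bar>act P Q $ i $ j\<bar> \<le> M / m * (M / m * k) * norm Q" by (simp add: mult_ac)
    qed
    also have "\<dots> = C * norm Q" unfolding C_def by (simp add: sum_distrib_right)
    finally show ?thesis .
  qed
  \<comment> \<open>Finite because \<open>nact\<close> bounds all isometries at once, and unchanged
    under the action because they are closed under composition.\<close>
  define N where "N Q = (SUP P\<in>G. norm (act P Q))" for Q
  have bdd: "bdd_above ((\<lambda>P. norm (act P Q)) ` G)" for Q
    using nact by (intro bdd_aboveI2) blast
  have Nup: "norm (act P Q) \<le> N Q" if "P \<in> G" for P Q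
    unfolding N_def by (rule cSUP_upper[OF that bdd])
  have Nle: "N Q \<le> B" if "\<And>P. P \<in> G \<Longrightarrow> norm (act P Q) \<le> B" for Q B
    unfolding N_def by (rule cSUP_least) (use G1 that in auto)
  have Nlip: "N Q \<le> N R + C * norm (Q - R)" for Q R
  proof (rule Nle)
    fix P assume P: "P \<in> G"
    have "act P Q = act P R + act P (Q - R)" by (simp add: act_diff)
    then have "norm (act P Q) \<le> norm (act P R) + norm (act P (Q - R))" by (metis norm_triangle_ineq)
    then show "norm (act P Q) \<le> N R + C * norm (Q - R)"
      using Nup[OF P, of R] nact[OF P, of "Q - R"] by linarith
  qed
  have Ncont: "continuous_on UNIV N"
    unfolding continuous_on_iff
  proof (intro ballI allI impI)
    fix Q :: "real^'n^'n" and e :: real assume e: "e > 0"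
    show "\<exists>d>0. \<forall>R\<in>UNIV. dist R Q < d \<longrightarrow> dist (N R) (N Q) < e"
    proof (intro exI[of _ "e / C"] conjI ballI impI)
      show "e / C > 0" using e C by simp
      fix R assume "dist R Q < e / C"
      then have "C * norm (R - Q) < e" using C by (simp add: dist_norm field_simps)
      then show "dist (N R) (N Q) < e"
        using Nlip[of R Q] Nlip[of Q R] by (simp add: dist_real_def abs_less_iff norm_minus_commute[of Q R])
    qed
  qed
  \<comment> \<open>Dominating the square of f is preserved by isometries of f and by convex
    combinations, is a closed condition, and guarantees positive definiteness.\<close>
  define K where "K = {Q. transpose Q = Q \<and> (\<forall>v. (f v)\<^sup>2 \<le> v \<bullet> (Q *v v))}"
  have lin: "linear (\<lambda>Q::real^'n^'n. v \<bullet> (Q *v v))" for v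
    by (rule linearI) (simp_all add: matrix_vector_mult_add_rdistrib inner_add_right scaleR_matrix_vector_assoc[symmetric])
  have lint: "linear (\<lambda>Q::real^'n^'n. transpose Q)"
    by (rule linearI) (simp_all add: transpose_def vec_eq_iff)
  have Kclosed: "closed K"
    unfolding K_def
    by (intro closed_Collect_conj closed_Collect_all closed_Collect_eq closed_Collect_le continuous_on_const
        continuous_on_id linear_continuous_on[OF linear_conv_bounded_linear[THEN iffD1, OF lin]]
        linear_continuous_on[OF linear_conv_bounded_linear[THEN iffD1, OF lint]])
  have K0: "M\<^sup>2 *\<^sub>R mat 1 \<in> K"
  proof -
    have "(f v)\<^sup>2 \<le> (M * norm v)\<^sup>2" for v
      using hi[of v] lo[of v] m by (intro power_mono) (auto intro: order_trans[rotated])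
    moreover have "v \<bullet> ((M\<^sup>2 *\<^sub>R mat 1) *v v) = (M * norm v)\<^sup>2" for v :: "real^'n"
      by (simp add: scaleR_matrix_vector_assoc[symmetric] power_mult_distrib dot_square_norm)
    moreover have "transpose (M\<^sup>2 *\<^sub>R mat 1) = (M\<^sup>2 *\<^sub>R mat 1 :: real^'n^'n)"
      by (simp add: transpose_def vec_eq_iff mat_def)
    ultimately show ?thesis by (simp add: K_def)
  qed
  \<comment> \<open>N is at least the Euclidean norm, so forms of norm above b cannot beat the known
    competitor, a multiple of the identity; the minimization takes place on a compact set.\<close>
  define b where "b = N (M\<^sup>2 *\<^sub>R mat 1)"
  have nN: "norm Q \<le> N Q" for Q using Nup[OF G1, of Q] by (simp add: act_1)
  have cpt: "compact (K \<inter> cball 0 b)" by (intro closed_Int_compact Kclosed compact_cball)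
  have ne: "K \<inter> cball 0 b \<noteq> {}" using K0 nN[of "M\<^sup>2 *\<^sub>R mat 1"] by (auto simp: b_def simp del: norm_scaleR)
  obtain Q where Q: "Q \<in> K" and Qmin': "\<And>R. R \<in> K \<inter> cball 0 b \<Longrightarrow> N Q \<le> N R"
    using continuous_attains_inf[OF cpt ne continuous_on_subset[OF Ncont]] by blast
  have Qmin: "N Q \<le> N R" if "R \<in> K" for R
  proof (cases "norm R \<le> b")
    case True
    then show ?thesis using Qmin'[of R] that by simp
  next
    case False
    have "N Q \<le> b" unfolding b_def using Qmin'[of "M\<^sup>2 *\<^sub>R mat 1"] K0 nN[of "M\<^sup>2 *\<^sub>R mat 1"]
      by (auto simp: b_def simp del: norm_scaleR)
    then show ?thesis using False nN[of R] by linarith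
  qed
  have uniq: "R = Q" if R: "R \<in> K" and NR: "N R \<le> N Q" for R
  proof (rule ccontr)
    assume "R \<noteq> Q"
    define S where "S = (1/2) *\<^sub>R (Q + R)"
    have SK: "S \<in> K"
    proof -
      have "transpose S = S"
        using Q R by (simp add: S_def K_def linear_cmul[OF lint] linear_add[OF lint])
      moreover have "(f v)\<^sup>2 \<le> v \<bullet> (S *v v)" for v
      proof -
        have "v \<bullet> (S *v v) = (1/2) * (v \<bullet> (Q *v v) + v \<bullet> (R *v v))"
          unfolding S_def linear_cmul[OF lin] linear_add[OF lin] by simp
        moreover have "(f v)\<^sup>2 \<le> v \<bullet> (Q *v v)" "(f v)\<^sup>2 \<le> v \<bullet> (R *v v)" using Q R by (auto simp: K_def)
        ultimately show ?thesis by simp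
      qed
      ultimately show ?thesis by (simp add: K_def)
    qed
    \<comment> \<open>The gain at the midpoint of two minimizers. It is uniform over the group: no
      isometry shrinks Q - R by more than the factor C, as its inverse is an isometry as
      well.\<close>
    define d where "d = (norm (Q - R) / C)\<^sup>2 / 4"
    have d: "d > 0" using \<open>R \<noteq> Q\<close> C by (simp add: d_def)
    have each: "norm (act P S) \<le> sqrt ((N Q)\<^sup>2 - d)" if P: "P \<in> G" for P
    proof -
      have par: "(norm (x + y))\<^sup>2 = 2 * (norm x)\<^sup>2 + 2 * (norm y)\<^sup>2 - (norm (x - y))\<^sup>2" for x y :: "real^'n^'n"
        by (simp add: power2_norm_eq_inner inner_add_left inner_add_right inner_diff_left inner_diff_right inner_commute)
      have "act (matrix_inv P) (act P (Q - R)) = Q - R"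
        unfolding act_act using matrix_inv_right[OF Ginv[OF P]] by (simp add: act_1)
      then have "norm (Q - R) \<le> C * norm (act P (Q - R))"
        using nact[OF Ginv'[OF P], of "act P (Q - R)"] by simp
      then have "norm (Q - R) / C \<le> norm (act P (Q - R))" using C by (simp add: field_simps)
      then have 1: "(norm (Q - R) / C)\<^sup>2 \<le> (norm (act P Q - act P R))\<^sup>2"
        using C by (intro power_mono) (auto simp: act_diff)
      have 2: "(norm (act P Q))\<^sup>2 \<le> (N Q)\<^sup>2" by (intro power_mono Nup P) simp
      have 3: "(norm (act P R))\<^sup>2 \<le> (N Q)\<^sup>2"
        using Nup[OF P, of R] NR by (intro power_mono) auto
      have "act P S = (1/2) *\<^sub>R (act P Q + act P R)" by (simp add: S_def act_scale act_add)
      then have "(norm (act P S))\<^sup>2 = (norm (act P Q + act P R))\<^sup>2 / 4"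
        by (simp add: power_divide)
      also have "\<dots> \<le> (N Q)\<^sup>2 - d" unfolding par d_def using 1 2 3 by simp
      finally show ?thesis by (rule real_le_rsqrt)
    qed
    have "N S \<le> sqrt ((N Q)\<^sup>2 - d)" by (rule Nle[OF each])
    also have "\<dots> < sqrt ((N Q)\<^sup>2)" using d by (intro real_sqrt_less_mono) simp
    also have "\<dots> = N Q" using order_trans[OF norm_ge_zero nN[of Q]] by simp
    finally show False using Qmin[OF SK] by simp
  qed
  show thesis
  proof (rule that)
    show "transpose Q = Q" using Q by (simp add: K_def)
    show "v \<bullet> (Q *v v) > 0" if "v \<noteq> 0" for v
    proof -
      have "0 < (f v)\<^sup>2" using pos[OF that] by simp
      also have "\<dots> \<le> v \<bullet> (Q *v v)" using Q by (simp add: K_def)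
      finally show ?thesis .
    qed
    fix P assume "\<And>v. f (P *v v) = f v"
    then have P: "P \<in> G" by (simp add: G_def)
    have "act P Q \<in> K"
    proof -
      have "v \<bullet> (act P Q *v v) = (P *v v) \<bullet> (Q *v (P *v v))" for v
      proof -
        have "act P Q *v v = transpose P *v (Q *v (P *v v))"
          unfolding act_def by (simp add: matrix_vector_mul_assoc matrix_mul_assoc)
        then show ?thesis by (metis dot_lmul_matrix transpose_matrix_vector transpose_transpose inner_commute)
      qed
      moreover have "(f v)\<^sup>2 \<le> (P *v v) \<bullet> (Q *v (P *v v))" for v
      proof -
        have "(f (P *v v))\<^sup>2 \<le> (P *v v) \<bullet> (Q *v (P *v v))" using Q by (simp add: K_def)
        then show ?thesis using P by (simp add: G_def)
      qed
      moreover have "transpose (act P Q) = act P Q"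
        using Q by (simp add: K_def act_def matrix_transpose_mul matrix_mul_assoc)
      ultimately show ?thesis by (simp add: K_def)
    qed
    moreover have "N (act P Q) \<le> N Q"
      by (rule Nle) (simp add: act_act Nup Gmul P)
    ultimately show "transpose P ** Q ** P = Q" using uniq unfolding act_def by blast
  qed
qed

text \<open>A generates linear maps P(t), found here by solving P' = A P. The hypothesis says that f
  is constant along t \<mapsto> P(t) v, so every P(t) is an isometry and preserves Q; the derivative
  of this invariance at t = 0 is the claim.\<close>

lemma infinitesimal_invariance:
  fixes A Q :: "real^'n^'n"
  assumes A: "\<And>v. v \<noteq> 0 \<Longrightarrow> frechet_derivative f (at v) (A *v v) = 0"
    and Q: "\<And>P. (\<And>v. f (P *v v) = f v) \<Longrightarrow> transpose P ** Q ** P = Q"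
  shows "(A *v y) \<bullet> (Q *v z) + y \<bullet> (Q *v (A *v z)) = 0"
proof -
  have bl: "bounded_linear (\<lambda>P::real^'n^'n. A ** P)"
    unfolding linear_conv_bounded_linear[symmetric]
    by (rule linearI) (simp_all add: matrix_mult_linear)
  have sm: "smooth_on UNIV (\<lambda>P::real^'n^'n. A ** P)"
    by (rule smooth_on_bounded_linear[OF bl smooth_on_id]) auto
  obtain e and P :: "real \<Rightarrow> real^'n^'n" where e: "e > 0" and P0: "P 0 = mat 1"
    and dP: "\<And>t::real. \<bar>t\<bar> < e \<Longrightarrow> (P has_vector_derivative A ** P t) (at t)"
    using picard[OF open_UNIV sm UNIV_I] by metis
  have dPv: "((\<lambda>s. P s *v v) has_vector_derivative A *v (P t *v v)) (at t)" if "\<bar>t\<bar> < e" for t v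
  proof -
    have "bounded_linear (\<lambda>P::real^'n^'n. P *v v)"
      by (rule bounded_bilinear.bounded_linear_left[OF bounded_bilinear_matrix_vector_mult])
    then have "((\<lambda>s. P s *v v) has_vector_derivative (A ** P t) *v v) (at t)"
      by (rule bounded_linear.has_vector_derivative[OF _ dP[OF that]])
    then show ?thesis by (simp add: matrix_vector_mul_assoc)
  qed
  \<comment> \<open>P(t) must be invertible for small t, because f is differentiable only away from
    0 and P(t) v has to stay there.\<close>
  have "((\<lambda>s. det (P s)) has_real_derivative trace (A ** P 0)) (at 0)"
    by (rule det_derivative_at_mat_1[OF dP P0]) (use e in simp)
  then have "((\<lambda>s. det (P s)) \<longlongrightarrow> det (P 0)) (at 0)"
    by (rule DERIV_isCont[unfolded isCont_def])
  then have "\<forall>\<^sub>F s in at 0. det (P s) > 0"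
    by (rule order_tendstoD) (simp add: P0)
  then obtain d where d: "d > 0" "\<And>s. s \<noteq> 0 \<Longrightarrow> \<bar>s\<bar> < d \<Longrightarrow> det (P s) > 0"
    unfolding eventually_at by (auto simp: dist_real_def)
  define r where "r = min d e"
  have r: "r > 0" using d e by (simp add: r_def)
  have detP: "det (P s) \<noteq> 0" if "\<bar>s\<bar> < r" for s
    using d(2)[of s] that P0 by (cases "s = 0") (auto simp: r_def)
  have fP: "f (P s *v v) = f v" if s: "\<bar>s\<bar> < r" for s v
  proof (cases "v = 0")
    case False
    have "((\<lambda>s. f (P s *v v)) has_real_derivative 0) (at t)" if t: "\<bar>t\<bar> < r" for t
    proof -
      have "invertible (P t)" using detP[OF t] invertible_det_nz by blast
      then have nz: "P t *v v \<noteq> 0" using False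
        by (metis invertible_left_inverse matrix_left_invertible_ker)
      have "((\<lambda>s. P s *v v) has_derivative (\<lambda>h. h *\<^sub>R (A *v (P t *v v)))) (at t)"
        using dPv[of t v] t unfolding has_vector_derivative_def by (simp add: r_def)
      moreover have "(f has_derivative frechet_derivative f (at (P t *v v))) (at (P t *v v))"
        by (rule smooth_on_derivative[OF smooth]) (use nz in simp)
      ultimately have "((\<lambda>s. f (P s *v v)) has_derivative
          (\<lambda>h. frechet_derivative f (at (P t *v v)) (h *\<^sub>R (A *v (P t *v v))))) (at t)"
        by (rule has_derivative_compose)
      moreover have "linear (frechet_derivative f (at (P t *v v)))"
        by (rule smooth_on_linear_frechet[OF smooth]) (use nz in simp)
      ultimately show ?thesis
        using A[OF nz] by (simp add: has_field_derivative_def linear_cmul lambda_zero[symmetric])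
    qed
    then have "\<exists>c. \<forall>t\<in>{-r<..<r}. f (P t *v v) = c"
      by (intro has_field_derivative_zero_constant) (auto intro: has_field_derivative_at_within)
    then obtain c where c: "\<And>t. t \<in> {-r<..<r} \<Longrightarrow> f (P t *v v) = c" by blast
    show ?thesis using c[of s] c[of 0] s r by (simp add: P0 abs_less_iff)
  qed simp
  have const: "(P s *v y) \<bullet> (Q *v (P s *v z)) = y \<bullet> (Q *v z)" if "\<bar>s\<bar> < r" for s
  proof -
    have "transpose (P s) ** Q ** P s = Q" using Q fP[OF that] by blast
    then have "y \<bullet> (Q *v z) = y \<bullet> (transpose (P s) *v (Q *v (P s *v z)))"
      by (simp add: matrix_vector_mul_assoc matrix_mul_assoc)
    then show ?thesis by (metis dot_lmul_matrix transpose_matrix_vector transpose_transpose inner_commute)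
  qed
  have bb: "bounded_bilinear (\<lambda>u v :: real^'n. u \<bullet> (Q *v v))"
    using bilinear_matrix_form bilinear_conv_bounded_bilinear by blast
  have "((\<lambda>s. (P s *v y) \<bullet> (Q *v (P s *v z))) has_vector_derivative
      (P 0 *v y) \<bullet> (Q *v (A *v (P 0 *v z))) + (A *v (P 0 *v y)) \<bullet> (Q *v (P 0 *v z))) (at 0)"
    by (rule bounded_bilinear.has_vector_derivative[OF bb dPv dPv]) (use e in auto)
  then have 1: "((\<lambda>s. y \<bullet> (Q *v z)) has_vector_derivative
      (P 0 *v y) \<bullet> (Q *v (A *v (P 0 *v z))) + (A *v (P 0 *v y)) \<bullet> (Q *v (P 0 *v z))) (at 0)"
    by (rule has_vector_derivative_transform_within_open[where S="{-r<..<r}"]) (use r const in auto)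
  have 2: "((\<lambda>s. y \<bullet> (Q *v z)) has_vector_derivative 0) (at (0::real))" by simp
  from vector_derivative_unique_at[OF 1 2] show ?thesis by (simp add: P0)
qed

end

section \<open>Volume, energy and vertical Hessian of a gauge\<close>

context gauge begin

lemma maxdet_bdd:
  "bdd_above ((\<lambda>V. \<bar>det V\<bar>) ` {V::real^'n^'n. \<forall>j. f (column j V) \<le> 1})"
proof -
  obtain m where m: "m > 0" and lo: "\<And>v. m * norm v \<le> f v" using bounds by metis
  show ?thesis
  proof (rule bdd_aboveI2)
    fix V :: "real^'n^'n" assume V: "V \<in> {V. \<forall>j. f (column j V) \<le> 1}"
    have e: "\<bar>V $ i $ j\<bar> \<le> 1 / m" for i j
    proof -
      have "m * norm (column j V) \<le> 1" using lo[of "column j V"] V by (simp add: order_trans)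
      then have "norm (column j V) \<le> 1 / m" using m by (simp add: field_simps)
      moreover have "\<bar>column j V $ i\<bar> \<le> norm (column j V)" by (rule component_le_norm_cart)
      ultimately show ?thesis by (simp add: column_def)
    qed
    have "\<bar>det V\<bar> \<le> (\<Sum>p\<in>{p. p permutes (UNIV::'n set)}. \<bar>of_int (sign p) * (\<Prod>i\<in>UNIV. V $ i $ p i)\<bar>)"
      unfolding det_def by (rule sum_abs)
    also have "\<dots> \<le> (\<Sum>p\<in>{p. p permutes (UNIV::'n set)}. \<Prod>i\<in>(UNIV::'n set). 1 / m)"
    proof (rule sum_mono)
      fix p
      have "\<bar>of_int (sign p) * (\<Prod>i\<in>UNIV. V $ i $ p i)\<bar> = (\<Prod>i\<in>UNIV. \<bar>V $ i $ p i\<bar>)"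
        by (simp add: abs_mult abs_prod sign_def)
      also have "\<dots> \<le> (\<Prod>i\<in>(UNIV::'n set). 1 / m)" by (rule prod_mono) (use e in auto)
      finally show "\<bar>of_int (sign p) * (\<Prod>i\<in>UNIV. V $ i $ p i)\<bar> \<le> (\<Prod>i\<in>(UNIV::'n set). 1 / m)" .
    qed
    finally show "\<bar>det V\<bar> \<le> (\<Sum>p\<in>{p. p permutes (UNIV::'n set)}. \<Prod>i\<in>(UNIV::'n set). 1 / m)" .
  qed
qed

lemma maxdet_pos: "maxdet f > 0"
proof -
  obtain M where M: "M > 0" and hi: "\<And>v. f v \<le> M * norm v" using bounds by metis
  let ?V = "(1 / M) *\<^sub>R mat 1 :: real^'n^'n"
  have "column j ?V = (1 / M) *\<^sub>R axis j 1" for j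
    by (simp add: vec_eq_iff column_def mat_def axis_def)
  then have "f (column j ?V) \<le> 1" for j
    using hi[of "(1 / M) *\<^sub>R axis j 1"] M by simp
  then have "\<bar>det ?V\<bar> \<le> maxdet f"
    unfolding maxdet_def by (intro cSUP_upper maxdet_bdd) simp
  moreover have "det ?V = (\<Prod>i\<in>(UNIV::'n set). 1 / M)"
    by (subst det_diagonal) (auto simp: mat_def)
  then have "det ?V > 0" using M by (simp add: prod_pos)
  ultimately show ?thesis by simp
qed

lemma euler: "v \<noteq> 0 \<Longrightarrow> frechet_derivative f (at v) v = f v"
proof -
  assume v: "v \<noteq> 0"
  have "((\<lambda>t. f (0 + t *\<^sub>R v)) has_derivative (\<lambda>h. h *\<^sub>R frechet_derivative f (at (0 + 1 *\<^sub>R v)) v)) (at 1)"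
    by (rule has_derivative_along_line) (use smooth_on_derivative[OF smooth] v in simp)
  moreover have "((\<lambda>t. t * f v) has_derivative (\<lambda>h. h * f v)) (at 1)"
    by (auto intro!: derivative_eq_intros)
  then have "((\<lambda>t. f (0 + t *\<^sub>R v)) has_derivative (\<lambda>h. h * f v)) (at 1)"
    by (rule has_derivative_transform_within_open[OF _ open_greaterThan[of 0]]) (auto simp: hom)
  ultimately have "(\<lambda>h. h *\<^sub>R frechet_derivative f (at (0 + 1 *\<^sub>R v)) v) = (\<lambda>h. h * f v)"
    by (rule has_derivative_unique)
  from fun_cong[OF this, of 1] show ?thesis by simp
qed

text \<open>The Lagrangian on one tangent space. It is homogeneous of degree 2, so its gradient has
  degree 1 and its Hessian degree 0.\<close>

definition en where "en v = (f v)\<^sup>2 / 2"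

lemma en_smooth: "smooth_on (- {0}) en"
proof -
  have "smooth_on (- {0}) (\<lambda>v. f v * f v * (1/2))"
    by (rule smooth_on_mult[OF smooth_on_mult[OF smooth smooth] smooth_on_const]) auto
  moreover have "en = (\<lambda>v. f v * f v * (1/2))" by (rule ext) (simp add: en_def power2_eq_square)
  ultimately show ?thesis by simp
qed

lemma en_hom: "r \<ge> 0 \<Longrightarrow> en (r *\<^sub>R v) = r\<^sup>2 * en v"
  by (simp add: en_def hom power_mult_distrib)

lemma en_pos: "v \<noteq> 0 \<Longrightarrow> en v > 0"
  using pos[of v] by (simp add: en_def)

lemma en_derivative: "v \<noteq> 0 \<Longrightarrow> frechet_derivative en (at v) z = f v * frechet_derivative f (at v) z"
proof (rule frechet_derivative_eqI)
  assume "v \<noteq> 0"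
  then have "(f has_derivative frechet_derivative f (at v)) (at v)"
    by (intro smooth_on_derivative[OF smooth]) simp
  then show "(en has_derivative (\<lambda>z. f v * frechet_derivative f (at v) z)) (at v)"
    unfolding en_def[abs_def] by (auto intro!: derivative_eq_intros)
qed

lemma en_euler: "v \<noteq> 0 \<Longrightarrow> frechet_derivative en (at v) v = 2 * en v"
  by (simp add: en_derivative euler) (simp add: en_def power2_eq_square)

lemma en_derivative_hom:
  assumes v: "v \<noteq> 0" and r: "r > 0"
  shows "frechet_derivative en (at (r *\<^sub>R v)) e = r * frechet_derivative en (at v) e"
proof -
  have 1: "((\<lambda>v. r *\<^sub>R v) has_derivative (\<lambda>h. r *\<^sub>R h)) (at v)" by (auto intro!: derivative_eq_intros)
  have 2: "(en has_derivative frechet_derivative en (at (r *\<^sub>R v))) (at (r *\<^sub>R v))"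
    by (rule smooth_on_derivative[OF en_smooth]) (use v r in simp)
  have 3: "((\<lambda>v. r\<^sup>2 * en v) has_derivative (\<lambda>h. r\<^sup>2 * frechet_derivative en (at v) h)) (at v)"
    by (rule has_derivative_mult_right[OF smooth_on_derivative[OF en_smooth]]) (use v in simp)
  have "(\<lambda>v. en (r *\<^sub>R v)) = (\<lambda>v. r\<^sup>2 * en v)" using r by (simp add: en_hom)
  from has_derivative_unique[OF has_derivative_compose[OF 1 2, unfolded this] 3]
  have "frechet_derivative en (at (r *\<^sub>R v)) (r *\<^sub>R e) = r\<^sup>2 * frechet_derivative en (at v) e"
    by (rule fun_cong)
  moreover have "linear (frechet_derivative en (at (r *\<^sub>R v)))" using has_derivative_linear[OF 2] .
  ultimately show ?thesis using r by (simp add: linear_cmul power2_eq_square)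
qed

definition hess where "hess v e = frechet_derivative (\<lambda>w. frechet_derivative en (at w) e) (at v)"

lemma hess_derivative:
  "v \<noteq> 0 \<Longrightarrow> ((\<lambda>w. frechet_derivative en (at w) e) has_derivative hess v e) (at v)"
  unfolding hess_def by (rule smooth_on_derivative[OF smooth_on_frechet[OF en_smooth]]) simp

lemma hess_hom:
  assumes v: "v \<noteq> 0" and r: "r > 0"
  shows "hess (r *\<^sub>R v) e h = hess v e h"
proof -
  have 1: "((\<lambda>v. r *\<^sub>R v) has_derivative (\<lambda>h. r *\<^sub>R h)) (at v)" by (auto intro!: derivative_eq_intros)
  have 2: "((\<lambda>w. frechet_derivative en (at w) e) has_derivative hess (r *\<^sub>R v) e) (at (r *\<^sub>R v))"
    by (rule hess_derivative) (use v r in simp)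
  have 3: "((\<lambda>w. r * frechet_derivative en (at w) e) has_derivative (\<lambda>h. r * hess v e h)) (at v)"
    by (rule has_derivative_mult_right[OF hess_derivative[OF v]])
  have 4: "((\<lambda>w. frechet_derivative en (at (r *\<^sub>R w)) e) has_derivative (\<lambda>h. r * hess v e h)) (at v)"
    by (rule has_derivative_transform_within_open[OF 3, of "-{0}"])
      (use v r in \<open>auto simp: en_derivative_hom\<close>)
  from has_derivative_unique[OF has_derivative_compose[OF 1 2] 4]
  have "hess (r *\<^sub>R v) e (r *\<^sub>R h) = r * hess v e h" by (rule fun_cong)
  moreover have "linear (hess (r *\<^sub>R v) e)" using has_derivative_linear[OF 2] .
  ultimately show ?thesis using r by (simp add: linear_cmul)
qed

lemma hess_linear: "v \<noteq> 0 \<Longrightarrow> linear (hess v e)" "v \<noteq> 0 \<Longrightarrow> linear (\<lambda>e. hess v e h)"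
  using has_derivative_linear[OF hess_derivative]
    second_derivative_linear[OF en_smooth, of v h] unfolding hess_def by auto

lemma hess_expand: "v \<noteq> 0 \<Longrightarrow> hess v e h = (\<Sum>j\<in>UNIV. hess v e (axis j 1) * h $ j)"
proof -
  assume v: "v \<noteq> 0"
  have "h = (\<Sum>j\<in>UNIV. h $ j *\<^sub>R axis j 1)"
    by (simp add: basis_expansion scalar_mult_eq_scaleR[symmetric])
  then have "hess v e h = hess v e (\<Sum>j\<in>UNIV. h $ j *\<^sub>R axis j 1)" by simp
  then show ?thesis
    by (simp add: linear_sum[OF hess_linear(1)[OF v]] linear_cmul[OF hess_linear(1)[OF v]] mult.commute)
qed

text \<open>Minimize \<open>en v\<close> relative to \<open>norm v ^ 2\<close>.\<close>

lemma hess_positive_somewhere: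
  obtains v m where "v \<noteq> 0" "m > 0" "\<And>h. hess v h h \<ge> m * (h \<bullet> h)"
proof -
  let ?S = "sphere (0::real^'n) 1"
  have c: "continuous_on ?S en"
    by (rule continuous_on_subset[OF smooth_on_continuous[OF en_smooth]]) auto
  have ne: "?S \<noteq> {}" by simp
  obtain a where a: "a \<in> ?S" "\<And>v. v \<in> ?S \<Longrightarrow> en a \<le> en v"
    using continuous_attains_inf[OF compact_sphere ne c] by blast
  define m where "m = en a"
  have a0: "a \<noteq> 0" using a by auto
  have m: "m > 0" unfolding m_def by (rule en_pos[OF a0])
  have lo: "en v \<ge> m * (v \<bullet> v)" for v
  proof (cases "v = 0")
    case False
    have u: "v /\<^sub>R norm v \<in> ?S" using False by simp
    have "en v = (norm v)\<^sup>2 * en (v /\<^sub>R norm v)" using en_hom[of "norm v" "v /\<^sub>R norm v"] False by simp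
    also have "\<dots> \<ge> (norm v)\<^sup>2 * m" unfolding m_def using a(2)[OF u] by (intro mult_left_mono) auto
    finally show ?thesis by (simp add: mult.commute dot_square_norm)
  qed (simp add: en_def at_0)
  have "hess a h h \<ge> 2 * m * (h \<bullet> h)" for h
  proof (rule ccontr)
    assume neg: "\<not> ?thesis"
    \<comment> \<open>The excess of \<open>en\<close> over its quadratic lower bound along a line
      through the minimizer. It is nonnegative and vanishes at 0; a negative second derivative there
      would make it negative just to the right.\<close>
    define \<phi> where "\<phi> t = en (a + t *\<^sub>R h) - m * ((a + t *\<^sub>R h) \<bullet> (a + t *\<^sub>R h))" for t
    define \<phi>' where "\<phi>' t = frechet_derivative en (at (a + t *\<^sub>R h)) h - 2 * m * ((a + t *\<^sub>R h) \<bullet> h)" for t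
    have \<phi>0: "\<phi> 0 = 0" using a(1) by (simp add: \<phi>_def m_def dot_square_norm)
    have \<phi>nn: "\<phi> t \<ge> 0" for t unfolding \<phi>_def using lo[of "a + t *\<^sub>R h"] by simp
    have d1: "(\<phi> has_real_derivative \<phi>' t) (at t)" if nz: "a + t *\<^sub>R h \<noteq> 0" for t
    proof -
      have "((\<lambda>t. en (a + t *\<^sub>R h)) has_derivative (\<lambda>s. s *\<^sub>R frechet_derivative en (at (a + t *\<^sub>R h)) h)) (at t)"
        by (rule has_derivative_along_line[OF smooth_on_derivative[OF en_smooth]]) (use nz in simp)
      moreover have "((\<lambda>t. m * ((a + t *\<^sub>R h) \<bullet> (a + t *\<^sub>R h))) has_derivative
          (\<lambda>s. s * (2 * m * ((a + t *\<^sub>R h) \<bullet> h)))) (at t)"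
        by (rule derivative_eq_intros refl)+ (simp add: inner_commute algebra_simps)
      ultimately have "(\<phi> has_derivative (\<lambda>s. s *\<^sub>R frechet_derivative en (at (a + t *\<^sub>R h)) h -
          s * (2 * m * ((a + t *\<^sub>R h) \<bullet> h)))) (at t)"
        unfolding \<phi>_def by (rule has_derivative_diff)
      moreover have "(\<lambda>s. s *\<^sub>R frechet_derivative en (at (a + t *\<^sub>R h)) h -
          s * (2 * m * ((a + t *\<^sub>R h) \<bullet> h))) = (\<lambda>s. s * \<phi>' t)"
        by (simp add: \<phi>'_def algebra_simps)
      ultimately show ?thesis by (simp add: has_field_derivative_def mult_commute_abs)
    qed
    have d2: "(\<phi>' has_real_derivative (hess a h h - 2 * m * (h \<bullet> h))) (at 0)"
    proof -
      have "((\<lambda>t. frechet_derivative en (at (a + t *\<^sub>R h)) h) has_derivative (\<lambda>s. s *\<^sub>R hess (a + 0 *\<^sub>R h) h h)) (at 0)"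
        by (rule has_derivative_along_line[OF hess_derivative]) (use a0 in simp)
      moreover have "((\<lambda>t. 2 * m * ((a + t *\<^sub>R h) \<bullet> h)) has_derivative (\<lambda>s. s * (2 * m * (h \<bullet> h)))) (at 0)"
        by (rule derivative_eq_intros refl)+ (simp add: algebra_simps)
      ultimately have "(\<phi>' has_derivative (\<lambda>s. s *\<^sub>R hess (a + 0 *\<^sub>R h) h h - s * (2 * m * (h \<bullet> h)))) (at 0)"
        unfolding \<phi>'_def by (rule has_derivative_diff)
      moreover have "(\<lambda>s. s *\<^sub>R hess (a + 0 *\<^sub>R h) h h - s * (2 * m * (h \<bullet> h))) =
          (\<lambda>s. s * (hess a h h - 2 * m * (h \<bullet> h)))"
        by (simp add: algebra_simps)
      ultimately show ?thesis by (simp add: has_field_derivative_def mult_commute_abs)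
    qed
    have "\<phi>' 0 = 0"
      by (rule DERIV_local_min[OF d1, of 0 1]) (use a0 \<phi>0 \<phi>nn in auto)
    obtain d where d: "d > 0" "\<And>t. 0 < t \<Longrightarrow> t < d \<Longrightarrow> \<phi>' t < \<phi>' 0"
      using DERIV_neg_dec_right[OF d2] neg by auto
    \<comment> \<open>The point a has norm 1, so for t below r the line cannot pass through the
      origin, where \<open>en\<close> need not be smooth.\<close>
    define r where "r = 1 / (norm h + 1)"
    have r: "r > 0" by (simp add: r_def add_nonneg_pos)
    have nz: "a + t *\<^sub>R h \<noteq> 0" if "0 \<le> t" "t < r" for t
    proof
      assume "a + t *\<^sub>R h = 0"
      then have "norm a = norm (t *\<^sub>R h)" by (metis add_eq_0_iff norm_minus_cancel)
      then have 1: "1 = t * norm h" using a(1) that by simp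
      have "norm h + 1 > 0" by (simp add: add_nonneg_pos)
      then have "t * (norm h + 1) < 1" using that by (simp add: r_def pos_less_divide_eq)
      then show False using 1 that by (simp add: algebra_simps)
    qed
    define s where "s = min d r / 2"
    have s: "s > 0" "s < d" "s < r" using d r by (auto simp: s_def)
    have "(\<phi> has_derivative (\<lambda>k. k * \<phi>' t)) (at t)" if "0 \<le> t" "t \<le> s" for t
      using d1[OF nz] that s by (simp add: has_field_derivative_def mult_commute_abs)
    then obtain t where t: "0 < t" "t < s" "\<phi> s - \<phi> 0 = s * \<phi>' t"
      using mvt_from_0[OF s(1), of \<phi> \<phi>'] by metis
    have "\<phi>' t < 0" using d(2)[of t] t s \<open>\<phi>' 0 = 0\<close> by simp
    then have "\<phi> s < 0" using t \<phi>0 s by (simp add: mult_pos_neg)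
    then show False using \<phi>nn[of s] by simp
  qed
  then show thesis using that[of a "2 * m"] a0 m by simp
qed

text \<open>The determinant of the Hessian matrix is continuous and nonzero at the point of
  positivity, hence nonzero on a neighbourhood. Homogeneity of degree 0 extends this to the positive
  rays through S, as is required later: a reparametrized geodesic has velocity r * v with an unknown
  r > 0.\<close>

lemma hess_nondegenerate:
  obtains S where "open S" "S \<noteq> {}" "0 \<notin> S"
    "\<And>v r h. v \<in> S \<Longrightarrow> r > 0 \<Longrightarrow> (\<And>e. hess (r *\<^sub>R v) e h = 0) \<Longrightarrow> h = 0"
proof -
  define H where "H v = (\<chi> i j. hess v (axis i 1) (axis j 1))" for v
  have Hv: "H v *v h = (\<chi> i. hess v (axis i 1) h)" if "v \<noteq> 0" for v h
    by (simp add: H_def matrix_vector_mult_def hess_expand[OF that, of _ h])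
  have sm: "smooth_on (-{0}) (\<lambda>v. H v $ i $ j)" for i j
    unfolding H_def hess_def by (simp add: smooth_on_frechet[OF smooth_on_frechet[OF en_smooth]])
  have "smooth_on (-{0}) (\<lambda>v. det (H v))" by (rule smooth_on_det[OF sm]) auto
  then have cont: "continuous_on (-{0}) (\<lambda>v. det (H v))" by (rule smooth_on_continuous)
  define S where "S = {v \<in> -{0}. det (H v) \<noteq> 0}"
  have "open ((-{0}) \<inter> (\<lambda>v. det (H v)) -` (-{0}))"
    by (rule continuous_open_preimage[OF cont]) auto
  moreover have "S = (-{0}) \<inter> (\<lambda>v. det (H v)) -` (-{0})" by (auto simp: S_def)
  ultimately have oS: "open S" by simp
  obtain a m where a: "a \<noteq> 0" "m > 0" "\<And>h. hess a h h \<ge> m * (h \<bullet> h)"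
    by (rule hess_positive_somewhere) blast
  have aS: "a \<in> S"
  proof -
    have "h = 0" if "H a *v h = 0" for h
    proof -
      have 0: "hess a (axis i 1) h = 0" for i using that unfolding Hv[OF a(1)] by (simp add: vec_eq_iff)
      have "h = (\<Sum>j\<in>UNIV. h $ j *\<^sub>R axis j 1)"
        by (simp add: basis_expansion scalar_mult_eq_scaleR[symmetric])
      then have "hess a h h = hess a (\<Sum>j\<in>UNIV. h $ j *\<^sub>R axis j 1) h" by simp
      also have "\<dots> = 0"
        by (simp add: linear_sum[OF hess_linear(2)[OF a(1)]] linear_cmul[OF hess_linear(2)[OF a(1)]] 0)
      finally have "m * (h \<bullet> h) \<le> 0" using a(3)[of h] by simp
      then have "h \<bullet> h \<le> 0" using a(2) by (simp add: mult_le_0_iff)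
      then have "h \<bullet> h = 0" using inner_ge_zero[of h] by linarith
      then show "h = 0" by simp
    qed
    then have "invertible (H a)" by (metis invertible_left_inverse matrix_left_invertible_ker)
    then show ?thesis using a(1) by (simp add: S_def invertible_det_nz)
  qed
  have nd: "h = 0" if "v \<in> S" "r > 0" "\<And>e. hess (r *\<^sub>R v) e h = 0" for v r h
  proof -
    have v: "v \<noteq> 0" using that by (simp add: S_def)
    have "H v *v h = 0" unfolding Hv[OF v] using that(3) by (simp add: hess_hom[OF v that(2)] vec_eq_iff)
    moreover have "invertible (H v)" using that(1) by (simp add: S_def invertible_det_nz)
    ultimately show ?thesis by (metis invertible_left_inverse matrix_left_invertible_ker)
  qed
  show thesis
    by (rule that[of S, OF oS _ _ nd]) (use aS in \<open>auto simp: S_def\<close>)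
qed

text \<open>\<eta> is the gradient of the energy with respect to Q. If it were parallel to the
  position vector everywhere, the quotient of the energy by the quadratic form of Q would have zero
  derivative, so f would be the norm of a multiple of Q. Independence at one point persists on an
  open set.\<close>

lemma gradient_independent:
  fixes Q :: "real^'n^'n"
  assumes n: "CARD('n) \<ge> 2" and sym: "transpose Q = Q" and Qpos: "\<And>v. v \<noteq> 0 \<Longrightarrow> v \<bullet> (Q *v v) > 0"
    and nq: "\<not> quadratic f"
  obtains S \<eta> where "open S" "S \<noteq> {}" "0 \<notin> S"
    "\<And>\<xi> z. \<xi> \<in> S \<Longrightarrow> frechet_derivative en (at \<xi>) z = \<eta> \<xi> \<bullet> (Q *v z)"
    "\<And>\<xi>. \<xi> \<in> S \<Longrightarrow> \<eta> \<xi> \<noteq> 0" "\<And>\<xi> r. \<xi> \<in> S \<Longrightarrow> \<xi> \<noteq> r *\<^sub>R \<eta> \<xi>"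
proof -
  let ?q = "\<lambda>v. v \<bullet> (Q *v v)"
  have inv: "invertible Q"
    using Qpos by (metis inner_zero_right invertible_left_inverse less_irrefl matrix_left_invertible_ker)
  define \<eta> where "\<eta> \<xi> = matrix_inv Q *v (\<chi> i. frechet_derivative en (at \<xi>) (axis i 1))" for \<xi>
  have \<eta>: "frechet_derivative en (at \<xi>) z = \<eta> \<xi> \<bullet> (Q *v z)" if "\<xi> \<noteq> 0" for \<xi> z
  proof -
    have lin: "linear (frechet_derivative en (at \<xi>))"
      by (rule smooth_on_linear_frechet[OF en_smooth]) (use that in simp)
    have "z = (\<Sum>j\<in>UNIV. z $ j *\<^sub>R axis j 1)"
      by (simp add: basis_expansion scalar_mult_eq_scaleR[symmetric])
    then have "frechet_derivative en (at \<xi>) z = frechet_derivative en (at \<xi>) (\<Sum>j\<in>UNIV. z $ j *\<^sub>R axis j 1)" by simp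
    also have "\<dots> = z \<bullet> (\<chi> i. frechet_derivative en (at \<xi>) (axis i 1))"
      by (simp add: linear_sum[OF lin] linear_cmul[OF lin] inner_vec_def)
    also have "\<dots> = z \<bullet> (Q *v \<eta> \<xi>)"
      by (simp add: \<eta>_def matrix_vector_mul_assoc matrix_inv_right[OF inv])
    also have "\<dots> = \<eta> \<xi> \<bullet> (Q *v z)" by (rule symmetric_matrix_inner[OF sym])
    finally show ?thesis .
  qed
  have \<eta>0: "\<eta> \<xi> \<noteq> 0" if "\<xi> \<noteq> 0" for \<xi>
    using \<eta>[OF that, of \<xi>] en_euler[OF that] en_pos[OF that] by auto
  have "\<exists>\<xi>. \<xi> \<noteq> 0 \<and> (\<forall>r. \<xi> \<noteq> r *\<^sub>R \<eta> \<xi>)"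
  proof (rule ccontr)
    assume "\<not> ?thesis"
    then have "\<exists>r. \<xi> = r *\<^sub>R \<eta> \<xi>" if "\<xi> \<noteq> 0" for \<xi> using that by blast
    then obtain \<rho> where \<rho>: "\<And>\<xi>. \<xi> \<noteq> 0 \<Longrightarrow> \<xi> = \<rho> \<xi> *\<^sub>R \<eta> \<xi>" by metis
    \<comment> \<open>With \<xi> = \<rho> \<eta>, the differential of the form and that of the
      energy are proportional, and Euler's relation gives the values of both functions with the same
      factor; the numerator of the quotient rule cancels.\<close>
    have der: "((\<lambda>v. en v / ?q v) has_derivative (\<lambda>h. 0)) (at \<xi>)" if nz: "\<xi> \<noteq> 0" for \<xi>
    proof -
      have q: "?q \<xi> > 0" by (rule Qpos[OF nz])
      have bb: "bounded_bilinear (\<lambda>u v :: real^'n. u \<bullet> (Q *v v))"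
        using bilinear_matrix_form bilinear_conv_bounded_bilinear by blast
      have dq: "(?q has_derivative (\<lambda>h. \<xi> \<bullet> (Q *v h) + h \<bullet> (Q *v \<xi>))) (at \<xi>)"
        by (rule bounded_bilinear.FDERIV[OF bb has_derivative_ident has_derivative_ident])
      have de: "(en has_derivative frechet_derivative en (at \<xi>)) (at \<xi>)"
        by (rule smooth_on_derivative[OF en_smooth]) (use nz in simp)
      have "\<rho> \<xi> \<noteq> 0" using \<rho>[OF nz] nz by (metis scaleR_zero_left)
      have "(frechet_derivative en (at \<xi>) h * ?q \<xi> - en \<xi> * (\<xi> \<bullet> (Q *v h) + h \<bullet> (Q *v \<xi>))) = 0" for h
      proof -
        have 1: "\<xi> \<bullet> (Q *v h) = \<rho> \<xi> * frechet_derivative en (at \<xi>) h"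
          unfolding \<eta>[OF nz] by (metis \<rho>[OF nz] inner_scaleR_left)
        have 2: "?q \<xi> = \<rho> \<xi> * (2 * en \<xi>)"
          using en_euler[OF nz] unfolding \<eta>[OF nz] by (metis \<rho>[OF nz] inner_scaleR_left)
        show ?thesis unfolding symmetric_matrix_inner[OF sym, of h \<xi>] 1 2 by (simp add: algebra_simps)
      qed
      then show ?thesis
        using has_derivative_divide'[OF de dq] q by simp
    qed
    \<comment> \<open>The complement of the origin is connected because the dimension is at least
      2.\<close>
    have conn: "connected (- {0 :: real^'n})"
      by (rule connected_punctured_universe) (use n in simp)
    have "\<exists>c. \<forall>v\<in>-{0}. en v / ?q v = c"
    proof -
      have "en v / ?q v = en (axis undefined 1) / ?q (axis undefined 1)" if "v \<in> -{0}" for v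
        by (rule has_derivative_zero_unique_connected[OF _ conn _ that]) (use der in auto)
      then show ?thesis by blast
    qed
    then obtain c where c: "\<And>v. v \<noteq> 0 \<Longrightarrow> en v / ?q v = c" by auto
    have "(f v)\<^sup>2 = v \<bullet> (((2 * c) *\<^sub>R Q) *v v)" for v
    proof (cases "v = 0")
      case False
      have "en v = c * ?q v" using c[OF False] Qpos[OF False] by (simp add: field_simps)
      then show ?thesis by (simp add: en_def scaleR_matrix_vector_assoc[symmetric])
    qed (simp add: at_0)
    then show False using nq unfolding quadratic_def by blast
  qed
  then obtain \<xi> where \<xi>: "\<xi> \<noteq> 0" "\<And>r. \<xi> \<noteq> r *\<^sub>R \<eta> \<xi>" by blast
  \<comment> \<open>A nonvanishing 2 by 2 minor expresses independence by an open condition, since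
    \<eta> is continuous.\<close>
  have "\<exists>i j. \<xi> $ i * \<eta> \<xi> $ j \<noteq> \<xi> $ j * \<eta> \<xi> $ i"
  proof (rule ccontr)
    assume "\<not> ?thesis"
    then have eq: "\<xi> $ i * \<eta> \<xi> $ j = \<xi> $ j * \<eta> \<xi> $ i" for i j by blast
    obtain j where j: "\<eta> \<xi> $ j \<noteq> 0" using \<eta>0[OF \<xi>(1)] by (metis vec_eq_iff zero_index)
    have "\<xi> = (\<xi> $ j / \<eta> \<xi> $ j) *\<^sub>R \<eta> \<xi>" using eq[of _ j] j by (simp add: vec_eq_iff field_simps)
    then show False using \<xi>(2) by blast
  qed
  then obtain i j where ij: "\<xi> $ i * \<eta> \<xi> $ j \<noteq> \<xi> $ j * \<eta> \<xi> $ i" by blast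
  let ?w = "\<lambda>v. v $ i * \<eta> v $ j - v $ j * \<eta> v $ i"
  have c\<eta>: "continuous_on (-{0}) \<eta>"
    unfolding \<eta>_def
    by (intro linear_continuous_on_compose[OF continuous_on_vec_lambda matrix_vector_mul_linear]
        smooth_on_continuous smooth_on_frechet en_smooth)
  have cont: "continuous_on (-{0}) ?w"
    by (intro continuous_intros c\<eta>)
  show thesis
  proof (rule that[of "(-{0}) \<inter> ?w -` (-{0})" \<eta>])
    show "open ((-{0}) \<inter> ?w -` (-{0}))" by (rule continuous_open_preimage[OF cont]) auto
    show "(-{0}) \<inter> ?w -` (-{0}) \<noteq> {}" using \<xi>(1) ij by auto
    fix v assume v: "v \<in> (-{0}) \<inter> ?w -` (-{0})"
    show "frechet_derivative en (at v) z = \<eta> v \<bullet> (Q *v z)" for z using v \<eta> by auto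
    show "\<eta> v \<noteq> 0" using v \<eta>0 by auto
    show "v \<noteq> r *\<^sub>R \<eta> v" for r
    proof
      assume e: "v = r *\<^sub>R \<eta> v"
      have "v $ i = r * \<eta> v $ i" "v $ j = r * \<eta> v $ j" by (subst e, simp)+
      then show False using v by simp
    qed
  qed auto
qed

end

text \<open>The columns of P ** V are the images under P of the columns of V, so P sends admissible
  frames of f to admissible frames of g. Applying the inequality to the inverse of P gives
  equality.\<close>

lemma maxdet_transform_le:
  fixes P :: "real^'n^'n"
  assumes f: "gauge f" and g: "gauge g" and P: "det P \<noteq> 0" and eq: "\<And>v. g (P *v v) = f v"
  shows "\<bar>det P\<bar> * maxdet f \<le> maxdet g"
proof -
  have "maxdet f \<le> maxdet g / \<bar>det P\<bar>"
    unfolding maxdet_def[of f]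
  proof (rule cSUP_least)
    have "(\<forall>j. f (column j 0) \<le> 1)" using gauge.at_0[OF f] by (simp add: column_def zero_vec_def[symmetric])
    then show "{V::real^'n^'n. \<forall>j. f (column j V) \<le> 1} \<noteq> {}" by blast
    fix V :: "real^'n^'n" assume V: "V \<in> {V. \<forall>j. f (column j V) \<le> 1}"
    have "column j (P ** V) = P *v column j V" for j
      by (simp add: vec_eq_iff column_def matrix_matrix_mult_def matrix_vector_mult_def)
    then have "\<bar>det (P ** V)\<bar> \<le> maxdet g"
      unfolding maxdet_def using V by (intro cSUP_upper gauge.maxdet_bdd[OF g]) (simp add: eq)
    then show "\<bar>det V\<bar> \<le> maxdet g / \<bar>det P\<bar>"
      using P by (simp add: det_mul abs_mult field_simps)
  qed
  then show ?thesis using P by (simp add: field_simps)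
qed

lemma maxdet_transform:
  fixes P :: "real^'n^'n"
  assumes f: "gauge f" and g: "gauge g" and P: "det P \<noteq> 0" and eq: "\<And>v. g (P *v v) = f v"
  shows "maxdet g = \<bar>det P\<bar> * maxdet f"
proof (rule antisym)
  have inv: "invertible P" using P invertible_det_nz by blast
  have d: "det P * det (matrix_inv P) = 1"
    using matrix_inv_right[OF inv] by (metis det_I det_mul)
  have "f (matrix_inv P *v v) = g v" for v
    using eq[of "matrix_inv P *v v"] matrix_inv_right[OF inv] by (simp add: matrix_vector_mul_assoc)
  then have "\<bar>det (matrix_inv P)\<bar> * maxdet g \<le> maxdet f"
    using d by (intro maxdet_transform_le g f) auto
  then have "\<bar>det P\<bar> * (\<bar>det (matrix_inv P)\<bar> * maxdet g) \<le> \<bar>det P\<bar> * maxdet f"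
    by (rule mult_left_mono) simp
  then show "maxdet g \<le> \<bar>det P\<bar> * maxdet f"
    using d by (simp add: mult.assoc[symmetric] abs_mult[symmetric])
qed (rule maxdet_transform_le[OF assms])

lemma quadratic_transform:
  fixes P :: "real^'n^'n"
  assumes P: "det P \<noteq> 0" and eq: "\<And>v. g (P *v v) = f v" and f: "quadratic f"
  shows "quadratic g"
proof -
  obtain Q where Q: "\<And>v. (f v)\<^sup>2 = v \<bullet> (Q *v v)" using f unfolding quadratic_def by blast
  have inv: "invertible P" using P invertible_det_nz by blast
  let ?R = "matrix_inv P"
  have "(g v)\<^sup>2 = v \<bullet> ((transpose ?R ** Q ** ?R) *v v)" for v
  proof -
    have "g v = f (?R *v v)"
      using eq[of "?R *v v"] matrix_inv_right[OF inv] by (simp add: matrix_vector_mul_assoc)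
    then have "(g v)\<^sup>2 = (?R *v v) \<bullet> (Q *v (?R *v v))" by (simp add: Q)
    also have "\<dots> = v \<bullet> (transpose ?R *v (Q *v (?R *v v)))"
      by (metis dot_lmul_matrix transpose_matrix_vector transpose_transpose inner_commute)
    finally show ?thesis by (simp add: matrix_vector_mul_assoc matrix_mul_assoc)
  qed
  then show ?thesis unfolding quadratic_def by blast
qed

subsection \<open>Berwald metrics in a chart\<close>

text \<open>The tensor \<lambda>^i \<delta>^j_k + \<lambda>^j \<delta>^i_k contracted with u^k is
  \<open>outer l u + outer u l\<close>; in this form the first equation becomes a matrix
  identity.\<close>

definition outer :: "real^'n \<Rightarrow> real^'n \<Rightarrow> real^'n^'n" where
  "outer p q = (\<chi> i j. p $ i * q $ j)"

lemma bounded_bilinear_outer: "bounded_bilinear (outer :: real^'n \<Rightarrow> _)"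
  unfolding bilinear_conv_bounded_bilinear[symmetric] bilinear_def
  by (auto intro!: linearI simp: outer_def vec_eq_iff algebra_simps)

lemma bounded_bilinear_matrix_mult: "bounded_bilinear ((**) :: real^'n^'n \<Rightarrow> real^'n^'n \<Rightarrow> real^'n^'n)"
  unfolding bilinear_conv_bounded_bilinear[symmetric] bilinear_def
  by (auto intro!: linearI simp: matrix_mult_linear)

lemma bounded_linear_transpose: "bounded_linear (transpose :: real^'n^'n \<Rightarrow> real^'n^'n)"
  unfolding linear_conv_bounded_linear[symmetric]
  by (rule linearI) (simp_all add: transpose_def vec_eq_iff)

lemma matrix_mult_outer:
  fixes M :: "real^'n^'n"
  shows "M ** outer p q = outer (M *v p) q" "outer p q ** transpose M = outer p (M *v q)"
  by (simp_all add: vec_eq_iff outer_def matrix_matrix_mult_def matrix_vector_mult_def transpose_def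
      sum_distrib_left sum_distrib_right algebra_simps)

lemma bilinear_expand:
  fixes C :: "real^'n \<Rightarrow> real^'n \<Rightarrow> real^'n"
  assumes "bilinear C"
  shows "C u v = (\<Sum>i\<in>UNIV. \<Sum>j\<in>UNIV. (u $ i * v $ j) *\<^sub>R C (axis i 1) (axis j 1))"
proof -
  have e: "z = (\<Sum>k\<in>UNIV. z $ k *\<^sub>R axis k 1)" for z :: "real^'n"
    by (simp add: basis_expansion scalar_mult_eq_scaleR[symmetric])
  have l1: "linear (\<lambda>x. C x y)" and l2: "linear (C x)" for x y
    using assms unfolding bilinear_def by auto
  have "C u v = C (\<Sum>i\<in>UNIV. u $ i *\<^sub>R axis i 1) v" by (subst e[of u]) simp
  also have "\<dots> = (\<Sum>i\<in>UNIV. u $ i *\<^sub>R C (axis i 1) v)"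
    by (simp only: linear_sum[OF l1[of v]] linear_cmul[OF l1[of v]])
  also have "\<dots> = (\<Sum>i\<in>UNIV. u $ i *\<^sub>R C (axis i 1) (\<Sum>j\<in>UNIV. v $ j *\<^sub>R axis j 1))"
    by (subst e[of v]) simp
  also have "\<dots> = (\<Sum>i\<in>UNIV. \<Sum>j\<in>UNIV. (u $ i * v $ j) *\<^sub>R C (axis i 1) (axis j 1))"
    by (simp add: linear_sum[OF l2] linear_cmul[OF l2] scaleR_sum_right)
  finally show ?thesis .
qed

text \<open>A field of bilinear maps is given as smooth only for constant arguments; expansion in
  coordinates allows the arguments to vary.\<close>

lemma smooth_on_bilinear_field:
  fixes C :: "real^'n \<Rightarrow> real^'n \<Rightarrow> real^'n \<Rightarrow> real^'n"
  assumes U: "open U" and S: "open S" and C: "\<And>u v. smooth_on U (\<lambda>x. C x u v)" and bil: "\<And>x. bilinear (C x)"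
    and X: "smooth_on S X" "X ` S \<subseteq> U" and u: "smooth_on S u" and v: "smooth_on S v"
  shows "smooth_on S (\<lambda>y. C (X y) (u y) (v y))"
proof -
  have "smooth_on S (\<lambda>y. (u y $ i * v y $ j) *\<^sub>R C (X y) (axis i 1) (axis j 1))" for i j
    by (rule smooth_on_scaleR[OF smooth_on_mult[OF smooth_on_nth[OF u S] smooth_on_nth[OF v S] S]
          smooth_on_compose[OF C X(1) S U X(2)] S])
  then have "smooth_on S (\<lambda>y. \<Sum>i\<in>UNIV. \<Sum>j\<in>UNIV. (u y $ i * v y $ j) *\<^sub>R C (X y) (axis i 1) (axis j 1))"
    using smooth_on_sum[of UNIV S] S by (intro smooth_on_sum S) blast
  then show ?thesis by (subst bilinear_expand[OF bil])
qed

text \<open>The octahedron argument: there is one cyclic identity for each choice of the last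
  argument. The sum of the first two minus the sum of the other two, rewritten by skewness, leaves
  twice the desired difference.\<close>

lemma pair_symmetry:
  fixes K :: "'a \<Rightarrow> 'a \<Rightarrow> 'a \<Rightarrow> 'a \<Rightarrow> real"
  assumes s1: "\<And>u w v z. K u w v z = - K w u v z" and s2: "\<And>u w v z. K u w v z = - K u w z v"
    and b: "\<And>u w v z. K u w v z + K w v u z + K v u w z = 0"
  shows "K u w v z = K v z u w"
proof -
  have "K u w v z + K w v u z + K v u w z = 0" "K w v z u + K v z w u + K z w v u = 0"
    "K v z u w + K z u v w + K u v z w = 0" "K z u w v + K u w z v + K w z u v = 0"
    by (rule b)+
  moreover have "K w v u z = - K w v z u" "K v u w z = - K u v w z" "K u v w z = - K u v z w" "K v z w u = - K v z u w"
    "K z w v u = - K w z v u" "K w z v u = - K w z u v" "K z u v w = - K z u w v" "K u w z v = - K u w v z"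
    using s1 s2 by blast+
  ultimately show ?thesis by linarith
qed

text \<open>Along a line from a point of S in direction v, the minors of L(p) and p are quadratic
  polynomials in the parameter. They vanish near 0, and their leading coefficient is the minor at
  v.\<close>

lemma parallel_on_open:
  fixes L :: "real^'n \<Rightarrow> real^'n"
  assumes lin: "linear L" and S: "open S" "S \<noteq> {}" and par: "\<And>v. v \<in> S \<Longrightarrow> \<exists>c. L v = c *\<^sub>R v"
  shows "L v $ i * v $ j = L v $ j * v $ i"
proof -
  obtain a where a: "a \<in> S" using S by blast
  then obtain e where e: "e > 0" "ball a e \<subseteq> S" using S open_contains_ball by blast
  define d where "d = e / (norm v + 1)"
  have nv: "norm v + 1 > 0" by (simp add: add_nonneg_pos)
  have d: "d > 0" using e nv by (simp add: d_def)
  let ?w = "\<lambda>p q. L p $ i * q $ j - L p $ j * q $ i"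
  have "?w a a + (?w a v + ?w v a) * t + ?w v v * t\<^sup>2 + 0 * t^3 = 0" if t: "\<bar>t\<bar> < d" for t
  proof -
    have "\<bar>t\<bar> * norm v \<le> \<bar>t\<bar> * (norm v + 1)" by (intro mult_left_mono) auto
    also have "\<dots> < e" using t nv by (simp add: d_def pos_less_divide_eq)
    finally have "a + t *\<^sub>R v \<in> S" using e by (auto simp: dist_norm subset_iff)
    then obtain c where "L (a + t *\<^sub>R v) = c *\<^sub>R (a + t *\<^sub>R v)" using par by blast
    then have "L (a + t *\<^sub>R v) $ i * (a + t *\<^sub>R v) $ j = L (a + t *\<^sub>R v) $ j * (a + t *\<^sub>R v) $ i" by simp
    then show ?thesis
      by (simp add: linear_add[OF lin] linear_cmul[OF lin] algebra_simps power2_eq_square)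
  qed
  from cubic_zero(3)[OF d this] show ?thesis by simp
qed

text \<open>As for linear maps, but the minors of T(p,p) and p are cubic along the line; the
  coefficient of t^3 is the minor at v.\<close>

lemma quadratic_parallel_on_open:
  fixes T :: "real^'n \<Rightarrow> real^'n \<Rightarrow> real^'n"
  assumes bil: "bilinear T" and sym: "\<And>u v. T u v = T v u" and S: "open S" "S \<noteq> {}"
    and par: "\<And>v. v \<in> S \<Longrightarrow> \<exists>c. T v v = c *\<^sub>R v"
  shows "T v v $ i * v $ j = T v v $ j * v $ i"
proof -
  obtain a where a: "a \<in> S" using S by blast
  then obtain e where e: "e > 0" "ball a e \<subseteq> S" using S open_contains_ball by blast
  define d where "d = e / (norm v + 1)"
  have nv: "norm v + 1 > 0" by (simp add: add_nonneg_pos)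
  have d: "d > 0" using e nv by (simp add: d_def)
  let ?w = "\<lambda>p q. p $ i * q $ j - p $ j * q $ i"
  have "?w (T a a) a + (?w (T a a) v + 2 * ?w (T a v) a) * t + (2 * ?w (T a v) v + ?w (T v v) a) * t\<^sup>2 + ?w (T v v) v * t^3 = 0"
    if t: "\<bar>t\<bar> < d" for t
  proof -
    have "\<bar>t\<bar> * norm v \<le> \<bar>t\<bar> * (norm v + 1)" by (intro mult_left_mono) auto
    also have "\<dots> < e" using t nv by (simp add: d_def pos_less_divide_eq)
    finally have "a + t *\<^sub>R v \<in> S" using e by (auto simp: dist_norm subset_iff)
    then obtain c where c: "T (a + t *\<^sub>R v) (a + t *\<^sub>R v) = c *\<^sub>R (a + t *\<^sub>R v)" using par by blast
    have ex: "T (a + t *\<^sub>R v) (a + t *\<^sub>R v) = T a a + t *\<^sub>R T a v + t *\<^sub>R T a v + (t * t) *\<^sub>R T v v"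
      unfolding bilinear_ladd[OF bil] bilinear_radd[OF bil] bilinear_lmul[OF bil] bilinear_rmul[OF bil] sym[of v a]
      by (simp only: scaleR_add_right scaleR_scaleR add.assoc)
    have "?w (T (a + t *\<^sub>R v) (a + t *\<^sub>R v)) (a + t *\<^sub>R v) = 0" unfolding c by simp
    then show ?thesis unfolding ex by (simp add: algebra_simps power2_eq_square power3_eq_cube)
  qed
  from cubic_zero(4)[OF d this] show ?thesis by simp
qed

text \<open>A Berwald metric read in one chart. \<open>C x u v\<close> is the vector \<Gamma>^i_jk
  u^j v^k; handling the Christoffel symbols as a bilinear map keeps indices out of the analysis. The
  axiom \<open>par\<close> is invariance of \<open>F\<close> under parallel transport, for curves
  inside U.\<close>

locale local_berwald =
  fixes U :: "(real^'n) set" and F :: "real^'n \<Rightarrow> real^'n \<Rightarrow> real"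
    and C :: "real^'n \<Rightarrow> real^'n \<Rightarrow> real^'n \<Rightarrow> real^'n"
  assumes U: "open U"
    and Fsm: "smooth_on (U \<times> (- {0})) (\<lambda>(x, v). F x v)"
    and Fhom: "\<And>x r v. x \<in> U \<Longrightarrow> r \<ge> 0 \<Longrightarrow> F x (r *\<^sub>R v) = r * F x v"
    and Fpos: "\<And>x v. x \<in> U \<Longrightarrow> v \<noteq> 0 \<Longrightarrow> F x v > 0"
    and Csm: "\<And>u v. smooth_on U (\<lambda>x. C x u v)"
    and Cbil: "\<And>x. bilinear (C x)"
    and Csym: "\<And>x u v. x \<in> U \<Longrightarrow> C x u v = C x v u"
    and par: "\<And>I x \<xi> s t. open_interval I \<Longrightarrow> smooth_on I x \<Longrightarrow> x ` I \<subseteq> U \<Longrightarrow>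
      (\<And>t. t \<in> I \<Longrightarrow> (\<xi> has_vector_derivative - C (x t) (vector_derivative x (at t)) (\<xi> t)) (at t)) \<Longrightarrow>
      s \<in> I \<Longrightarrow> t \<in> I \<Longrightarrow> F (x s) (\<xi> s) = F (x t) (\<xi> t)"
begin

abbreviation "TU \<equiv> U \<times> (- {0 :: real^'n})"

lemma TU: "open TU"
  using U by (intro open_Times) auto

lemma gauge: "x \<in> U \<Longrightarrow> gauge (F x)"
proof
  assume x: "x \<in> U"
  have "smooth_on (- {0}) (\<lambda>v. (\<lambda>(x, v). F x v) (x, v))"
    by (rule smooth_on_compose[OF Fsm smooth_on_Pair[OF smooth_on_const smooth_on_id] _ TU]) (use x in auto)
  then show "smooth_on (- {0}) (F x)" by simp
qed (simp_all add: Fhom Fpos)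

definition Cm where "Cm x u = matrix (C x u)"

lemma Cm: "Cm x u *v v = C x u v"
  unfolding Cm_def using Cbil[of x] by (simp add: matrix_works bilinear_def)

lemma Cm_smooth: "smooth_on U (\<lambda>x. Cm x u)"
  unfolding Cm_def matrix_def by (intro smooth_on_vec_lambda smooth_on_nth Csm U)

text \<open>P(t) is the matrix of parallel transport along the straight coordinate line from x0 in
  direction e, normalized to the identity at t = 0.\<close>

lemma transport:
  assumes x0: "x0 \<in> U"
  obtains r P where "r > 0" "P 0 = mat 1" "\<And>t. \<bar>t\<bar> < r \<Longrightarrow> x0 + t *\<^sub>R e \<in> U" "\<And>t. \<bar>t\<bar> < r \<Longrightarrow> det (P t) \<noteq> 0"
    "\<And>t. \<bar>t\<bar> < r \<Longrightarrow> (P has_vector_derivative - (Cm (x0 + t *\<^sub>R e) e ** P t)) (at t)"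
    "\<And>t v. \<bar>t\<bar> < r \<Longrightarrow> F (x0 + t *\<^sub>R e) (P t *v v) = F x0 v"
proof -
  \<comment> \<open>The transport equation depends on t through the base point. Carrying the base
    point along as a component with constant derivative e makes the system autonomous, as
    \<open>picard\<close> requires.\<close>
  let ?f = "\<lambda>p :: (real^'n) \<times> (real^'n^'n). (e, - (Cm (fst p) e ** snd p))"
  have oU: "open (U \<times> (UNIV :: (real^'n^'n) set))" using U by (intro open_Times) auto
  have sm: "smooth_on (U \<times> UNIV) ?f"
  proof -
    have i: "smooth_on (U \<times> (UNIV :: (real^'n^'n) set)) (\<lambda>p. p)" by (rule smooth_on_id[OF oU])
    have 1: "smooth_on (U \<times> (UNIV :: (real^'n^'n) set)) (\<lambda>p. Cm (fst p) e)"
      by (rule smooth_on_compose[OF Cm_smooth smooth_on_bounded_linear[OF bounded_linear_fst i oU] oU U]) auto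
    have 2: "smooth_on (U \<times> (UNIV :: (real^'n^'n) set)) (\<lambda>p. snd p)"
      by (rule smooth_on_bounded_linear[OF bounded_linear_snd i oU])
    have "smooth_on (U \<times> (UNIV :: (real^'n^'n) set)) (\<lambda>p. Cm (fst p) e ** snd p)"
      by (rule smooth_on_bilinear[OF bounded_bilinear_matrix_mult 1 2 oU])
    then have "smooth_on (U \<times> (UNIV :: (real^'n^'n) set)) (\<lambda>p. - (Cm (fst p) e ** snd p))"
      by (rule smooth_on_uminus[OF _ oU])
    then show ?thesis by (rule smooth_on_Pair[OF smooth_on_const _ oU])
  qed
  have in0: "(x0, mat 1) \<in> U \<times> (UNIV :: (real^'n^'n) set)" using x0 by simp
  obtain d z where d: "d > 0" and z0: "z 0 = (x0, mat 1)" and zU: "\<And>t::real. \<bar>t\<bar> < d \<Longrightarrow> z t \<in> U \<times> UNIV"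
    and dz: "\<And>t. \<bar>t\<bar> < d \<Longrightarrow> (z has_vector_derivative ?f (z t)) (at t)"
    by (rule picard[OF oU sm in0]) blast
  define P where "P t = snd (z t)" for t
  have dfst: "((\<lambda>t. fst (z t)) has_vector_derivative e) (at t)" if "\<bar>t\<bar> < d" for t
    using bounded_linear.has_vector_derivative[OF bounded_linear_fst dz[OF that]] by simp
  have fst: "fst (z t) = x0 + t *\<^sub>R e" if t: "\<bar>t\<bar> < d" for t
  proof -
    have "((\<lambda>t. fst (z t) - t *\<^sub>R e) has_derivative (\<lambda>h. 0)) (at s within {-d<..<d})" if "s \<in> {-d<..<d}" for s
    proof -
      have "((\<lambda>t. fst (z t) - t *\<^sub>R e) has_vector_derivative e - e) (at s)"
        by (rule has_vector_derivative_diff[OF dfst]) (use that in \<open>auto intro!: derivative_eq_intros\<close>)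
      then show ?thesis by (auto simp: has_vector_derivative_def intro: has_derivative_at_withinI)
    qed
    then have "\<exists>c. \<forall>s\<in>{-d<..<d}. fst (z s) - s *\<^sub>R e = c"
      by (intro has_derivative_zero_constant) auto
    then obtain c where c: "\<And>s. s \<in> {-d<..<d} \<Longrightarrow> fst (z s) - s *\<^sub>R e = c" by blast
    from c[of t] c[of 0] t d show ?thesis by (auto simp: z0 abs_less_iff algebra_simps)
  qed
  have dP: "(P has_vector_derivative - (Cm (x0 + t *\<^sub>R e) e ** P t)) (at t)" if "\<bar>t\<bar> < d" for t
    unfolding P_def using bounded_linear.has_vector_derivative[OF bounded_linear_snd dz[OF that]] by (simp add: fst[OF that])
  have xU: "x0 + t *\<^sub>R e \<in> U" if "\<bar>t\<bar> < d" for t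
    using zU[OF that] fst[OF that] by (metis mem_Times_iff)
  have P0: "P 0 = mat 1" by (simp add: P_def z0)
  have "((\<lambda>s. det (P s)) has_real_derivative trace (- (Cm (x0 + 0 *\<^sub>R e) e ** P 0))) (at 0)"
    by (rule det_derivative_at_mat_1[OF dP P0]) (use d in simp)
  then have "((\<lambda>s. det (P s)) \<longlongrightarrow> det (P 0)) (at 0)"
    by (rule DERIV_isCont[unfolded isCont_def])
  then have "\<forall>\<^sub>F s in at 0. det (P s) > 0"
    by (rule order_tendstoD) (simp add: P0)
  then obtain d' where d': "d' > 0" "\<And>s. s \<noteq> 0 \<Longrightarrow> \<bar>s\<bar> < d' \<Longrightarrow> det (P s) > 0"
    unfolding eventually_at by (auto simp: dist_real_def)
  define r where "r = min d d'"
  have r: "r > 0" using d d' by (simp add: r_def)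
  show thesis
  proof (rule that[of r P, OF r P0])
    fix t assume t: "\<bar>t\<bar> < r"
    then have td: "\<bar>t\<bar> < d" by (simp add: r_def)
    show "x0 + t *\<^sub>R e \<in> U" by (rule xU[OF td])
    show "det (P t) \<noteq> 0" using d'(2)[of t] t P0 by (cases "t = 0") (auto simp: r_def)
    show "(P has_vector_derivative - (Cm (x0 + t *\<^sub>R e) e ** P t)) (at t)" by (rule dP[OF td])
    fix v
    let ?I = "{-r<..<r}"
    have dx: "((\<lambda>t. x0 + t *\<^sub>R e) has_vector_derivative e) (at s)" for s
      by (auto intro!: derivative_eq_intros)
    have "F (x0 + t *\<^sub>R e) (P t *v v) = F (x0 + 0 *\<^sub>R e) (P 0 *v v)"
    proof (rule par[of ?I "\<lambda>t. x0 + t *\<^sub>R e" "\<lambda>t. P t *v v"])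
      show "open_interval ?I" using r by (auto simp: open_interval_def is_interval_def)
      show "smooth_on ?I (\<lambda>t. x0 + t *\<^sub>R e)"
        by (rule smooth_on_vector_derivativeI[OF _ dx smooth_on_const]) auto
      show "(\<lambda>t. x0 + t *\<^sub>R e) ` ?I \<subseteq> U" using xU by (auto simp: r_def abs_less_iff)
      fix s assume "s \<in> ?I"
      then have s: "\<bar>s\<bar> < d" by (auto simp: r_def)
      have bl: "bounded_linear (\<lambda>P::real^'n^'n. P *v v)"
        by (rule bounded_bilinear.bounded_linear_left[OF bounded_bilinear_matrix_vector_mult])
      have "((\<lambda>t. P t *v v) has_vector_derivative (- (Cm (x0 + s *\<^sub>R e) e ** P s)) *v v) (at s)"
        by (rule bounded_linear.has_vector_derivative[OF bl dP[OF s]])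
      moreover have "(- (Cm (x0 + s *\<^sub>R e) e ** P s)) *v v = - C (x0 + s *\<^sub>R e) e (P s *v v)"
        unfolding linear_neg[OF bounded_linear.linear[OF bl]]
        by (simp add: matrix_vector_mul_assoc[symmetric] Cm)
      ultimately show "((\<lambda>t. P t *v v) has_vector_derivative
          - C (x0 + s *\<^sub>R e) (vector_derivative (\<lambda>t. x0 + t *\<^sub>R e) (at s)) (P s *v v)) (at s)"
        using vector_derivative_at[OF dx] by simp
    qed (use t r in auto)
    then show "F (x0 + t *\<^sub>R e) (P t *v v) = F x0 v" by (simp add: P0)
  qed
qed

definition L where "L p = (F (fst p) (snd p))\<^sup>2 / 2"

abbreviation "dL p w \<equiv> frechet_derivative L (at p) w"

lemma L_smooth: "smooth_on TU L"
proof -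
  have "smooth_on TU (\<lambda>p. (case p of (x, v) \<Rightarrow> F x v) * (case p of (x, v) \<Rightarrow> F x v) * (1/2))"
    by (rule smooth_on_mult[OF smooth_on_mult[OF Fsm Fsm TU] smooth_on_const TU])
  moreover have "L = (\<lambda>p. (case p of (x, v) \<Rightarrow> F x v) * (case p of (x, v) \<Rightarrow> F x v) * (1/2))"
    by (rule ext) (simp add: L_def power2_eq_square split: prod.split)
  ultimately show ?thesis by simp
qed

lemma dL: "p \<in> TU \<Longrightarrow> (L has_derivative dL p) (at p)"
  by (rule smooth_on_derivative[OF L_smooth])

lemma dL_linear: "p \<in> TU \<Longrightarrow> linear (dL p)"
  by (rule smooth_on_linear_frechet[OF L_smooth])

lemma ddL: "p \<in> TU \<Longrightarrow> ((\<lambda>p. dL p w) has_derivative frechet_derivative (\<lambda>p. dL p w) (at p)) (at p)"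
  by (rule smooth_on_derivative[OF smooth_on_frechet[OF L_smooth]])

lemma section_derivative: "((\<lambda>v. (x, v)) has_derivative (\<lambda>h. (0, h))) (at v)"
  by (auto intro!: derivative_eq_intros has_derivative_Pair)

lemma section_derivative': "((\<lambda>x. (x, v)) has_derivative (\<lambda>h. (h, 0))) (at x)"
  by (auto intro!: derivative_eq_intros has_derivative_Pair)

lemma en_eq: "x \<in> U \<Longrightarrow> gauge.en (F x) v = L (x, v)"
  by (simp add: gauge.en_def[OF gauge] L_def)

lemma en_section:
  assumes "x \<in> U" "v \<noteq> 0"
  shows "frechet_derivative (gauge.en (F x)) (at v) e = dL (x, v) (0, e)"
proof (rule frechet_derivative_eqI)
  have "((\<lambda>v. L (x, v)) has_derivative (\<lambda>h. dL (x, v) (0, h))) (at v)"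
    by (rule has_derivative_compose[OF section_derivative dL]) (use assms in auto)
  moreover have "gauge.en (F x) = (\<lambda>v. L (x, v))" using en_eq[OF assms(1)] by blast
  ultimately show "(gauge.en (F x) has_derivative (\<lambda>h. dL (x, v) (0, h))) (at v)" by simp
qed

lemma hess_section:
  assumes "x \<in> U" "v \<noteq> 0"
  shows "gauge.hess (F x) v e h = frechet_derivative (\<lambda>p. dL p (0, e)) (at (x, v)) (0, h)"
  unfolding gauge.hess_def[OF gauge[OF assms(1)]]
proof (rule frechet_derivative_eqI)
  have "((\<lambda>v. dL (x, v) (0, e)) has_derivative
      (\<lambda>h. frechet_derivative (\<lambda>p. dL p (0, e)) (at (x, v)) (0, h))) (at v)"
    by (rule has_derivative_compose[OF section_derivative ddL]) (use assms in auto)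
  then show "((\<lambda>w. frechet_derivative (gauge.en (F x)) (at w) e) has_derivative
      (\<lambda>h. frechet_derivative (\<lambda>p. dL p (0, e)) (at (x, v)) (0, h))) (at v)"
    by (rule has_derivative_transform_within_open[of _ _ _ _ "-{0}"]) (use assms en_section in auto)
qed

text \<open>Parallel transport along coordinate lines yields \<open>\<partial>L/\<partial>x\<^sup>k = \<Gamma>\<^sup>i\<^sub>k\<^sub>j v\<^sup>j \<partial>L/\<partial>v\<^sup>i\<close>.\<close>

lemma horizontal:
  assumes "p \<in> TU"
  shows "dL p (u, 0) = dL p (0, C (fst p) u (snd p))"
proof -
  obtain x v where p: "p = (x, v)" and x: "x \<in> U" and v: "v \<noteq> 0" using assms by auto
  obtain r P where r: "r > 0" and P0: "P 0 = mat 1"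
    and dP: "\<And>t. \<bar>t\<bar> < r \<Longrightarrow> (P has_vector_derivative - (Cm (x + t *\<^sub>R u) u ** P t)) (at t)"
    and FP: "\<And>t v. \<bar>t\<bar> < r \<Longrightarrow> F (x + t *\<^sub>R u) (P t *v v) = F x v"
    by (rule transport[OF x, of u]) blast
  have bl: "bounded_linear (\<lambda>P::real^'n^'n. P *v v)"
    by (rule bounded_bilinear.bounded_linear_left[OF bounded_bilinear_matrix_vector_mult])
  have "((\<lambda>t. P t *v v) has_vector_derivative (- (Cm (x + 0 *\<^sub>R u) u ** P 0)) *v v) (at 0)"
    by (rule bounded_linear.has_vector_derivative[OF bl dP]) (use r in simp)
  moreover have "(- (Cm (x + 0 *\<^sub>R u) u ** P 0)) *v v = - C x u v"
    unfolding linear_neg[OF bounded_linear.linear[OF bl]] by (simp add: P0 Cm)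
  ultimately have "((\<lambda>t. P t *v v) has_vector_derivative - C x u v) (at 0)" by simp
  moreover have "((\<lambda>t. x + t *\<^sub>R u) has_vector_derivative u) (at 0)" by (auto intro!: derivative_eq_intros)
  ultimately have "((\<lambda>t. (x + t *\<^sub>R u, P t *v v)) has_vector_derivative (u, - C x u v)) (at 0)"
    by (intro has_vector_derivative_Pair)
  then have 1: "((\<lambda>t. (x + t *\<^sub>R u, P t *v v)) has_derivative (\<lambda>h. h *\<^sub>R (u, - C x u v))) (at 0)"
    by (simp add: has_vector_derivative_def)
  have "((\<lambda>t. L (x + t *\<^sub>R u, P t *v v)) has_derivative (\<lambda>h. dL (x, v) (h *\<^sub>R (u, - C x u v)))) (at 0)"
    by (rule has_derivative_compose[OF 1, of L "dL (x, v)"]) (use dL[of "(x, v)"] x v P0 in simp)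
  then have 2: "((\<lambda>t. L (x, v)) has_derivative (\<lambda>h. dL (x, v) (h *\<^sub>R (u, - C x u v)))) (at 0)"
    by (rule has_derivative_transform_within_open[of _ _ _ _ "{-r<..<r}"]) (use r FP in \<open>auto simp: L_def abs_less_iff\<close>)
  from has_derivative_unique[OF 2 has_derivative_const] have "dL (x, v) (1 *\<^sub>R (u, - C x u v)) = 0"
    by (rule fun_cong)
  moreover have "dL (x, v) (u, - C x u v) = dL (x, v) (u, 0) - dL (x, v) (0, C x u v)"
    using linear_diff[OF dL_linear, of "(x, v)" "(u, 0)" "(0, C x u v)"] x v by simp
  ultimately show ?thesis by (simp add: p)
qed

definition dC where "dC x w u v = frechet_derivative (\<lambda>x. C x u v) (at x) w"

lemma dC: "x \<in> U \<Longrightarrow> ((\<lambda>x. C x u v) has_derivative (\<lambda>w. dC x w u v)) (at x)"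
  unfolding dC_def by (rule smooth_on_derivative[OF Csm])

lemma dC_sym: "x \<in> U \<Longrightarrow> dC x w u v = dC x w v u"
  unfolding dC_def by (rule fun_cong[OF frechet_derivative_cong_open[OF U]]) (auto simp: Csym)

lemma dC_linear: "x \<in> U \<Longrightarrow> linear (dC x w u)"
proof
  assume x: "x \<in> U"
  show "dC x w u (v + v') = dC x w u v + dC x w u v'" for v v'
    unfolding dC_def[of x w u "v + v'"] bilinear_radd[OF Cbil]
    by (rule frechet_derivative_eqI[OF has_derivative_add[OF dC[OF x] dC[OF x]]])
  show "dC x w u (r *\<^sub>R v) = r *\<^sub>R dC x w u v" for r v
    unfolding dC_def[of x w u "r *\<^sub>R v"] bilinear_rmul[OF Cbil]
    by (rule frechet_derivative_eqI[OF has_derivative_scaleR_right[OF dC[OF x]]])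
qed

text \<open>The identity \<open>horizontal\<close> holds on an open set and may be differentiated.
  Its right-hand side has a moving direction, whose variation accounts for the second
  summand.\<close>

lemma horizontal_derivative:
  assumes p: "p \<in> TU"
  shows "frechet_derivative (\<lambda>p. dL p (u, 0)) (at p) (w, z) =
    frechet_derivative (\<lambda>q. dL q (0, C (fst p) u (snd p))) (at p) (w, z) +
    dL p (0, dC (fst p) w u (snd p) + C (fst p) u z)"
proof -
  obtain x v where pe: "p = (x, v)" and x: "x \<in> U" and v: "v \<noteq> 0" using p by auto
  have e: "C y u v = (\<Sum>j\<in>UNIV. v $ j *\<^sub>R C y u (axis j 1))" for y v
  proof -
    have "v = (\<Sum>k\<in>UNIV. v $ k *\<^sub>R axis k 1)"
      by (simp add: basis_expansion scalar_mult_eq_scaleR[symmetric])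
    then have "C y u v = C y u (\<Sum>k\<in>UNIV. v $ k *\<^sub>R axis k 1)" by simp
    moreover have l: "linear (C y u)" using Cbil[of y] by (simp add: bilinear_def)
    ultimately show ?thesis by (simp add: linear_sum[OF l] linear_cmul[OF l])
  qed
  have "((\<lambda>p. \<Sum>j\<in>UNIV. snd p $ j *\<^sub>R C (fst p) u (axis j 1)) has_derivative
      (\<lambda>h. \<Sum>j\<in>UNIV. snd p $ j *\<^sub>R dC (fst p) (fst h) u (axis j 1) + snd h $ j *\<^sub>R C (fst p) u (axis j 1))) (at p)"
  proof (intro has_derivative_sum has_derivative_scaleR)
    fix j
    show "((\<lambda>p. snd p $ j) has_derivative (\<lambda>h. snd h $ j)) (at p)"
      by (intro bounded_linear.has_derivative[OF bounded_linear_vec_nth] has_derivative_snd has_derivative_ident)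
    show "((\<lambda>p. C (fst p) u (axis j 1)) has_derivative (\<lambda>h. dC (fst p) (fst h) u (axis j 1))) (at p)"
      by (rule has_derivative_compose[OF has_derivative_fst[OF has_derivative_ident] dC]) (use x pe in simp)
  qed
  moreover have "(\<Sum>j\<in>UNIV. snd p $ j *\<^sub>R dC (fst p) (fst h) u (axis j 1) + snd h $ j *\<^sub>R C (fst p) u (axis j 1))
      = dC x (fst h) u v + C x u (snd h)" for h
  proof -
    have "v = (\<Sum>k\<in>UNIV. v $ k *\<^sub>R axis k 1)"
      by (simp add: basis_expansion scalar_mult_eq_scaleR[symmetric])
    then have "dC x (fst h) u v = dC x (fst h) u (\<Sum>k\<in>UNIV. v $ k *\<^sub>R axis k 1)" by simp
    then have "dC x (fst h) u v = (\<Sum>j\<in>UNIV. v $ j *\<^sub>R dC x (fst h) u (axis j 1))"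
      by (simp add: linear_sum[OF dC_linear[OF x]] linear_cmul[OF dC_linear[OF x]])
    then show ?thesis by (simp add: sum.distrib e[of x "snd h"] pe)
  qed
  ultimately have W: "((\<lambda>p. C (fst p) u (snd p)) has_derivative (\<lambda>h. dC x (fst h) u v + C x u (snd h))) (at p)"
    by (simp add: e[symmetric])
  have "((\<lambda>q. dL q (0, C (fst q) u (snd q))) has_derivative
     (\<lambda>h. frechet_derivative (\<lambda>q. dL q (0, C (fst p) u (snd p))) (at p) h +
        dL p (0, dC x (fst h) u v + C x u (snd h)))) (at p)"
    by (rule has_derivative_frechet_apply[OF L_smooth TU p has_derivative_Pair[OF has_derivative_const W]])
  then have "((\<lambda>q. dL q (u, 0)) has_derivative
     (\<lambda>h. frechet_derivative (\<lambda>q. dL q (0, C (fst p) u (snd p))) (at p) h +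
        dL p (0, dC x (fst h) u v + C x u (snd h)))) (at p)"
    by (rule has_derivative_transform_within_open[OF _ TU p]) (simp add: horizontal)
  from frechet_derivative_eqI[OF this, of "(w, z)"] show ?thesis by (simp add: pe)
qed

text \<open>With velocity v and acceleration b, the left side is the time derivative of the momentum
  component along e. The Euler-Lagrange defect is thus the vertical Hessian applied to the covariant
  acceleration b + C(v,v): geodesics of \<Gamma> are always extremals, and the converse holds where
  the Hessian is nondegenerate.\<close>

lemma euler_lagrange_residual:
  assumes p: "(x, v) \<in> TU"
  shows "frechet_derivative (\<lambda>p. dL p (0, e)) (at (x, v)) (v, b) =
    dL (x, v) (e, 0) + gauge.hess (F x) v e (b + C x v v)"
proof -
  have x: "x \<in> U" and v: "v \<noteq> 0" using p by auto
  let ?D = "\<lambda>w h. frechet_derivative (\<lambda>p. dL p w) (at (x, v)) h"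
  have lin: "linear (?D w)" for w using has_derivative_linear[OF ddL[OF p]] .
  have sch: "?D w h = ?D h w" for w h by (rule schwarz[OF L_smooth TU p])
  \<comment> \<open>Exchanging the order of differentiation makes v a fixed horizontal direction, to
    which \<open>horizontal_derivative\<close> applies.\<close>
  have 1: "?D (0, e) (v, 0) = ?D (0, C x v v) (0, e) + dL (x, v) (0, C x v e)"
  proof -
    have "dC x 0 v v = 0" unfolding dC_def
      by (rule linear_0[OF smooth_on_linear_frechet[OF Csm x]])
    then show ?thesis
      using horizontal_derivative[OF p, of v 0 e] unfolding sch[of "(0, e)" "(v, 0)"] by simp
  qed
  have "?D (0, e) (v, b) = ?D (0, e) (v, 0) + ?D (0, e) (0, b)"
    using linear_add[OF lin[of "(0, e)"], of "(v, 0)" "(0, b)"] by simp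
  also have "\<dots> = dL (x, v) (0, C x v e) + (?D (0, e) (0, C x v v) + ?D (0, e) (0, b))"
    unfolding 1 sch[of "(0, C x v v)" "(0, e)"] by simp
  also have "?D (0, e) (0, C x v v) + ?D (0, e) (0, b) = gauge.hess (F x) v e (b + C x v v)"
    using linear_add[OF lin[of "(0, e)"], of "(0, C x v v)" "(0, b)"]
    by (simp add: hess_section[OF x v] add.commute)
  also have "dL (x, v) (0, C x v e) = dL (x, v) (e, 0)"
    using horizontal[OF p, of e] Csym[OF x, of v e] by simp
  finally show ?thesis .
qed

text \<open>The curvature operator R(u,w) of \<Gamma> applied to v; in \<open>dC x u w v\<close> the
  direction of differentiation is u.\<close>

definition R where "R x u w v = dC x u w v - dC x w u v + C x u (C x w v) - C x w (C x u v)"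

lemma R_linear: "x \<in> U \<Longrightarrow> linear (R x u w)"
proof -
  assume x: "x \<in> U"
  have C: "linear (C x u)" for u using Cbil[of x] by (simp add: bilinear_def)
  show ?thesis unfolding R_def
    by (rule linearI) (simp_all add: linear_add[OF dC_linear[OF x]] linear_cmul[OF dC_linear[OF x]]
        linear_add[OF C] linear_cmul[OF C] algebra_simps)
qed

lemma R_skew: "R x u w v = - R x w u v"
  by (simp add: R_def)

lemma R_bianchi: "x \<in> U \<Longrightarrow> R x u w v + R x w v u + R x v u w = 0"
  by (simp add: R_def dC_sym[of x _ u] dC_sym[of x _ w v] Csym[of x w v] Csym[of x v u] Csym[of x w u])

text \<open>Integrability condition of \<open>horizontal\<close>: the second derivatives of L in two
  base directions commute, and evaluating both orders by \<open>horizontal_derivative\<close> leaves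
  exactly the curvature term.\<close>

lemma R_invariant:
  assumes x: "x \<in> U" and v: "v \<noteq> 0"
  shows "dL (x, v) (0, R x u w v) = 0"
proof -
  have p: "(x, v) \<in> TU" using x v by simp
  let ?D = "\<lambda>w h. frechet_derivative (\<lambda>p. dL p w) (at (x, v)) h"
  have sch: "?D w h = ?D h w" for w h by (rule schwarz[OF L_smooth TU p])
  have lin: "linear (dL (x, v))" by (rule dL_linear[OF p])
  have z: "dC x 0 u v = 0" for u v unfolding dC_def
    by (rule linear_0[OF smooth_on_linear_frechet[OF Csm x]])
  have C0: "C x u 0 = 0" for u using bilinear_rzero[OF Cbil] .
  \<comment> \<open>The first term is the vertical Hessian and is symmetric in u and w; only the
    other two survive antisymmetrization.\<close>
  have A: "?D (u, 0) (w, 0) = ?D (0, C x w v) (0, C x u v) + dL (x, v) (0, C x w (C x u v)) + dL (x, v) (0, dC x w u v)" for u w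
  proof -
    have "?D (u, 0) (w, 0) = ?D (0, C x u v) (w, 0) + dL (x, v) (0, dC x w u v)"
      using horizontal_derivative[OF p, of u w 0] by (simp add: C0)
    also have "?D (0, C x u v) (w, 0) = ?D (w, 0) (0, C x u v)" by (rule sch)
    also have "\<dots> = ?D (0, C x w v) (0, C x u v) + dL (x, v) (0, C x w (C x u v))"
      using horizontal_derivative[OF p, of w 0 "C x u v"] by (simp add: z)
    finally show ?thesis .
  qed
  have "dL (x, v) (0, C x w (C x u v)) + dL (x, v) (0, dC x w u v) =
      dL (x, v) (0, C x u (C x w v)) + dL (x, v) (0, dC x u w v)"
    using A[of u w] A[of w u] sch[of "(u, 0)" "(w, 0)"] sch[of "(0, C x w v)" "(0, C x u v)"] by simp
  moreover have l: "linear (\<lambda>z. dL (x, v) (0, z))"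
    by (rule linear_compose[OF _ lin, unfolded o_def]) (rule linearI, auto)
  have "dL (x, v) (0, R x u w v) = dL (x, v) (0, dC x u w v) - dL (x, v) (0, dC x w u v) +
      dL (x, v) (0, C x u (C x w v)) - dL (x, v) (0, C x w (C x u v))"
    unfolding R_def linear_add[OF l] linear_diff[OF l] ..
  ultimately show ?thesis by simp
qed

text \<open>The operators R(u,w) annihilate \<open>F x\<close> infinitesimally, hence are skew for
  the invariant form; together with the Bianchi identity this gives all symmetries of a Riemann
  tensor, although the form is chosen at x alone.\<close>

lemma curvature_kernel:
  assumes n: "CARD('n) \<ge> 2" and x: "x \<in> U" and nq: "\<not> quadratic (F x)"
  obtains S \<eta> where "open S" "S \<noteq> {}" "\<And>\<xi>. \<xi> \<in> S \<Longrightarrow> \<eta> \<xi> \<noteq> 0" "\<And>\<xi> r. \<xi> \<in> S \<Longrightarrow> \<xi> \<noteq> r *\<^sub>R \<eta> \<xi>"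
    "\<And>\<xi> u. \<xi> \<in> S \<Longrightarrow> R x \<xi> (\<eta> \<xi>) u = 0"
proof -
  interpret g: gauge "F x" by (rule gauge[OF x])
  obtain Q where sym: "transpose Q = Q" and Qpos: "\<And>v. v \<noteq> 0 \<Longrightarrow> v \<bullet> (Q *v v) > 0"
    and Qinv: "\<And>P. (\<And>v. F x (P *v v) = F x v) \<Longrightarrow> transpose P ** Q ** P = Q"
    using g.invariant_form by metis
  obtain S \<eta> where S: "open S" "S \<noteq> {}" "0 \<notin> S"
    and \<eta>: "\<And>\<xi> z. \<xi> \<in> S \<Longrightarrow> frechet_derivative g.en (at \<xi>) z = \<eta> \<xi> \<bullet> (Q *v z)"
    and \<eta>0: "\<And>\<xi>. \<xi> \<in> S \<Longrightarrow> \<eta> \<xi> \<noteq> 0" and ind: "\<And>\<xi> r. \<xi> \<in> S \<Longrightarrow> \<xi> \<noteq> r *\<^sub>R \<eta> \<xi>"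
    using g.gradient_independent[OF n sym Qpos nq] by metis
  define K where "K u w v z = R x u w v \<bullet> (Q *v z)" for u w v z
  have m: "matrix (R x u w) *v v = R x u w v" for u w v by (simp add: matrix_works R_linear[OF x])
  have skew: "K u w v z = - K u w z v" for u w v z
  proof -
    have "(matrix (R x u w) *v v) \<bullet> (Q *v z) + v \<bullet> (Q *v (matrix (R x u w) *v z)) = 0"
    proof (rule g.infinitesimal_invariance[OF _ Qinv])
      fix v :: "real^'n" assume v: "v \<noteq> 0"
      have "F x v * frechet_derivative (F x) (at v) (R x u w v) = 0"
        using R_invariant[OF x v] g.en_derivative[OF v] by (simp add: en_section[OF x v])
      then show "frechet_derivative (F x) (at v) (matrix (R x u w) *v v) = 0"
        using g.pos[OF v] by (simp add: m)
    qed
    then show ?thesis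
      unfolding m K_def using symmetric_matrix_inner[OF sym, of v "R x u w z"] by simp
  qed
  have pair: "K u w v z = K v z u w" for u w v z
  proof (rule pair_symmetry[of K])
    show "K u w v z = - K w u v z" for u w v z unfolding K_def by (subst R_skew) simp
    show "K u w v z + K w v u z + K v u w z = 0" for u w v z
      unfolding K_def inner_add_left[symmetric] by (simp add: R_bianchi[OF x])
  qed (rule skew)
  show thesis
  proof (rule that[of S \<eta>, OF S(1,2) \<eta>0 ind])
    fix \<xi> u assume \<xi>: "\<xi> \<in> S"
    have z: "\<xi> \<noteq> 0" using \<xi> S by blast
    have "K u w \<xi> (\<eta> \<xi>) = 0" for u w
    proof -
      have "\<eta> \<xi> \<bullet> (Q *v R x u w \<xi>) = 0"
        using R_invariant[OF x z] by (simp add: \<eta>[OF \<xi>, symmetric] en_section[OF x z])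
      then show ?thesis unfolding K_def using symmetric_matrix_inner[OF sym, of "\<eta> \<xi>" "R x u w \<xi>"] by simp
    qed
    \<comment> \<open>The vector R(\<xi>,\<eta>)u is orthogonal to everything, in particular to
      itself, and the form is positive definite.\<close>
    then have "K \<xi> (\<eta> \<xi>) u (R x \<xi> (\<eta> \<xi>) u) = 0" unfolding pair[of \<xi>] by blast
    then show "R x \<xi> (\<eta> \<xi>) u = 0" unfolding K_def using Qpos by (metis less_irrefl)
  qed
qed

end

section \<open>Ricci identities for the pair of equations\<close>

context local_berwald begin

lemma Cm_derivative:
  "x \<in> U \<Longrightarrow> ((\<lambda>y. Cm y u) has_derivative frechet_derivative (\<lambda>y. Cm y u) (at x)) (at x)"
  by (rule smooth_on_derivative[OF Cm_smooth])

lemma Cm_dC: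
  assumes x: "x \<in> U"
  shows "frechet_derivative (\<lambda>y. Cm y u) (at x) w *v v = dC x w u v"
proof -
  have bl: "bounded_linear (\<lambda>P::real^'n^'n. P *v v)"
    by (rule bounded_bilinear.bounded_linear_left[OF bounded_bilinear_matrix_vector_mult])
  have "((\<lambda>y. Cm y u *v v) has_derivative (\<lambda>w. frechet_derivative (\<lambda>y. Cm y u) (at x) w *v v)) (at x)"
    by (rule bounded_linear.has_derivative[OF bl Cm_derivative[OF x]])
  then show ?thesis unfolding dC_def Cm by (rule frechet_derivative_eqI[symmetric])
qed

text \<open>Substitute the first-order equation for a into the symmetry of its second derivatives.
  The connection terms combine into the action of R(w,u) on a, which vanishes by
  \<open>flat\<close>; what is left contains only the covariant derivative \<Lambda> of l.\<close>

lemma ricci_tensor: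
  assumes asm: "smooth_on U a" and lsm: "smooth_on U l" and x: "x \<in> U"
    and eq: "\<And>y u. y \<in> U \<Longrightarrow> frechet_derivative a (at y) u =
      outer (l y) u + outer u (l y) - Cm y u ** a y - a y ** transpose (Cm y u)"
    and \<Lambda>: "\<And>u. \<Lambda> u = frechet_derivative l (at x) u + C x u (l x)"
    and flat: "\<And>v. R x w u v = 0"
  shows "outer (\<Lambda> w) u + outer u (\<Lambda> w) = outer (\<Lambda> u) w + outer w (\<Lambda> u)"
proof -
  let ?a = "frechet_derivative a (at x)" and ?l = "frechet_derivative l (at x)"
  let ?G = "\<lambda>u w. frechet_derivative (\<lambda>y. Cm y u) (at x) w"
  note bo = bounded_bilinear_outer and bm = bounded_bilinear_matrix_mult
  have H: "frechet_derivative (\<lambda>y. frechet_derivative a (at y) u) (at x) w =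
     outer (?l w) u + outer u (?l w) - (Cm x u ** ?a w + ?G u w ** a x) -
     (a x ** transpose (?G u w) + ?a w ** transpose (Cm x u))" for u w
  proof (rule frechet_derivative_eqI)
    have da: "(a has_derivative ?a) (at x)" by (rule smooth_on_derivative[OF asm x])
    have dl: "(l has_derivative ?l) (at x)" by (rule smooth_on_derivative[OF lsm x])
    have "((\<lambda>y. outer (l y) u + outer u (l y) - Cm y u ** a y - a y ** transpose (Cm y u)) has_derivative
      (\<lambda>w. outer (?l w) u + outer u (?l w) - (Cm x u ** ?a w + ?G u w ** a x) -
        (a x ** transpose (?G u w) + ?a w ** transpose (Cm x u)))) (at x)"
      by (intro has_derivative_diff has_derivative_add
          bounded_linear.has_derivative[OF bounded_bilinear.bounded_linear_left[OF bo] dl]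
          bounded_linear.has_derivative[OF bounded_bilinear.bounded_linear_right[OF bo] dl]
          bounded_bilinear.FDERIV[OF bm Cm_derivative[OF x] da]
          bounded_bilinear.FDERIV[OF bm da bounded_linear.has_derivative[OF bounded_linear_transpose Cm_derivative[OF x]]])
    then show "((\<lambda>y. frechet_derivative a (at y) u) has_derivative
      (\<lambda>w. outer (?l w) u + outer u (?l w) - (Cm x u ** ?a w + ?G u w ** a x) -
        (a x ** transpose (?G u w) + ?a w ** transpose (Cm x u)))) (at x)"
      by (rule has_derivative_transform_within_open[OF _ U x]) (simp add: eq)
  qed
  \<comment> \<open>The matrix of the curvature operator R(w,u). Its vanishing allows one derivative
    of \<open>Cm\<close> to be eliminated in favour of the other, after which the remaining terms
    cancel algebraically.\<close>
  define \<rho> where "\<rho> = ?G u w - ?G w u + Cm x w ** Cm x u - Cm x u ** Cm x w"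
  have "\<rho> *v v = R x w u v" for v
    by (simp add: \<rho>_def matrix_vector_mult_add_rdistrib matrix_vector_mult_diff_rdistrib Cm_dC[OF x]
        matrix_vector_mul_assoc[symmetric] Cm R_def)
  then have "\<rho> = 0" using flat by (simp add: matrix_eq)
  then have G: "?G u w = ?G w u - Cm x w ** Cm x u + Cm x u ** Cm x w"
    by (simp add: \<rho>_def algebra_simps eq_diff_eq)
  have t: "transpose (A + B) = transpose A + transpose B" "transpose (A - B) = transpose A - transpose B"
    for A B :: "real^'n^'n"
    by (simp_all add: transpose_def vec_eq_iff)
  have o: "outer (p + q) r = outer p r + outer q r" "outer r (p + q) = outer r p + outer r q" for p q r :: "real^'n"
    by (simp_all add: bounded_bilinear.add_left[OF bo] bounded_bilinear.add_right[OF bo])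
  have "frechet_derivative (\<lambda>y. frechet_derivative a (at y) u) (at x) w =
      frechet_derivative (\<lambda>y. frechet_derivative a (at y) w) (at x) u"
    by (rule schwarz[OF asm U x])
  then show ?thesis
    unfolding H eq[OF x] G \<Lambda> o
    by (simp add: matrix_mult_linear matrix_mult_outer matrix_transpose_mul matrix_mul_assoc t Cm Csym[OF x, of w u]
        algebra_simps)
qed

text \<open>With w = \<xi> and u = \<eta>, the Ricci identity makes each \<xi> of an open set an
  eigenvector of the covariant derivative of l, which is therefore a multiple of the identity. The
  factor is stated as a normalized trace so that its smooth dependence on x is evident.\<close>

lemma hessian_proportional:
  assumes n: "CARD('n) \<ge> 2" and nq: "\<not> quadratic (F x)" and x: "x \<in> U"
    and asm: "smooth_on U a" and lsm: "smooth_on U l"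
    and eq: "\<And>y u. y \<in> U \<Longrightarrow> frechet_derivative a (at y) u =
      outer (l y) u + outer u (l y) - Cm y u ** a y - a y ** transpose (Cm y u)"
  shows "frechet_derivative l (at x) v + C x v (l x) =
    ((\<Sum>k\<in>UNIV. (frechet_derivative l (at x) (axis k 1) + C x (axis k 1) (l x)) $ k) / CARD('n)) *\<^sub>R v"
proof -
  define \<Lambda> where "\<Lambda> u = frechet_derivative l (at x) u + C x u (l x)" for u
  obtain S \<eta> where S: "open S" "S \<noteq> {}" and \<eta>0: "\<And>\<xi>. \<xi> \<in> S \<Longrightarrow> \<eta> \<xi> \<noteq> 0"
    and ind: "\<And>\<xi> r. \<xi> \<in> S \<Longrightarrow> \<xi> \<noteq> r *\<^sub>R \<eta> \<xi>" and flat: "\<And>\<xi> u. \<xi> \<in> S \<Longrightarrow> R x \<xi> (\<eta> \<xi>) u = 0"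
    by (rule curvature_kernel[OF n x nq]) blast
  have lin: "linear \<Lambda>"
    unfolding \<Lambda>_def
    by (rule linear_compose_add[OF smooth_on_linear_frechet[OF lsm x]]) (use Cbil[of x] in \<open>simp add: bilinear_def\<close>)
  have "\<exists>c. \<Lambda> \<xi> = c *\<^sub>R \<xi>" if \<xi>: "\<xi> \<in> S" for \<xi>
  proof (rule eigenvector_of_symmetric_product[OF _ ind[OF \<xi>] \<eta>0[OF \<xi>]])
    fix i j
    have "outer (\<Lambda> \<xi>) (\<eta> \<xi>) + outer (\<eta> \<xi>) (\<Lambda> \<xi>) = outer (\<Lambda> (\<eta> \<xi>)) \<xi> + outer \<xi> (\<Lambda> (\<eta> \<xi>))"
      by (rule ricci_tensor[OF asm lsm x eq \<Lambda>_def flat[OF \<xi>]])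
    then have "(outer (\<Lambda> \<xi>) (\<eta> \<xi>) + outer (\<eta> \<xi>) (\<Lambda> \<xi>)) $ i $ j = (outer (\<Lambda> (\<eta> \<xi>)) \<xi> + outer \<xi> (\<Lambda> (\<eta> \<xi>))) $ i $ j"
      by simp
    then show "\<Lambda> (\<eta> \<xi>) $ i * \<xi> $ j + \<Lambda> (\<eta> \<xi>) $ j * \<xi> $ i = \<Lambda> \<xi> $ i * \<eta> \<xi> $ j + \<Lambda> \<xi> $ j * \<eta> \<xi> $ i"
      by (simp add: outer_def mult.commute)
  qed
  from linear_map_parallel[OF lin parallel_on_open[OF lin S this]] show ?thesis
    unfolding \<Lambda>_def .
qed

text \<open>The Ricci identity for l reads dm(w) u - dm(u) w = R(w,u) l. On the pair \<xi>, \<eta>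
  the right side vanishes, so independence gives dm(\<xi>) = 0 on an open set of \<xi>, which spans
  the space.\<close>

lemma hessian_factor_constant:
  assumes n: "CARD('n) \<ge> 2" and nq: "\<not> quadratic (F x)" and x: "x \<in> U"
    and lsm: "smooth_on U l" and msm: "smooth_on U m"
    and eq: "\<And>y v. y \<in> U \<Longrightarrow> frechet_derivative l (at y) v + C y v (l y) = m y *\<^sub>R v"
  shows "(m has_derivative (\<lambda>h. 0)) (at x)"
proof -
  let ?m = "frechet_derivative m (at x)" and ?l = "frechet_derivative l (at x)"
  have dm: "(m has_derivative ?m) (at x)" by (rule smooth_on_derivative[OF msm x])
  have dl: "(l has_derivative ?l) (at x)" by (rule smooth_on_derivative[OF lsm x])
  have lin: "linear ?m" by (rule smooth_on_linear_frechet[OF msm x])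
  have l': "frechet_derivative l (at y) v = m y *\<^sub>R v - Cm y v *v l y" if "y \<in> U" for y v
    using eq[OF that, of v] by (simp add: Cm eq_diff_eq)
  have H: "frechet_derivative (\<lambda>y. frechet_derivative l (at y) u) (at x) w =
      ?m w *\<^sub>R u - (C x u (?l w) + dC x w u (l x))" for u w
  proof (rule frechet_derivative_eqI)
    have "((\<lambda>y. m y *\<^sub>R u - Cm y u *v l y) has_derivative
        (\<lambda>w. ?m w *\<^sub>R u - (Cm x u *v ?l w + frechet_derivative (\<lambda>y. Cm y u) (at x) w *v l x))) (at x)"
      by (intro has_derivative_diff has_derivative_scaleR_left dm
          bounded_bilinear.FDERIV[OF bounded_bilinear_matrix_vector_mult Cm_derivative[OF x] dl])
    then show "((\<lambda>y. frechet_derivative l (at y) u) has_derivative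
        (\<lambda>w. ?m w *\<^sub>R u - (C x u (?l w) + dC x w u (l x)))) (at x)"
      unfolding Cm_dC[OF x] Cm[of x]
      by (rule has_derivative_transform_within_open[OF _ U x]) (simp add: l')
  qed
  have key: "?m w *\<^sub>R u - ?m u *\<^sub>R w = R x w u (l x)" for u w
  proof -
    have "?m w *\<^sub>R u - (C x u (?l w) + dC x w u (l x)) = ?m u *\<^sub>R w - (C x w (?l u) + dC x u w (l x))"
      using schwarz[OF lsm U x, of u w] unfolding H .
    then show ?thesis
      unfolding R_def l'[OF x] Cm bilinear_rsub[OF Cbil] bilinear_rmul[OF Cbil] Csym[OF x, of w u]
      by (simp add: algebra_simps)
  qed
  obtain S \<eta> where S: "open S" "S \<noteq> {}" and \<eta>0: "\<And>\<xi>. \<xi> \<in> S \<Longrightarrow> \<eta> \<xi> \<noteq> 0"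
    and ind: "\<And>\<xi> r. \<xi> \<in> S \<Longrightarrow> \<xi> \<noteq> r *\<^sub>R \<eta> \<xi>" and flat: "\<And>\<xi> u. \<xi> \<in> S \<Longrightarrow> R x \<xi> (\<eta> \<xi>) u = 0"
    by (rule curvature_kernel[OF n x nq]) blast
  have z: "?m \<xi> = 0" if \<xi>: "\<xi> \<in> S" for \<xi>
  proof -
    have e: "?m \<xi> *\<^sub>R \<eta> \<xi> = ?m (\<eta> \<xi>) *\<^sub>R \<xi>" using key[of \<xi> "\<eta> \<xi>"] flat[OF \<xi>] by simp
    have "?m (\<eta> \<xi>) = 0"
    proof (rule ccontr)
      assume nz: "?m (\<eta> \<xi>) \<noteq> 0"
      have "(?m \<xi> / ?m (\<eta> \<xi>)) *\<^sub>R \<eta> \<xi> = inverse (?m (\<eta> \<xi>)) *\<^sub>R (?m \<xi> *\<^sub>R \<eta> \<xi>)"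
        by (simp add: divide_inverse mult.commute)
      also have "\<dots> = \<xi>" unfolding e using nz by simp
      finally show False using ind[OF \<xi>] by metis
    qed
    then show ?thesis using e \<eta>0[OF \<xi>] by simp
  qed
  have "?m v = 0" for v
  proof -
    obtain a where a: "a \<in> S" using S by blast
    obtain e where e: "e > 0" "ball a e \<subseteq> S" using S a open_contains_ball by blast
    have nv: "norm v + 1 > 0" by (simp add: add_nonneg_pos)
    define k where "k = norm v + 1"
    \<comment> \<open>Small enough that both a and a + t * v lie in S; v is then recovered from
      their difference, and dm is linear.\<close>
    define t where "t = e / k / 2"
    have t: "t > 0" using e nv by (simp add: t_def k_def)
    have "t * norm v < e"
    proof -
      have "2 * (t * k) = e" using nv by (simp add: t_def k_def[symmetric])
      moreover have "t * k = t * norm v + t" by (simp add: k_def algebra_simps)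
      moreover have "t * norm v \<ge> 0" using t by simp
      ultimately show ?thesis using t by linarith
    qed
    then have "a + t *\<^sub>R v \<in> S" using e t by (auto simp: dist_norm subset_iff)
    from z[OF this] z[OF a] show "?m v = 0" using t by (simp add: linear_add[OF lin] linear_cmul[OF lin])
  qed
  then have "?m = (\<lambda>h. 0)" by blast
  with dm show ?thesis by simp
qed

lemma euler_lagrange_derivative:
  assumes y: "(y has_vector_derivative z s) (at s)" and z: "(z has_vector_derivative b) (at s)"
    and p: "(y s, z s) \<in> TU"
  shows "((\<lambda>s. dL (y s, z s) (0, e)) has_real_derivative
    dL (y s, z s) (e, 0) + gauge.hess (F (y s)) (z s) e (b + C (y s) (z s) (z s))) (at s)"
proof -
  have "((\<lambda>s. (y s, z s)) has_vector_derivative (z s, b)) (at s)"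
    by (rule has_vector_derivative_Pair[OF y z])
  then have "((\<lambda>s. (y s, z s)) has_derivative (\<lambda>h. h *\<^sub>R (z s, b))) (at s)"
    by (simp add: has_vector_derivative_def)
  from has_derivative_compose[OF this ddL[OF p, of "(0, e)"]]
  have "((\<lambda>s. dL (y s, z s) (0, e)) has_derivative
      (\<lambda>h. frechet_derivative (\<lambda>p. dL p (0, e)) (at (y s, z s)) (h *\<^sub>R (z s, b)))) (at s)" .
  moreover have "(\<lambda>h. frechet_derivative (\<lambda>p. dL p (0, e)) (at (y s, z s)) (h *\<^sub>R (z s, b))) =
      (\<lambda>h. h * (dL (y s, z s) (e, 0) + gauge.hess (F (y s)) (z s) e (b + C (y s) (z s) (z s))))"
    unfolding linear_cmul[OF has_derivative_linear[OF ddL[OF p]]] euler_lagrange_residual[OF p] by simp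
  ultimately show ?thesis by (simp add: has_field_derivative_def mult_commute_abs)
qed

end

subsection \<open>Metrics geodesically equivalent to a Berwald metric in a chart\<close>

text \<open>The common form of the two volume computations below: along a line, each density is a
  positive constant times the absolute determinant of a matrix curve through the identity.\<close>

lemma ln_det_derivative:
  fixes N :: "real \<Rightarrow> real^'n^'n"
  assumes N: "(N has_vector_derivative D) (at 0)" and N0: "N 0 = mat 1" and c: "c > 0" and r: "r > 0"
    and f: "\<And>t. \<bar>t\<bar> < r \<Longrightarrow> f t = c * \<bar>det (N t)\<bar>"
  shows "((\<lambda>t. ln (f t)) has_real_derivative trace D) (at 0)"
proof -
  have dd: "((\<lambda>s. det (N s)) has_real_derivative trace D) (at 0)"
    by (rule det_derivative_at_mat_1[OF N N0])
  then have "((\<lambda>s. det (N s)) \<longlongrightarrow> det (N 0)) (at 0)"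
    by (rule DERIV_isCont[unfolded isCont_def])
  then have "\<forall>\<^sub>F s in at 0. det (N s) > 0"
    by (rule order_tendstoD) (simp add: N0)
  then obtain d where d: "d > 0" "\<And>s. s \<noteq> 0 \<Longrightarrow> \<bar>s\<bar> < d \<Longrightarrow> det (N s) > 0"
    unfolding eventually_at by (auto simp: dist_real_def)
  have "((\<lambda>t. c * det (N t)) has_real_derivative c * trace D) (at 0)" by (rule DERIV_cmult[OF dd])
  moreover have "(ln has_real_derivative inverse (c * det (N 0))) (at (c * det (N 0)))"
    by (rule DERIV_ln) (simp add: N0 c)
  ultimately have "((\<lambda>t. ln (c * det (N t))) has_real_derivative inverse (c * det (N 0)) * (c * trace D)) (at 0)"
    using DERIV_chain2[of ln "inverse (c * det (N 0))" "\<lambda>t. c * det (N t)" 0 "c * trace D" UNIV] by blast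
  then have "((\<lambda>t. ln (c * det (N t))) has_real_derivative trace D) (at 0)"
    using c by (simp add: N0 mult.assoc[symmetric])
  then show ?thesis unfolding has_field_derivative_def
  proof (rule has_derivative_transform_within_open[of _ _ _ _ "{- min d r<..<min d r}"])
    fix t assume t: "t \<in> {- min d r<..<min d r}"
    then have t': "\<bar>t\<bar> < d" "\<bar>t\<bar> < r" by auto
    have "det (N t) > 0" using d(2)[of t] t' N0 by (cases "t = 0") auto
    then show "ln (c * det (N t)) = ln (f t)" using f[OF t'(2)] by simp
  qed (use d r in auto)
qed

lemma has_vector_derivative_real:
  fixes f :: "real \<Rightarrow> 'b::real_normed_vector"
  assumes "(f has_derivative D) (at t)"
  shows "(f has_vector_derivative D 1) (at t)"
proof -
  have "D = (\<lambda>k. k *\<^sub>R D 1)"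
  proof (rule ext)
    show "D k = k *\<^sub>R D 1" for k using linear_cmul[OF has_derivative_linear[OF assms], of k 1] by simp
  qed
  from back_subst[where P="\<lambda>D. (f has_derivative D) (at t)", OF assms this] show ?thesis
    unfolding has_vector_derivative_def .
qed

text \<open>The chart picture of the full situation: h is the metric, D the bilinear map of its
  Levi-Civita connection, \<open>compat\<close> says that h is parallel for D. The axiom
  \<open>geo\<close> states geodesic equivalence for curves in U; nonconstancy is expressed by a
  nonzero velocity at some time.\<close>

locale local_equiv = local_berwald U F C
  for U :: "(real^'n) set" and F C +
  fixes h :: "real^'n \<Rightarrow> real^'n^'n" and D :: "real^'n \<Rightarrow> real^'n \<Rightarrow> real^'n \<Rightarrow> real^'n"
  assumes n: "CARD('n) \<ge> 2"
    and hsm: "smooth_on U h" and hsym: "\<And>x. x \<in> U \<Longrightarrow> transpose (h x) = h x"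
    and hinv: "\<And>x. x \<in> U \<Longrightarrow> invertible (h x)"
    and Dsm: "\<And>u v. smooth_on U (\<lambda>x. D x u v)"
    and Dbil: "\<And>x. bilinear (D x)"
    and Dsym: "\<And>x u v. x \<in> U \<Longrightarrow> D x u v = D x v u"
    and compat: "\<And>x u. x \<in> U \<Longrightarrow>
      frechet_derivative h (at x) u = transpose (matrix (D x u)) ** h x + h x ** matrix (D x u)"
    and geo: "\<And>I y. open_interval I \<Longrightarrow> smooth_on I y \<Longrightarrow> y ` I \<subseteq> U \<Longrightarrow>
      (\<And>t. t \<in> I \<Longrightarrow> ((\<lambda>t. vector_derivative y (at t)) has_vector_derivative
         - D (y t) (vector_derivative y (at t)) (vector_derivative y (at t))) (at t)) \<Longrightarrow>
      (\<exists>t\<in>I. vector_derivative y (at t) \<noteq> 0) \<Longrightarrow>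
      \<exists>J \<tau>. open_interval J \<and> smooth_on J \<tau> \<and> (\<forall>t\<in>J. deriv \<tau> t > 0) \<and> \<tau> ` J = I \<and>
        (\<forall>s\<in>J. vector_derivative (y \<circ> \<tau>) (at s) \<noteq> 0 \<and>
          (\<forall>i. ((\<lambda>s. dL (y (\<tau> s), vector_derivative (y \<circ> \<tau>) (at s)) (0, axis i 1)) has_real_derivative
             dL (y (\<tau> s), vector_derivative (y \<circ> \<tau>) (at s)) (axis i 1, 0)) (at s)))"
begin

definition Dm where "Dm x u = matrix (D x u)"

lemma Dm: "Dm x u *v v = D x u v"
  unfolding Dm_def using Dbil[of x] by (simp add: matrix_works bilinear_def)

text \<open>If the connections differ by \<phi>(u) v + \<phi>(v) u, then taking the trace over v
  gives (n + 1) \<phi>(u); this fixes the 1-form in advance.\<close>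

definition \<phi> where "\<phi> x u = (trace (Dm x u) - trace (Cm x u)) / (CARD('n) + 1)"

text \<open>A geodesic of the metric becomes an extremal \<open>\<sigma>\<close> after reparametrization, so the Hessian of
  \<open>F\<^sup>2/2\<close> annihilates \<open>\<sigma>'' + \<Gamma>(\<sigma>', \<sigma>')\<close>; where it is nondegenerate, the difference of the two connections
  maps \<open>(\<sigma>', \<sigma>')\<close> to a multiple of \<open>\<sigma>'\<close>.\<close>

lemma projective_direction:
  assumes x: "x \<in> U" and v: "v \<noteq> 0"
    and nd: "\<And>r k. r > 0 \<Longrightarrow> (\<And>e. gauge.hess (F x) (r *\<^sub>R v) e k = 0) \<Longrightarrow> k = 0"
  shows "\<exists>c. D x v v - C x v v = c *\<^sub>R v"
proof -
  let ?f = "\<lambda>p :: (real^'n) \<times> (real^'n). (snd p, - D (fst p) (snd p) (snd p))"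
  have oU: "open (U \<times> (UNIV :: (real^'n) set))" using U by (intro open_Times) auto
  have i: "smooth_on (U \<times> (UNIV :: (real^'n) set)) (\<lambda>p. p)" by (rule smooth_on_id[OF oU])
  have s1: "smooth_on (U \<times> (UNIV :: (real^'n) set)) fst" by (rule smooth_on_bounded_linear[OF bounded_linear_fst i oU])
  have s2: "smooth_on (U \<times> (UNIV :: (real^'n) set)) snd" by (rule smooth_on_bounded_linear[OF bounded_linear_snd i oU])
  have "smooth_on (U \<times> (UNIV :: (real^'n) set)) (\<lambda>p. D (fst p) (snd p) (snd p))"
    by (rule smooth_on_bilinear_field[OF U oU Dsm Dbil s1 _ s2 s2]) auto
  then have sm: "smooth_on (U \<times> UNIV) ?f"
    by (rule smooth_on_Pair[OF s2 smooth_on_uminus[OF _ oU] oU])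
  have in0: "(x, v) \<in> U \<times> (UNIV :: (real^'n) set)" using x by simp
  obtain d z where d: "d > 0" and z0: "z 0 = (x, v)" and zU: "\<And>t::real. \<bar>t\<bar> < d \<Longrightarrow> z t \<in> U \<times> UNIV"
    and dz: "\<And>t. \<bar>t\<bar> < d \<Longrightarrow> (z has_vector_derivative ?f (z t)) (at t)"
    by (rule picard[OF oU sm in0]) blast
  define I where "I = {-d<..<d}"
  define y where "y t = fst (z t)" for t
  define w where "w t = snd (z t)" for t
  have abs: "t \<in> I \<longleftrightarrow> \<bar>t\<bar> < d" for t by (auto simp: I_def)
  have dy: "(y has_vector_derivative w t) (at t)" if "t \<in> I" for t
    using bounded_linear.has_vector_derivative[OF bounded_linear_fst dz] that unfolding y_def w_def abs by simp
  have dw: "(w has_vector_derivative - D (y t) (w t) (w t)) (at t)" if "t \<in> I" for t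
    using bounded_linear.has_vector_derivative[OF bounded_linear_snd dz] that unfolding y_def w_def abs by simp
  have y': "vector_derivative y (at t) = w t" if "t \<in> I" for t by (rule vector_derivative_at[OF dy[OF that]])
  have I: "open I" "open_interval I" "0 \<in> I" using d by (auto simp: I_def open_interval_def is_interval_def)
  have "y t \<in> U" if "t \<in> I" for t using zU[OF that[unfolded abs]] by (simp add: y_def mem_Times_iff)
  then have yU: "y ` I \<subseteq> U" by blast
  have "z ` I \<subseteq> U \<times> UNIV" using zU[folded abs] by blast
  then have zs: "smooth_on I z" by (rule smooth_on_solution[OF oU sm I(1) _ dz[folded abs]])
  have ysm: "smooth_on I y" unfolding y_def by (rule smooth_on_bounded_linear[OF bounded_linear_fst zs I(1)])
  have dy': "((\<lambda>t. vector_derivative y (at t)) has_vector_derivative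
         - D (y t) (vector_derivative y (at t)) (vector_derivative y (at t))) (at t)" if t: "t \<in> I" for t
    unfolding y'[OF t] by (rule has_vector_derivative_transform_within_open[OF dw[OF t] I(1) t]) (simp add: y')
  have nz: "\<exists>t\<in>I. vector_derivative y (at t) \<noteq> 0"
    using y'[OF I(3)] I(3) v by (auto simp: w_def z0)
  have "\<exists>J \<tau>. open_interval J \<and> smooth_on J \<tau> \<and>
      (\<forall>t\<in>J. deriv \<tau> t > 0) \<and> \<tau> ` J = I \<and>
        (\<forall>s\<in>J. vector_derivative (y \<circ> \<tau>) (at s) \<noteq> 0 \<and>
          (\<forall>i. ((\<lambda>s. dL (y (\<tau> s), vector_derivative (y \<circ> \<tau>) (at s)) (0, axis i 1)) has_real_derivative
             dL (y (\<tau> s), vector_derivative (y \<circ> \<tau>) (at s)) (axis i 1, 0)) (at s)))"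
    by (rule geo[OF I(2) ysm yU _ nz]) (rule dy')
  then obtain J \<tau> where J\<tau>: "open_interval J \<and> smooth_on J \<tau> \<and>
      (\<forall>t\<in>J. deriv \<tau> t > 0) \<and> \<tau> ` J = I \<and>
        (\<forall>s\<in>J. vector_derivative (y \<circ> \<tau>) (at s) \<noteq> 0 \<and>
          (\<forall>i. ((\<lambda>s. dL (y (\<tau> s), vector_derivative (y \<circ> \<tau>) (at s)) (0, axis i 1)) has_real_derivative
             dL (y (\<tau> s), vector_derivative (y \<circ> \<tau>) (at s)) (axis i 1, 0)) (at s)))"
    by (elim exE) (rule that)
  then have J: "open_interval J" and \<tau>s: "smooth_on J \<tau>"
    and \<tau>p: "\<And>t. t \<in> J \<Longrightarrow> deriv \<tau> t > 0" and \<tau>J: "\<tau> ` J = I"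
    by blast+
  have EL: "((\<lambda>s. dL (y (\<tau> s), vector_derivative (y \<circ> \<tau>) (at s)) (0, axis i 1)) has_real_derivative
       dL (y (\<tau> s), vector_derivative (y \<circ> \<tau>) (at s)) (axis i 1, 0)) (at s)" if "s \<in> J" for s i
    using J\<tau> that by blast
  have oJ: "open J" using J by (simp add: open_interval_def)
  obtain s where s: "s \<in> J" "\<tau> s = 0" using \<tau>J I(3) by (metis imageE)
  define r where "r = deriv \<tau> s"
  have r: "r > 0" using \<tau>p[OF s(1)] by (simp add: r_def)
  have fr: "(\<tau> has_derivative frechet_derivative \<tau> (at t)) (at t)" if "t \<in> J" for t
    by (rule smooth_on_derivative[OF \<tau>s that])
  have d\<tau>: "(\<tau> has_vector_derivative frechet_derivative \<tau> (at t) 1) (at t)" if "t \<in> J" for t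
    by (rule has_vector_derivative_real[OF fr[OF that]])
  have \<tau>': "deriv \<tau> t = frechet_derivative \<tau> (at t) 1" if "t \<in> J" for t
    using d\<tau>[OF that] by (intro DERIV_imp_deriv) (simp add: has_real_derivative_iff_has_vector_derivative)
  have "smooth_on J (\<lambda>t. frechet_derivative \<tau> (at t) 1)" by (rule smooth_on_frechet[OF \<tau>s])
  then have "smooth_on J (deriv \<tau>)"
    using smooth_on_cong[OF oJ, of "deriv \<tau>" "\<lambda>t. frechet_derivative \<tau> (at t) 1"] \<tau>' by blast
  then have "(deriv \<tau> has_derivative frechet_derivative (deriv \<tau>) (at s)) (at s)"
    by (rule smooth_on_derivative[OF _ s(1)])
  then obtain r2 where d2: "(deriv \<tau> has_vector_derivative r2) (at s)"
    using has_vector_derivative_real by blast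
  \<comment> \<open>The velocity of the reparametrized curve; at the chosen time it is r * v, where
    r is the unknown positive value of \<tau>'.\<close>
  define \<sigma> where "\<sigma> t = deriv \<tau> t *\<^sub>R w (\<tau> t)" for t
  have dy\<tau>: "(y \<circ> \<tau> has_vector_derivative \<sigma> t) (at t)" if "t \<in> J" for t
    unfolding \<sigma>_def \<tau>'[OF that]
    by (rule vector_diff_chain_at[OF d\<tau>[OF that] dy]) (use that \<tau>J in blast)
  have \<sigma>: "vector_derivative (y \<circ> \<tau>) (at t) = \<sigma> t" if "t \<in> J" for t
    by (rule vector_derivative_at[OF dy\<tau>[OF that]])
  have v0: "w (\<tau> s) = v" "y (\<tau> s) = x" by (simp_all add: w_def y_def s z0)
  have \<sigma>s: "\<sigma> s = r *\<^sub>R v" by (simp add: \<sigma>_def r_def v0)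
  \<comment> \<open>The acceleration of the reparametrized curve at that time: the term with
    \<tau>'' is along v, the other is the geodesic acceleration rescaled by the square of
    \<tau>'.\<close>
  define b where "b = r2 *\<^sub>R v - (r * r) *\<^sub>R D x v v"
  have "(w \<circ> \<tau> has_vector_derivative deriv \<tau> s *\<^sub>R (- D (y (\<tau> s)) (w (\<tau> s)) (w (\<tau> s)))) (at s)"
    unfolding \<tau>'[OF s(1)] by (rule vector_diff_chain_at[OF d\<tau>[OF s(1)] dw]) (use s I in simp)
  then have "((\<lambda>t. w (\<tau> t)) has_vector_derivative r *\<^sub>R (- D x v v)) (at s)"
    by (simp add: v0 r_def o_def)
  then have "(\<sigma> has_vector_derivative deriv \<tau> s *\<^sub>R (r *\<^sub>R (- D x v v)) + r2 *\<^sub>R w (\<tau> s)) (at s)"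
    unfolding \<sigma>_def by (rule bounded_bilinear.has_vector_derivative[OF bounded_bilinear_scaleR d2])
  then have d\<sigma>: "(\<sigma> has_vector_derivative b) (at s)"
    by (simp add: b_def r_def[symmetric] v0)
  have "gauge.hess (F x) (r *\<^sub>R v) (axis i 1) (b + C x (r *\<^sub>R v) (r *\<^sub>R v)) = 0" for i
  proof -
    have p: "((y \<circ> \<tau>) s, \<sigma> s) \<in> TU" using x v r by (simp add: v0 \<sigma>s)
    have 1: "((\<lambda>t. dL ((y \<circ> \<tau>) t, \<sigma> t) (0, axis i 1)) has_real_derivative
        dL ((y \<circ> \<tau>) s, \<sigma> s) (axis i 1, 0) +
        gauge.hess (F ((y \<circ> \<tau>) s)) (\<sigma> s) (axis i 1) (b + C ((y \<circ> \<tau>) s) (\<sigma> s) (\<sigma> s))) (at s)"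
      by (rule euler_lagrange_derivative[OF dy\<tau>[OF s(1)] d\<sigma> p])
    have 2: "((\<lambda>t. dL ((y \<circ> \<tau>) t, \<sigma> t) (0, axis i 1)) has_real_derivative dL ((y \<circ> \<tau>) s, \<sigma> s) (axis i 1, 0)) (at s)"
    proof -
      have "((\<lambda>t. dL (y (\<tau> t), vector_derivative (y \<circ> \<tau>) (at t)) (0, axis i 1)) has_real_derivative
          dL (y (\<tau> s), \<sigma> s) (axis i 1, 0)) (at s)"
        using EL[OF s(1), of i] by (simp only: \<sigma>[OF s(1)])
      then show ?thesis
        unfolding has_field_derivative_def comp_apply
        by (rule has_derivative_transform_within_open[OF _ oJ s(1)]) (simp add: \<sigma>[unfolded comp_def])
    qed
    from DERIV_unique[OF 1 2] show ?thesis by (simp add: v0 \<sigma>s)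
  qed
  moreover have rv: "r *\<^sub>R v \<noteq> 0" using r v by simp
  ultimately have "gauge.hess (F x) (r *\<^sub>R v) e (b + C x (r *\<^sub>R v) (r *\<^sub>R v)) = 0" for e
  proof -
    assume z: "\<And>i. gauge.hess (F x) (r *\<^sub>R v) (axis i 1) (b + C x (r *\<^sub>R v) (r *\<^sub>R v)) = 0"
    have l: "linear (\<lambda>e. gauge.hess (F x) (r *\<^sub>R v) e (b + C x (r *\<^sub>R v) (r *\<^sub>R v)))"
      by (rule gauge.hess_linear(2)[OF gauge[OF x] rv])
    have "e = (\<Sum>k\<in>UNIV. e $ k *\<^sub>R axis k 1)"
      by (simp add: basis_expansion scalar_mult_eq_scaleR[symmetric])
    then have "gauge.hess (F x) (r *\<^sub>R v) e (b + C x (r *\<^sub>R v) (r *\<^sub>R v)) =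
        gauge.hess (F x) (r *\<^sub>R v) (\<Sum>k\<in>UNIV. e $ k *\<^sub>R axis k 1) (b + C x (r *\<^sub>R v) (r *\<^sub>R v))" by simp
    also have "\<dots> = 0" unfolding linear_sum[OF l] linear_cmul[OF l] z by simp
    finally show ?thesis .
  qed
  then have "b + C x (r *\<^sub>R v) (r *\<^sub>R v) = 0" by (rule nd[OF r])
  then have "(r * r) *\<^sub>R (D x v v - C x v v) = r2 *\<^sub>R v"
    by (simp add: b_def bilinear_lmul[OF Cbil] bilinear_rmul[OF Cbil] algebra_simps)
  then have "D x v v - C x v v = inverse (r * r) *\<^sub>R (r2 *\<^sub>R v)"
    using r by (metis less_irrefl mult_eq_0_iff scaleR_left_imp_eq scaleR_scaleR right_inverse scaleR_one)
  then show ?thesis by (metis scaleR_scaleR)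
qed

text \<open>The difference tensor T maps (v,v) to a multiple of v on the open set where the Hessian
  is nondegenerate. The polynomial argument removes the restriction to that set, and polarization
  yields the full formula with the trace as 1-form.\<close>

lemma projective:
  assumes x: "x \<in> U"
  shows "D x u v = C x u v + \<phi> x u *\<^sub>R v + \<phi> x v *\<^sub>R u"
proof -
  interpret g: gauge "F x" by (rule gauge[OF x])
  define T where "T u v = D x u v - C x u v" for u v
  have bil: "bilinear T"
    using Dbil[of x] Cbil[of x] unfolding T_def bilinear_def by (auto intro: linear_compose_sub)
  have sym: "T u v = T v u" for u v by (simp add: T_def Dsym[OF x, of u v] Csym[OF x, of u v])
  obtain S where S: "open S" "S \<noteq> {}" "0 \<notin> S"
    and nd: "\<And>v r k. v \<in> S \<Longrightarrow> r > 0 \<Longrightarrow> (\<And>e. g.hess (r *\<^sub>R v) e k = 0) \<Longrightarrow> k = 0"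
    by (rule g.hess_nondegenerate) blast
  have "\<exists>c. T v v = c *\<^sub>R v" if "v \<in> S" for v
    unfolding T_def by (rule projective_direction[OF x _ nd[OF that]]) (use that S in auto)
  then have "T v v $ i * v $ j = T v v $ j * v $ i" for v i j
    by (rule quadratic_parallel_on_open[OF bil sym S(1,2)])
  from quadratic_map_parallel[OF bil sym this, of u v]
  have "T u v = ((\<Sum>k\<in>UNIV. T u (axis k 1) $ k) *\<^sub>R v + (\<Sum>k\<in>UNIV. T v (axis k 1) $ k) *\<^sub>R u) /\<^sub>R (CARD('n) + 1)" .
  moreover have "(\<Sum>k\<in>UNIV. T u (axis k 1) $ k) = trace (Dm x u) - trace (Cm x u)" for u
    by (simp add: T_def trace_def Dm_def Cm_def matrix_def sum_subtractf)
  ultimately have "T u v = \<phi> x u *\<^sub>R v + \<phi> x v *\<^sub>R u"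
    by (simp add: \<phi>_def scaleR_add_right divide_inverse mult.commute)
  then show ?thesis by (simp add: T_def eq_diff_eq algebra_simps)
qed

text \<open>The derivatives of the two logarithms are the trace of D and minus the trace of C, so
  the sum divided by n + 1 is a primitive of \<phi>. The first measures the metric volume, the
  second the reciprocal of a \<Gamma>-parallel volume.\<close>

definition \<psi> where "\<psi> x = (ln \<bar>det (h x)\<bar> / 2 + ln (maxdet (F x))) / (CARD('n) + 1)"

lemma trace_sum: "trace (Dm x u) = (\<Sum>k\<in>UNIV. D x u (axis k 1) $ k)" "trace (Cm x u) = (\<Sum>k\<in>UNIV. C x u (axis k 1) $ k)"
  by (simp_all add: trace_def Dm_def Cm_def matrix_def)

lemma \<phi>_smooth: "smooth_on U (\<lambda>x. \<phi> x u)"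
proof -
  have "smooth_on U (\<lambda>x. \<Sum>k\<in>UNIV. D x u (axis k 1) $ k)"
    by (rule smooth_on_sum[OF smooth_on_nth[OF Dsm U] U])
  moreover have "smooth_on U (\<lambda>x. \<Sum>k\<in>UNIV. C x u (axis k 1) $ k)"
    by (rule smooth_on_sum[OF smooth_on_nth[OF Csm U] U])
  ultimately show ?thesis
    unfolding \<phi>_def trace_sum
    by (intro smooth_on_divide[OF smooth_on_diff[OF _ _ U] smooth_on_const U]) auto
qed

lemma \<phi>_linear: "linear (\<phi> x)"
  unfolding \<phi>_def trace_sum
  by (rule linearI)
    (simp_all add: bilinear_ladd[OF Cbil] bilinear_ladd[OF Dbil] bilinear_lmul[OF Cbil] bilinear_lmul[OF Dbil]
      sum.distrib sum_distrib_left[symmetric] diff_divide_distrib add_divide_distrib right_diff_distrib)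

lemma ln_det_metric_derivative:
  assumes x: "x \<in> U"
  shows "((\<lambda>t. ln \<bar>det (h (x + t *\<^sub>R u))\<bar>) has_real_derivative 2 * trace (Dm x u)) (at 0)"
proof -
  let ?H = "matrix_inv (h x)"
  have inv: "invertible (h x)" by (rule hinv[OF x])
  have dnz: "det (h x) \<noteq> 0" using inv invertible_det_nz by blast
  have "((\<lambda>t. h (x + t *\<^sub>R u)) has_derivative (\<lambda>s. s *\<^sub>R frechet_derivative h (at x) u)) (at 0)"
    using has_derivative_along_line[of h "frechet_derivative h (at x)" x 0 u] smooth_on_derivative[OF hsm x] by simp
  then have "((\<lambda>t. h (x + t *\<^sub>R u)) has_vector_derivative frechet_derivative h (at x) u) (at 0)"
    by (simp add: has_vector_derivative_def)
  from bounded_linear.has_vector_derivative[OF bounded_bilinear.bounded_linear_right[OF bounded_bilinear_matrix_mult] this]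
  have 1: "((\<lambda>t. ?H ** h (x + t *\<^sub>R u)) has_vector_derivative ?H ** frechet_derivative h (at x) u) (at 0)" .
  have tr: "trace (?H ** frechet_derivative h (at x) u) = 2 * trace (Dm x u)"
  proof -
    have "trace (?H ** (transpose (Dm x u) ** h x)) = trace (transpose (Dm x u) ** (h x ** ?H))"
      by (subst trace_mul_sym) (simp add: matrix_mul_assoc)
    moreover have "?H ** (h x ** Dm x u) = Dm x u"
      by (simp add: matrix_mul_assoc matrix_inv_left[OF inv])
    moreover have "trace (transpose (Dm x u)) = trace (Dm x u)"
      by (simp add: trace_def transpose_def)
    ultimately show ?thesis
      unfolding compat[OF x] by (simp add: matrix_mult_linear trace_add matrix_inv_right[OF inv] Dm_def[symmetric])
  qed
  have "((\<lambda>t. ln \<bar>det (h (x + t *\<^sub>R u))\<bar>) has_real_derivative trace (?H ** frechet_derivative h (at x) u)) (at 0)"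
  proof (rule ln_det_derivative[OF 1, where c="\<bar>det (h x)\<bar>" and r=1])
    have "det (h x) * det ?H = 1" using matrix_inv_right[OF inv] by (metis det_I det_mul)
    then show "\<bar>det (h (x + t *\<^sub>R u))\<bar> = \<bar>det (h x)\<bar> * \<bar>det (?H ** h (x + t *\<^sub>R u))\<bar>" for t
      by (simp add: det_mul abs_mult mult.assoc[symmetric]) (simp add: abs_mult[symmetric])
  qed (use dnz in \<open>simp_all add: matrix_inv_left[OF inv]\<close>)
  then show ?thesis by (simp add: tr)
qed

text \<open>Parallel transport P(t) preserves \<open>F\<close>, so along a line
  \<open>maxdet\<close> changes only by the factor det P(t), whose logarithmic derivative at 0 is
  minus the trace of C.\<close>

lemma ln_maxdet_derivative:
  assumes x: "x \<in> U"
  shows "((\<lambda>t. ln (maxdet (F (x + t *\<^sub>R u)))) has_real_derivative - trace (Cm x u)) (at 0)"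
proof -
  obtain r P where r: "r > 0" and P0: "P 0 = mat 1" and inU: "\<And>t. \<bar>t\<bar> < r \<Longrightarrow> x + t *\<^sub>R u \<in> U"
    and det: "\<And>t. \<bar>t\<bar> < r \<Longrightarrow> det (P t) \<noteq> 0"
    and dP: "\<And>t. \<bar>t\<bar> < r \<Longrightarrow> (P has_vector_derivative - (Cm (x + t *\<^sub>R u) u ** P t)) (at t)"
    and FP: "\<And>t v. \<bar>t\<bar> < r \<Longrightarrow> F (x + t *\<^sub>R u) (P t *v v) = F x v"
    by (rule transport[OF x, of u]) blast
  have "(P has_vector_derivative - Cm x u) (at 0)" using dP[of 0] r by (simp add: P0)
  then have "((\<lambda>t. ln (maxdet (F (x + t *\<^sub>R u)))) has_real_derivative trace (- Cm x u)) (at 0)"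
  proof (rule ln_det_derivative[where N=P and f="\<lambda>t. maxdet (F (x + t *\<^sub>R u))", OF _ P0 gauge.maxdet_pos[OF gauge[OF x]] r])
    fix t assume t: "\<bar>t\<bar> < r"
    show "maxdet (F (x + t *\<^sub>R u)) = maxdet (F x) * \<bar>det (P t)\<bar>"
      using maxdet_transform[OF gauge[OF x] gauge[OF inU[OF t]] det[OF t] FP[OF t]] by simp
  qed
  then show ?thesis by (simp add: trace_def sum_negf)
qed

text \<open>A supremum such as \<open>maxdet\<close> is not visibly differentiable in x; transport
  provides directional derivatives only. They are linear in the direction and continuous in the
  point, hence come from a total derivative.\<close>

lemma \<psi>_derivative:
  assumes x: "x \<in> U"
  shows "(\<psi> has_derivative \<phi> x) (at x)"
proof (rule has_derivative_directional[OF U x])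
  show "((\<lambda>t. \<psi> (y + t *\<^sub>R v)) has_real_derivative \<phi> y v) (at 0)" if y: "y \<in> U" for y v
    unfolding \<psi>_def
    by (rule derivative_eq_intros ln_det_metric_derivative[OF y] ln_maxdet_derivative[OF y] refl | simp add: \<phi>_def)+
  show "linear (\<phi> y)" for y by (rule \<phi>_linear)
  show "continuous_on U (\<lambda>y. \<phi> y v)" for v by (rule smooth_on_continuous[OF \<phi>_smooth])
qed

lemma \<psi>_smooth: "smooth_on U \<psi>"
  by (rule smooth_onI_derivative[OF U \<psi>_derivative \<phi>_smooth])

definition grad where "grad x = (\<chi> i. \<phi> x (axis i 1))"

lemma grad: "grad x \<bullet> u = \<phi> x u"
proof -
  have "u = (\<Sum>k\<in>UNIV. u $ k *\<^sub>R axis k 1)"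
    by (simp add: basis_expansion scalar_mult_eq_scaleR[symmetric])
  then have "\<phi> x u = \<phi> x (\<Sum>k\<in>UNIV. u $ k *\<^sub>R axis k 1)" by simp
  then show ?thesis
    by (simp add: linear_sum[OF \<phi>_linear] linear_cmul[OF \<phi>_linear] grad_def inner_vec_def mult.commute)
qed

text \<open>The exponential factor is chosen to cancel the multiple of the inverse metric that
  \<phi>(u) Id contributes to its covariant derivative with respect to \<Gamma>.\<close>

definition sol where "sol x = exp (2 * \<psi> x) *\<^sub>R matrix_inv (h x)"
definition lam where "lam x = - (sol x *v grad x)"

lemma hinv_smooth: "smooth_on U (\<lambda>x. matrix_inv (h x))"
proof -
  have "smooth_on U (\<lambda>x. \<chi> i j. matrix_inv (h x) $ i $ j)"
    by (intro smooth_on_vec_lambda smooth_on_matrix_inv smooth_on_matrix_entries hsm U hinv)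
  then show ?thesis by simp
qed

lemma exp_smooth: "smooth_on U (\<lambda>x. exp (2 * \<psi> x))"
  by (rule smooth_on_compose[OF smooth_on_exp smooth_on_mult[OF smooth_on_const \<psi>_smooth U] U]) auto

lemma sol_smooth: "smooth_on U sol"
  unfolding sol_def by (rule smooth_on_scaleR[OF exp_smooth hinv_smooth U])

lemma lam_smooth: "smooth_on U lam"
  unfolding lam_def grad_def
  by (intro smooth_on_uminus smooth_on_bilinear[OF bounded_bilinear_matrix_vector_mult] sol_smooth
      smooth_on_vec_lambda \<phi>_smooth U)

lemma sol_sym: "x \<in> U \<Longrightarrow> transpose (sol x) = sol x"
proof -
  assume x: "x \<in> U"
  have "transpose (matrix_inv (h x)) = matrix_inv (h x)"
  proof -
    have "transpose (h x ** matrix_inv (h x)) = transpose (mat 1)" by (simp add: matrix_inv_right hinv x)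
    then have "transpose (matrix_inv (h x)) ** h x = mat 1" by (simp add: matrix_transpose_mul hsym x)
    then have "transpose (matrix_inv (h x)) ** h x ** matrix_inv (h x) = matrix_inv (h x)" by simp
    then show ?thesis by (simp add: matrix_mul_assoc[symmetric] matrix_inv_right hinv x)
  qed
  then show ?thesis
    by (simp add: sol_def linear_cmul[OF bounded_linear.linear[OF bounded_linear_transpose]])
qed

lemma hinv_derivative:
  assumes x: "x \<in> U"
  shows "frechet_derivative (\<lambda>x. matrix_inv (h x)) (at x) u =
    - (Dm x u ** matrix_inv (h x)) - matrix_inv (h x) ** transpose (Dm x u)"
proof -
  let ?H = "matrix_inv (h x)" and ?E = "frechet_derivative (\<lambda>x. matrix_inv (h x)) (at x)"
  have inv: "invertible (h x)" by (rule hinv[OF x])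
  have dH: "((\<lambda>x. matrix_inv (h x)) has_derivative ?E) (at x)" by (rule smooth_on_derivative[OF hinv_smooth x])
  have dh: "(h has_derivative frechet_derivative h (at x)) (at x)" by (rule smooth_on_derivative[OF hsm x])
  have "((\<lambda>x. h x ** matrix_inv (h x)) has_derivative (\<lambda>u. h x ** ?E u + frechet_derivative h (at x) u ** ?H)) (at x)"
    by (rule bounded_bilinear.FDERIV[OF bounded_bilinear_matrix_mult dh dH])
  then have "((\<lambda>x. mat 1) has_derivative (\<lambda>u. h x ** ?E u + frechet_derivative h (at x) u ** ?H)) (at x)"
    by (rule has_derivative_transform_within_open[OF _ U x]) (simp add: matrix_inv_right hinv)
  from fun_cong[OF has_derivative_unique[OF this has_derivative_const], of u]
  have "h x ** ?E u = - (frechet_derivative h (at x) u ** ?H)" by (simp add: eq_neg_iff_add_eq_0)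
  then have "?H ** (h x ** ?E u) = ?H ** (- (frechet_derivative h (at x) u ** ?H))" by simp
  moreover have "?H ** (h x ** ?E u) = ?E u" by (simp add: matrix_mul_assoc matrix_inv_left[OF inv])
  moreover have neg: "A ** (- B) = - (A ** B)" for A B :: "real^'n^'n"
    using matrix_mult_linear(5)[of A "-1" B] by simp
  ultimately have "?E u = - (?H ** ((transpose (Dm x u) ** h x + h x ** Dm x u) ** ?H))"
    by (simp add: compat[OF x] Dm_def)
  also have "?H ** ((transpose (Dm x u) ** h x + h x ** Dm x u) ** ?H) =
      ?H ** transpose (Dm x u) ** (h x ** ?H) + (?H ** h x) ** Dm x u ** ?H"
    by (simp add: matrix_mult_linear matrix_mul_assoc)
  also have "\<dots> = ?H ** transpose (Dm x u) + Dm x u ** ?H"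
    by (simp add: matrix_inv_left[OF inv] matrix_inv_right[OF inv])
  finally show ?thesis by simp
qed

text \<open>The inverse metric is parallel for D, and D_u = C_u + \<phi>(u) Id + u \<otimes> \<phi>.
  Passing from D to C costs twice \<phi>(u), which the derivative of the exponential compensates,
  and two outer products, which form the right-hand side.\<close>

lemma sol_derivative:
  assumes x: "x \<in> U"
  shows "frechet_derivative sol (at x) u =
      outer (lam x) u + outer u (lam x) - Cm x u ** sol x - sol x ** transpose (Cm x u)"
proof -
  let ?H = "matrix_inv (h x)" and ?E = "frechet_derivative (\<lambda>x. matrix_inv (h x)) (at x)"
  have dH: "((\<lambda>x. matrix_inv (h x)) has_derivative ?E) (at x)" by (rule smooth_on_derivative[OF hinv_smooth x])
  have de: "((\<lambda>x. exp (2 * \<psi> x)) has_derivative (\<lambda>u. 2 * \<phi> x u * exp (2 * \<psi> x))) (at x)"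
    by (rule derivative_eq_intros \<psi>_derivative[OF x] refl | simp)+
  have "(sol has_derivative (\<lambda>u. exp (2 * \<psi> x) *\<^sub>R ?E u + (2 * \<phi> x u * exp (2 * \<psi> x)) *\<^sub>R ?H)) (at x)"
    unfolding sol_def[abs_def] by (rule has_derivative_scaleR[OF de dH])
  then have "frechet_derivative sol (at x) u = exp (2 * \<psi> x) *\<^sub>R ?E u + (2 * \<phi> x u * exp (2 * \<psi> x)) *\<^sub>R ?H"
    by (rule frechet_derivative_eqI)
  also have "\<dots> = (2 * \<phi> x u) *\<^sub>R sol x - Dm x u ** sol x - sol x ** transpose (Dm x u)"
    by (simp add: hinv_derivative[OF x] sol_def matrix_mult_linear scaleR_diff_right mult.commute)
  \<comment> \<open>The projective relation as an identity of matrices acting on the second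
    argument.\<close>
  also have Dmd: "Dm x u = Cm x u + \<phi> x u *\<^sub>R mat 1 + outer u (grad x)"
  proof (subst matrix_eq, rule allI)
    fix v
    have "outer u (grad x) *v v = \<phi> x v *\<^sub>R u"
      unfolding grad[symmetric]
      by (simp add: vec_eq_iff outer_def matrix_vector_mult_def inner_vec_def sum_distrib_left sum_distrib_right mult_ac)
    then show "Dm x u *v v = (Cm x u + \<phi> x u *\<^sub>R mat 1 + outer u (grad x)) *v v"
      by (simp add: Dm Cm projective[OF x, of u v] matrix_vector_mult_add_rdistrib scaleR_matrix_vector_assoc[symmetric])
  qed
  also have "transpose (Cm x u + \<phi> x u *\<^sub>R mat 1 + outer u (grad x)) =
      transpose (Cm x u) + \<phi> x u *\<^sub>R mat 1 + outer (grad x) u"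
    by (simp add: transpose_def vec_eq_iff outer_def mat_def)
  also have "outer u (grad x) ** sol x = outer u (sol x *v grad x)"
  proof -
    have "outer u (grad x) ** sol x = outer u (grad x) ** transpose (sol x)" by (simp add: sol_sym[OF x])
    then show ?thesis by (simp add: matrix_mult_outer)
  qed
  then have "(Cm x u + \<phi> x u *\<^sub>R mat 1 + outer u (grad x)) ** sol x =
      Cm x u ** sol x + \<phi> x u *\<^sub>R sol x + outer u (sol x *v grad x)"
    by (simp add: matrix_mult_linear)
  moreover have "sol x ** (transpose (Cm x u) + \<phi> x u *\<^sub>R mat 1 + outer (grad x) u) =
      sol x ** transpose (Cm x u) + \<phi> x u *\<^sub>R sol x + outer (sol x *v grad x) u"
    by (simp add: matrix_mult_linear matrix_mult_outer)
  moreover have "outer (lam x) u = - outer (sol x *v grad x) u" "outer u (lam x) = - outer u (sol x *v grad x)"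
    by (simp_all add: lam_def outer_def vec_eq_iff)
  moreover have "(2 * \<phi> x u) *\<^sub>R sol x = \<phi> x u *\<^sub>R sol x + \<phi> x u *\<^sub>R sol x"
    by (simp only: mult_2 scaleR_left_distrib)
  ultimately show ?thesis by (simp only: Dmd) simp
qed

text \<open>\<open>sol\<close> is invertible, so \<open>lam\<close> vanishes exactly where \<phi>
  does, and there the projective relation has no correction term.\<close>

lemma lam_zero:
  assumes x: "x \<in> U" and z: "lam x = 0"
  shows "D x u v = C x u v"
proof -
  have "h x *v (sol x *v grad x) = exp (2 * \<psi> x) *\<^sub>R grad x"
    by (simp add: sol_def matrix_vector_mul_assoc matrix_mult_linear matrix_inv_right[OF hinv[OF x]]
        scaleR_matrix_vector_assoc[symmetric] matrix_vector_mult_scaleR)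
  then have "grad x = 0" using z by (simp add: lam_def)
  then have "\<phi> x u = 0" for u using grad[of x u] by simp
  then show ?thesis by (simp add: projective[OF x])
qed

end

subsection \<open>Charts, tangent vectors and connections\<close>

text \<open>The product rule for a moving direction, for vectors \<xi> given only along a curve and
  not as a field on an open set.\<close>

lemma curve_frechet_apply:
  fixes f :: "'a::euclidean_space \<Rightarrow> 'b::euclidean_space"
  assumes f: "smooth_on S f" and S: "open S" and I: "open I" "t \<in> I" and xS: "\<And>s. s \<in> I \<Longrightarrow> x s \<in> S"
    and x: "(x has_vector_derivative x') (at t)" and \<xi>: "(\<xi> has_vector_derivative \<xi>') (at t)"
  shows "((\<lambda>s. frechet_derivative f (at (x s)) (\<xi> s)) has_vector_derivative
    frechet_derivative (\<lambda>y. frechet_derivative f (at y) (\<xi> t)) (at (x t)) x' +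
    frechet_derivative f (at (x t)) \<xi>') (at t)"
proof -
  let ?D = "\<lambda>b y. frechet_derivative f (at y) b"
  let ?D2 = "\<lambda>b. frechet_derivative (?D b) (at (x t))"
  have xt: "x t \<in> S" using xS I by blast
  have d2: "(?D b has_derivative ?D2 b) (at (x t))" for b
    using smooth_on_derivative[OF smooth_on_frechet[OF f] xt] .
  have rep: "?D w y = (\<Sum>b\<in>Basis. (w \<bullet> b) *\<^sub>R ?D b y)" if "y \<in> S" for w y
    using linear_Basis_expand[OF smooth_on_linear_frechet[OF f that]] .
  have dx: "((\<lambda>s. ?D b (x s)) has_vector_derivative ?D2 b x') (at t)" for b
  proof -
    have "((\<lambda>s. ?D b (x s)) has_derivative (\<lambda>h. ?D2 b (h *\<^sub>R x'))) (at t)"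
      by (rule has_derivative_compose[OF x[unfolded has_vector_derivative_def] d2])
    then show ?thesis
      unfolding has_vector_derivative_def linear_cmul[OF has_derivative_linear[OF d2]] .
  qed
  have "((\<lambda>s. \<Sum>b\<in>Basis. (\<xi> s \<bullet> b) *\<^sub>R ?D b (x s)) has_vector_derivative
      (\<Sum>b\<in>Basis. (\<xi> t \<bullet> b) *\<^sub>R ?D2 b x' + (\<xi>' \<bullet> b) *\<^sub>R ?D b (x t))) (at t)"
    by (intro has_vector_derivative_sum bounded_bilinear.has_vector_derivative[OF bounded_bilinear_scaleR]
        bounded_linear.has_vector_derivative[OF bounded_linear_inner_left] \<xi> dx)
  then have 1: "((\<lambda>s. ?D (\<xi> s) (x s)) has_vector_derivative
      (\<Sum>b\<in>Basis. (\<xi> t \<bullet> b) *\<^sub>R ?D2 b x' + (\<xi>' \<bullet> b) *\<^sub>R ?D b (x t))) (at t)"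
    by (rule has_vector_derivative_transform_within_open[OF _ I]) (rule rep[OF xS, symmetric])
  have "?D2 (\<xi> t) x' = (\<Sum>b\<in>Basis. (\<xi> t \<bullet> b) *\<^sub>R ?D2 b x')"
    by (rule linear_Basis_expand[OF second_derivative_linear[OF f S xt]])
  with 1 show ?thesis by (simp add: sum.distrib rep[OF xt, of \<xi>'])
qed

lemma partial_component:
  assumes "(f has_derivative D) (at x)"
  shows "partial k (\<lambda>x. f x $ i) x = D (axis k 1) $ i"
  unfolding partial_def
  by (rule frechet_derivative_eqI[OF bounded_linear.has_derivative[OF bounded_linear_vec_nth assms]])

lemma partial_entry:
  assumes "(f has_derivative D) (at x)"
  shows "partial k (\<lambda>x. f x $ i $ j) x = D (axis k 1) $ i $ j"
  unfolding partial_def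
  by (rule frechet_derivative_eqI[OF bounded_linear.has_derivative[OF bounded_linear_vec_nth
          bounded_linear.has_derivative[OF bounded_linear_vec_nth assms]]])

lemma partial_cong:
  assumes "open S" "x \<in> S" "\<And>y. y \<in> S \<Longrightarrow> f y = g y"
  shows "partial k f x = partial k g x"
  unfolding partial_def by (rule fun_cong[OF frechet_derivative_cong_open[OF assms]])

lemma sum_axis: "(\<Sum>k\<in>UNIV. f k * axis (j::'m::finite) (1::real) $ k) = f j"
proof -
  have "(\<Sum>k\<in>UNIV. f k * axis j (1::real) $ k) = (\<Sum>k\<in>UNIV. if k = j then f j else 0)"
    by (intro sum.cong) (auto simp: axis_def)
  then show ?thesis by simp
qed

section \<open>Transition maps, their Jacobians and components of tangent vectors\<close>

locale smooth_mfd =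
  fixes A :: "('a::{t2_space,second_countable_topology}, 'n::finite) chart set"
  assumes mfd: "smooth_manifold A"
begin

lemma chart_open: "c \<in> A \<Longrightarrow> open (source c)" "c \<in> A \<Longrightarrow> open (target c)"
  using mfd by (auto simp: smooth_manifold_def is_chart_def)

lemma chart_homeo: "c \<in> A \<Longrightarrow> homeomorphism (source c) (target c) (coord c) (pt c)"
  using mfd by (auto simp: smooth_manifold_def is_chart_def)

lemma pt_coord: "c \<in> A \<Longrightarrow> p \<in> source c \<Longrightarrow> pt c (coord c p) = p"
  using homeomorphism_apply1[OF chart_homeo] by blast

lemma coord_pt: "x \<in> target c \<Longrightarrow> coord c (pt c x) = x"
  by (rule f_inv_into_f)

lemma pt_source: "x \<in> target c \<Longrightarrow> pt c x \<in> source c"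
  by (rule inv_into_into)

lemma coord_target: "p \<in> source c \<Longrightarrow> coord c p \<in> target c"
  by blast

lemma coord_continuous: "c \<in> A \<Longrightarrow> continuous_on (source c) (coord c)"
  and pt_continuous: "c \<in> A \<Longrightarrow> continuous_on (target c) (pt c)"
  using chart_homeo by (auto simp: homeomorphism_def)

lemma chart_at: obtains c where "c \<in> A" "p \<in> source c"
proof -
  have "p \<in> (\<Union>c\<in>A. source c)" using mfd by (simp add: smooth_manifold_def)
  then show ?thesis using that by blast
qed

definition tr where "tr c d = coord d \<circ> pt c"
definition dom where "dom c d = coord c ` (source c \<inter> source d)"

lemma dom_iff: "c \<in> A \<Longrightarrow> x \<in> dom c d \<longleftrightarrow> x \<in> target c \<and> pt c x \<in> source d"
  unfolding dom_def using pt_coord coord_pt pt_source by (auto simp: image_iff)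

lemma dom_target: "x \<in> dom c d \<Longrightarrow> x \<in> target c"
  by (auto simp: dom_def)

lemma dom_open: "c \<in> A \<Longrightarrow> d \<in> A \<Longrightarrow> open (dom c d)"
proof -
  assume c: "c \<in> A" and d: "d \<in> A"
  have "open (target c \<inter> pt c -` source d)"
    by (rule continuous_open_preimage[OF pt_continuous[OF c] chart_open(2)[OF c] chart_open(1)[OF d]])
  moreover have "dom c d = target c \<inter> pt c -` source d" using dom_iff[OF c] by blast
  ultimately show ?thesis by simp
qed

lemma dom_coord: "p \<in> source c \<Longrightarrow> p \<in> source d \<Longrightarrow> coord c p \<in> dom c d"
  by (auto simp: dom_def)

lemma tr_smooth: "c \<in> A \<Longrightarrow> d \<in> A \<Longrightarrow> smooth_on (dom c d) (tr c d)"
  using mfd unfolding smooth_manifold_def tr_def dom_def by blast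

lemma pt_tr: "c \<in> A \<Longrightarrow> d \<in> A \<Longrightarrow> x \<in> dom c d \<Longrightarrow> pt d (tr c d x) = pt c x"
  by (simp add: tr_def pt_coord dom_iff)

lemma tr_dom: "c \<in> A \<Longrightarrow> d \<in> A \<Longrightarrow> x \<in> dom c d \<Longrightarrow> tr c d x \<in> dom d c"
  using dom_iff[of c x d] by (auto simp: tr_def dom_def pt_source)

lemma tr_target: "c \<in> A \<Longrightarrow> d \<in> A \<Longrightarrow> x \<in> dom c d \<Longrightarrow> tr c d x \<in> target d"
  using tr_dom dom_target by blast

lemma tr_derivative:
  "c \<in> A \<Longrightarrow> d \<in> A \<Longrightarrow> x \<in> dom c d \<Longrightarrow> (tr c d has_derivative frechet_derivative (tr c d) (at x)) (at x)"
  by (rule smooth_on_derivative[OF tr_smooth])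

lemma jac_app:
  assumes "c \<in> A" "d \<in> A" "x \<in> dom c d"
  shows "jac c d (pt c x) *v v = frechet_derivative (tr c d) (at x) v"
proof -
  have "coord c (pt c x) = x" by (rule coord_pt[OF dom_target[OF assms(3)]])
  then show ?thesis
    using has_derivative_linear[OF tr_derivative[OF assms]]
    by (simp add: jac_def jacobian_def tr_def[symmetric] matrix_works)
qed

lemma jac_cocycle:
  assumes c: "c \<in> A" and d: "d \<in> A" and e: "e \<in> A"
    and p: "p \<in> source c" "p \<in> source d" "p \<in> source e"
  shows "jac d e p ** jac c d p = jac c e p"
proof -
  let ?x = "coord c p" and ?y = "coord d p"
  have xd: "?x \<in> dom c d" and xe: "?x \<in> dom c e" and ye: "?y \<in> dom d e" using p by (auto intro: dom_coord)
  have px: "pt c ?x = p" "pt d ?y = p" using p c d by (auto simp: pt_coord)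
  have y: "tr c d ?x = ?y" by (simp add: tr_def px)
  have 1: "((\<lambda>x. tr d e (tr c d x)) has_derivative
      (\<lambda>v. frechet_derivative (tr d e) (at ?y) (frechet_derivative (tr c d) (at ?x) v))) (at ?x)"
    by (rule has_derivative_compose[OF tr_derivative[OF c d xd]]) (simp add: y tr_derivative[OF d e ye])
  have "((\<lambda>x. tr c e x) has_derivative
      (\<lambda>v. frechet_derivative (tr d e) (at ?y) (frechet_derivative (tr c d) (at ?x) v))) (at ?x)"
    by (rule has_derivative_transform_within_open[OF 1 dom_open[OF c d] xd]) (simp add: tr_def[of d e] pt_tr c d, simp add: tr_def)
  then have "frechet_derivative (tr c e) (at ?x) v =
      frechet_derivative (tr d e) (at ?y) (frechet_derivative (tr c d) (at ?x) v)" for v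
    by (rule frechet_derivative_eqI)
  then show ?thesis
    using jac_app[OF c d xd] jac_app[OF c e xe] jac_app[OF d e ye]
    by (simp add: px matrix_eq matrix_vector_mul_assoc[symmetric])
qed

lemma jac_self:
  assumes c: "c \<in> A" and p: "p \<in> source c"
  shows "jac c c p = mat 1"
proof -
  let ?x = "coord c p"
  have x: "?x \<in> dom c c" using p by (auto intro: dom_coord)
  have "(tr c c has_derivative (\<lambda>v. v)) (at ?x)"
    by (rule has_derivative_transform_within_open[OF has_derivative_ident dom_open[OF c c] x])
      (simp add: tr_def coord_pt dom_target)
  then have "frechet_derivative (tr c c) (at ?x) v = v" for v by (rule frechet_derivative_eqI)
  then show ?thesis using jac_app[OF c c x] by (simp add: pt_coord[OF c p] matrix_eq)
qed

lemma jac_det: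
  assumes "c \<in> A" "d \<in> A" "p \<in> source c" "p \<in> source d"
  shows "det (jac c d p) \<noteq> 0"
proof -
  have "jac d c p ** jac c d p = mat 1"
    using jac_cocycle[of c d c p] jac_self[of c p] assms by simp
  then have "det (jac d c p) * det (jac c d p) = 1" by (metis det_I det_mul)
  then show ?thesis by auto
qed

lemma tvec_tangent:
  assumes c: "c \<in> A" and p: "p \<in> source c"
  shows "tvec A c p v \<in> tangent_space A p"
proof -
  have "tvec A c p v e = jac d e p *v tvec A c p v d"
    if "d \<in> A" "e \<in> A" "p \<in> source d \<inter> source e" for d e
    using that c p jac_cocycle[of c d e p] by (simp add: tvec_def matrix_vector_mul_assoc)
  then show ?thesis
    unfolding tangent_space_def mem_Collect_eq by (intro conjI ballI impI allI) (auto simp only: tvec_def if_False)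
qed

lemma tvec_self: "c \<in> A \<Longrightarrow> p \<in> source c \<Longrightarrow> tvec A c p v c = v"
  by (simp add: tvec_def jac_self)

lemma tvec_change:
  assumes "c \<in> A" "d \<in> A" "p \<in> source c" "p \<in> source d"
  shows "tvec A d p (jac c d p *v v) = tvec A c p v"
proof (rule ext)
  show "tvec A d p (jac c d p *v v) e = tvec A c p v e" for e
    using assms jac_cocycle[of c d e p] by (simp add: tvec_def matrix_vector_mul_assoc)
qed

lemma tangent_tvec:
  assumes "\<xi> \<in> tangent_space A p" "c \<in> A" "p \<in> source c"
  shows "\<xi> = tvec A c p (\<xi> c)"
proof (rule ext)
  have 1: "\<forall>c\<in>A. \<forall>d\<in>A. p \<in> source c \<inter> source d \<longrightarrow> \<xi> d = jac c d p *v \<xi> c"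
    and 2: "\<forall>c. \<not> (c \<in> A \<and> p \<in> source c) \<longrightarrow> \<xi> c = 0"
    using assms(1) by (auto simp only: tangent_space_def mem_Collect_eq)
  show "\<xi> d = tvec A c p (\<xi> c) d" for d
    using 1[rule_format, OF assms(2), of d] 2[rule_format, of d] assms(3) by (auto simp only: tvec_def split: if_splits)
qed

lemma tvec_scaleR: "(\<lambda>d. r *\<^sub>R tvec A c p v d) = tvec A c p (r *\<^sub>R v)"
  by (rule ext) (simp add: tvec_def matrix_vector_mult_scaleR)

lemma in_coord_change:
  assumes "c \<in> A" "d \<in> A" "p \<in> source c" "p \<in> source d"
  shows "in_coord A F d (coord d p) (jac c d p *v v) = in_coord A F c (coord c p) v"
  using assms by (simp add: in_coord_def pt_coord tvec_change)

section \<open>Christoffel symbols as bilinear maps and their transformation law\<close>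

definition conn :: "('a, 'n) connection \<Rightarrow> ('a, 'n) chart \<Rightarrow> real^'n \<Rightarrow> real^'n \<Rightarrow> real^'n \<Rightarrow> real^'n" where
  "conn \<Gamma> c x u v = (\<chi> i. \<Sum>j\<in>UNIV. \<Sum>k\<in>UNIV. \<Gamma> (pt c x) c i j k * u $ j * v $ k)"

lemma conn_bilinear: "bilinear (conn \<Gamma> c x)"
  unfolding bilinear_def conn_def
  by (auto intro!: linearI simp: vec_eq_iff algebra_simps sum.distrib sum_distrib_left)

lemma conn_axis_left: "conn \<Gamma> c x (axis j 1) v $ i = (\<Sum>k\<in>UNIV. \<Gamma> (pt c x) c i j k * v $ k)"
proof -
  have "conn \<Gamma> c x (axis j 1) v $ i =
      (\<Sum>j'\<in>UNIV. (\<Sum>k\<in>UNIV. \<Gamma> (pt c x) c i j' k * v $ k) * axis j 1 $ j')"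
    by (simp add: conn_def sum_distrib_left sum_distrib_right mult_ac)
  then show ?thesis by (simp only: sum_axis)
qed

lemma conn_axis: "conn \<Gamma> c x (axis j 1) (axis k 1) $ i = \<Gamma> (pt c x) c i j k"
  by (simp only: conn_axis_left sum_axis)

lemma conn_smooth:
  assumes c: "c \<in> A" and s: "\<And>i j k. smooth_on (target c) (\<lambda>x. \<Gamma> (pt c x) c i j k)"
  shows "smooth_on (target c) (\<lambda>x. conn \<Gamma> c x u v)"
proof -
  note o = chart_open(2)[OF c]
  show ?thesis
    unfolding conn_def
    by (rule smooth_on_vec_lambda[OF smooth_on_sum[OF smooth_on_sum[OF smooth_on_mult[OF smooth_on_mult[OF s
                smooth_on_const o] smooth_on_const o] o] o] o])
qed

lemma conn_sym:
  assumes "\<And>i j k. \<Gamma> (pt c x) c i j k = \<Gamma> (pt c x) c i k j"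
  shows "conn \<Gamma> c x u v = conn \<Gamma> c x v u"
proof -
  have "(\<Sum>j\<in>UNIV. \<Sum>k\<in>UNIV. \<Gamma> (pt c x) c i j k * u $ j * v $ k) =
      (\<Sum>j\<in>UNIV. \<Sum>k\<in>UNIV. \<Gamma> (pt c x) c i j k * v $ j * u $ k)" for i
    by (subst sum.swap) (simp add: assms[of i] mult_ac)
  then show ?thesis by (simp add: conn_def)
qed

definition hes where
  "hes c d x u v = frechet_derivative (\<lambda>z. frechet_derivative (tr c d) (at z) v) (at x) u"

text \<open>The transformation law of Christoffel symbols with the indices absorbed into arbitrary
  vectors u, v. It is the common property of \<Gamma>, for which it is assumed in components, and of
  the explicit Levi-Civita symbols, for which it has to be proved.\<close>

definition conn_law where
  "conn_law \<Gamma> \<longleftrightarrow> (\<forall>c\<in>A. \<forall>d\<in>A. \<forall>x\<in>dom c d. \<forall>u v.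
     frechet_derivative (tr c d) (at x) (conn \<Gamma> c x u v) =
     hes c d x u v + conn \<Gamma> d (tr c d x) (frechet_derivative (tr c d) (at x) u) (frechet_derivative (tr c d) (at x) v))"

lemma hes_derivative:
  "c \<in> A \<Longrightarrow> d \<in> A \<Longrightarrow> x \<in> dom c d \<Longrightarrow>
    ((\<lambda>z. frechet_derivative (tr c d) (at z) v) has_derivative (\<lambda>u. hes c d x u v)) (at x)"
  unfolding hes_def by (rule smooth_on_derivative[OF smooth_on_frechet[OF tr_smooth]])

lemma hes_sym: "c \<in> A \<Longrightarrow> d \<in> A \<Longrightarrow> x \<in> dom c d \<Longrightarrow> hes c d x u v = hes c d x v u"
  unfolding hes_def by (rule schwarz[OF tr_smooth dom_open])

lemma hes_bilinear: "c \<in> A \<Longrightarrow> d \<in> A \<Longrightarrow> x \<in> dom c d \<Longrightarrow> bilinear (hes c d x)"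
proof -
  assume *: "c \<in> A" "d \<in> A" "x \<in> dom c d"
  have 1: "linear (\<lambda>u. hes c d x u v)" for v by (rule has_derivative_linear[OF hes_derivative[OF *]])
  have eq: "hes c d x u = (\<lambda>v. hes c d x v u)" for u by (rule ext) (rule hes_sym[OF *])
  have "linear (hes c d x u)" for u by (subst eq) (rule 1)
  with 1 show ?thesis by (simp add: bilinear_def)
qed

lemma bilinear_eqI:
  fixes B B' :: "real^'m \<Rightarrow> real^'m \<Rightarrow> real^'m"
  assumes "bilinear B" "bilinear B'" "\<And>i j. B (axis i 1) (axis j 1) = B' (axis i 1) (axis j 1)"
  shows "B u v = B' u v"
  by (subst bilinear_expand[OF assms(1)], subst bilinear_expand[OF assms(2)]) (simp add: assms(3))

lemma affine_connection_law:
  assumes "affine_connection A \<Gamma>"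
  shows "conn_law \<Gamma>"
  unfolding conn_law_def
proof (intro ballI allI)
  fix c d x u v assume c: "c \<in> A" and d: "d \<in> A" and x: "x \<in> dom c d"
  let ?J = "frechet_derivative (tr c d) (at x)"
  have lin: "linear ?J" by (rule has_derivative_linear[OF tr_derivative[OF c d x]])
  let ?B = "\<lambda>u v. ?J (conn \<Gamma> c x u v)"
  let ?B' = "\<lambda>u v. hes c d x u v + conn \<Gamma> d (tr c d x) (?J u) (?J v)"
  have b1: "bilinear ?B"
    using conn_bilinear[of \<Gamma> c x] lin unfolding bilinear_def by (auto intro: linear_compose[unfolded o_def])
  have b2: "bilinear ?B'"
    using conn_bilinear[of \<Gamma> d "tr c d x"] lin hes_bilinear[OF c d x] unfolding bilinear_def
    by (auto intro!: linear_compose_add linear_compose[of ?J, unfolded o_def])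
  have xt: "x \<in> target c" and px: "pt c x \<in> source c \<inter> source d" using x c by (auto simp: dom_iff pt_source)
  have "?B (axis i 1) (axis j 1) = ?B' (axis i 1) (axis j 1)" for i j
  proof (subst vec_eq_iff, rule allI)
    fix r
    have cx: "coord c (pt c x) = x" by (rule coord_pt[OF xt])
    have J: "jac c d (pt c x) *v w = ?J w" for w by (rule jac_app[OF c d x])
    have Jc: "jac c d (pt c x) $ s $ i = ?J (axis i 1) $ s" for s i
      unfolding J[symmetric] by (simp add: matrix_vector_mult_basis column_def)
    have "partial i (partial j (\<lambda>x. coord d (pt c x) $ r)) x =
        partial i (\<lambda>z. frechet_derivative (tr c d) (at z) (axis j 1) $ r) x"
    proof (rule partial_cong[OF dom_open[OF c d] x])
      fix z assume z: "z \<in> dom c d"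
      show "partial j (\<lambda>x. coord d (pt c x) $ r) z = frechet_derivative (tr c d) (at z) (axis j 1) $ r"
        using partial_component[OF tr_derivative[OF c d z]] by (simp add: tr_def)
    qed
    also have "\<dots> = hes c d x (axis i 1) (axis j 1) $ r"
      by (rule partial_component[OF hes_derivative[OF c d x]])
    finally have P: "partial i (partial j (\<lambda>x. coord d (pt c x) $ r)) x = hes c d x (axis i 1) (axis j 1) $ r" .
    have "?B (axis i 1) (axis j 1) $ r = (\<Sum>k\<in>UNIV. jac c d (pt c x) $ r $ k * \<Gamma> (pt c x) c k i j)"
      unfolding J[symmetric] by (simp add: matrix_vector_mult_def conn_axis)
    also have "\<dots> = partial i (partial j (\<lambda>x. coord d (pt c x) $ r)) x +
        (\<Sum>s\<in>UNIV. \<Sum>t\<in>UNIV. \<Gamma> (pt c x) d r s t * jac c d (pt c x) $ s $ i * jac c d (pt c x) $ t $ j)"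
    proof -
      have "\<forall>p \<in> source c \<inter> source d. \<forall>r i j. (\<Sum>k\<in>UNIV. jac c d p $ r $ k * \<Gamma> p c k i j) =
        partial i (partial j (\<lambda>x. coord d (pt c x) $ r)) (coord c p) +
        (\<Sum>s\<in>UNIV. \<Sum>t\<in>UNIV. \<Gamma> p d r s t * jac c d p $ s $ i * jac c d p $ t $ j)"
        using assms c d unfolding affine_connection_def by blast
      from this[rule_format, OF px, of r i j] show ?thesis unfolding cx .
    qed
    also have "\<dots> = ?B' (axis i 1) (axis j 1) $ r"
      unfolding P by (simp add: conn_def Jc pt_tr[OF c d x])
    finally show "?B (axis i 1) (axis j 1) $ r = ?B' (axis i 1) (axis j 1) $ r" .
  qed
  then show "?B u v = ?B' u v" by (rule bilinear_eqI[OF b1 b2])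
qed

section \<open>Curves given in one chart and viewed in every other chart\<close>

context
  fixes c I x
  assumes c: "c \<in> A" and I: "open_interval I" and xs: "smooth_on I x" and xI: "x ` I \<subseteq> target c"
begin

definition "dI d = {t \<in> I. pt c (x t) \<in> source d}"

lemma oI: "open I"
  using I by (simp add: open_interval_def)

lemma dI_dom: "t \<in> dI d \<Longrightarrow> x t \<in> dom c d"
  using xI by (auto simp: dI_def dom_iff[OF c])

lemma dI_I: "t \<in> dI d \<Longrightarrow> t \<in> I"
  by (simp add: dI_def)

lemma dI_open: "d \<in> A \<Longrightarrow> open (dI d)"
proof -
  assume d: "d \<in> A"
  have "open (I \<inter> x -` dom c d)"
    by (rule continuous_open_preimage[OF smooth_on_continuous[OF xs] oI dom_open[OF c d]])
  moreover have "dI d = I \<inter> x -` dom c d" using xI by (auto simp: dI_def dom_iff[OF c])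
  ultimately show ?thesis by simp
qed

lemma curve_smooth: "smooth_curve A (pt c \<circ> x) I"
  unfolding smooth_curve_def
proof (intro conjI ballI I)
  show "continuous_on I (pt c \<circ> x)"
    by (rule continuous_on_compose[OF smooth_on_continuous[OF xs] continuous_on_subset[OF pt_continuous[OF c] xI]])
  fix d assume d: "d \<in> A"
  have "smooth_on (dI d) (\<lambda>t. tr c d (x t))"
    by (rule smooth_on_compose[OF tr_smooth[OF c d] smooth_on_subset[OF xs] dI_open[OF d] dom_open[OF c d]])
      (auto simp: dI_I dI_dom)
  then show "smooth_on {t \<in> I. (pt c \<circ> x) t \<in> source d} (coord d \<circ> (pt c \<circ> x))"
    by (simp add: dI_def tr_def o_def)
qed

lemma curve_velocity:
  assumes d: "d \<in> A" and t: "t \<in> dI d"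
  shows "velocity (pt c \<circ> x) d t = frechet_derivative (tr c d) (at (x t)) (vector_derivative x (at t))"
proof -
  have "(x has_derivative frechet_derivative x (at t)) (at t)" by (rule smooth_on_derivative[OF xs dI_I[OF t]])
  then have dx: "(x has_vector_derivative vector_derivative x (at t)) (at t)"
    using has_vector_derivative_real vector_derivative_works differentiableI_vector by blast
  have "((\<lambda>t. tr c d (x t)) has_derivative (\<lambda>h. frechet_derivative (tr c d) (at (x t)) (h *\<^sub>R vector_derivative x (at t)))) (at t)"
    by (rule has_derivative_compose[OF dx[unfolded has_vector_derivative_def] tr_derivative[OF c d dI_dom[OF t]]])
  then have "((\<lambda>t. tr c d (x t)) has_vector_derivative frechet_derivative (tr c d) (at (x t)) (vector_derivative x (at t))) (at t)"
    unfolding has_vector_derivative_def linear_cmul[OF has_derivative_linear[OF tr_derivative[OF c d dI_dom[OF t]]]] .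
  from vector_derivative_at[OF this] show ?thesis by (simp add: velocity_def tr_def o_def)
qed

lemma curve_derivative_works: "t \<in> I \<Longrightarrow> (x has_vector_derivative vector_derivative x (at t)) (at t)"
  using has_vector_derivative_real[OF smooth_on_derivative[OF xs]] vector_derivative_works differentiableI_vector by blast

text \<open>Differentiating the pushed-forward vector J(x) \<xi> produces a second derivative of the
  transition map. It is cancelled by the inhomogeneous term of the transformation law, so the
  parallel equation keeps its form.\<close>

lemma curve_parallel_transfer:
  assumes law: "conn_law \<Gamma>" and d: "d \<in> A" and t: "t \<in> dI d"
    and \<xi>: "(\<xi> has_vector_derivative - conn \<Gamma> c (x t) (vector_derivative x (at t)) (\<xi> t)) (at t)"
  shows "((\<lambda>s. frechet_derivative (tr c d) (at (x s)) (\<xi> s)) has_vector_derivative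
    - conn \<Gamma> d (tr c d (x t)) (velocity (pt c \<circ> x) d t) (frechet_derivative (tr c d) (at (x t)) (\<xi> t))) (at t)"
proof -
  have x: "x t \<in> dom c d" by (rule dI_dom[OF t])
  have "((\<lambda>s. frechet_derivative (tr c d) (at (x s)) (\<xi> s)) has_vector_derivative
      hes c d (x t) (vector_derivative x (at t)) (\<xi> t) +
      frechet_derivative (tr c d) (at (x t)) (- conn \<Gamma> c (x t) (vector_derivative x (at t)) (\<xi> t))) (at t)"
    unfolding hes_def
    by (rule curve_frechet_apply[OF tr_smooth[OF c d] dom_open[OF c d] dI_open[OF d] t dI_dom
          curve_derivative_works[OF dI_I[OF t]] \<xi>])
  moreover have "frechet_derivative (tr c d) (at (x t)) (- conn \<Gamma> c (x t) (vector_derivative x (at t)) (\<xi> t)) =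
      - (hes c d (x t) (vector_derivative x (at t)) (\<xi> t) +
         conn \<Gamma> d (tr c d (x t)) (velocity (pt c \<circ> x) d t) (frechet_derivative (tr c d) (at (x t)) (\<xi> t)))"
    unfolding linear_neg[OF has_derivative_linear[OF tr_derivative[OF c d x]]] curve_velocity[OF d t]
      law[unfolded conn_law_def, rule_format, OF c d x] ..
  ultimately show ?thesis by simp
qed

lemma curve_parallel:
  assumes law: "conn_law \<Gamma>"
    and \<xi>: "\<And>t. t \<in> I \<Longrightarrow> (\<xi> has_vector_derivative - conn \<Gamma> c (x t) (vector_derivative x (at t)) (\<xi> t)) (at t)"
  shows "parallel_along A \<Gamma> (pt c \<circ> x) I (\<lambda>t. tvec A c (pt c (x t)) (\<xi> t))"
  unfolding parallel_along_def
proof (intro conjI ballI impI)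
  show "tvec A c (pt c (x t)) (\<xi> t) \<in> tangent_space A ((pt c \<circ> x) t)" if "t \<in> I" for t
    using xI that by (auto intro!: tvec_tangent c pt_source)
  fix d t assume d: "d \<in> A" and tI: "t \<in> I" and "(pt c \<circ> x) t \<in> source d"
  then have t: "t \<in> dI d" by (simp add: dI_def)
  have eq: "frechet_derivative (tr c d) (at (x s)) (\<xi> s) = tvec A c (pt c (x s)) (\<xi> s) d" if "s \<in> dI d" for s
    using that d by (simp add: tvec_def jac_app[OF c d dI_dom[OF that]]) (simp add: dI_def)
  have "((\<lambda>s. tvec A c (pt c (x s)) (\<xi> s) d) has_vector_derivative
      - conn \<Gamma> d (tr c d (x t)) (velocity (pt c \<circ> x) d t) (tvec A c (pt c (x t)) (\<xi> t) d)) (at t)"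
    using has_vector_derivative_transform_within_open[OF curve_parallel_transfer[OF law d t \<xi>[OF tI]] dI_open[OF d] t eq]
    unfolding eq[OF t] .
  moreover have "- conn \<Gamma> d (tr c d (x t)) (velocity (pt c \<circ> x) d t) (tvec A c (pt c (x t)) (\<xi> t) d) =
      (\<chi> i. - (\<Sum>j\<in>UNIV. \<Sum>k\<in>UNIV. \<Gamma> ((pt c \<circ> x) t) d i j k * velocity (pt c \<circ> x) d t $ j * tvec A c (pt c (x t)) (\<xi> t) d $ k))"
    by (simp add: conn_def pt_tr[OF c d dI_dom[OF t]] vec_eq_iff)
  ultimately show "((\<lambda>s. tvec A c (pt c (x s)) (\<xi> s) d) has_vector_derivative
      (\<chi> i. - (\<Sum>j\<in>UNIV. \<Sum>k\<in>UNIV. \<Gamma> ((pt c \<circ> x) t) d i j k * velocity (pt c \<circ> x) d t $ j * tvec A c (pt c (x t)) (\<xi> t) d $ k))) (at t)"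
    by simp
qed

lemma curve_affine_geodesic:
  assumes law: "conn_law \<Gamma>"
    and geo: "\<And>t. t \<in> I \<Longrightarrow> ((\<lambda>t. vector_derivative x (at t)) has_vector_derivative
       - conn \<Gamma> c (x t) (vector_derivative x (at t)) (vector_derivative x (at t))) (at t)"
  shows "affine_geodesic A \<Gamma> (pt c \<circ> x) I"
  unfolding affine_geodesic_def
proof (intro conjI ballI impI curve_smooth)
  fix d t assume d: "d \<in> A" and tI: "t \<in> I" and "(pt c \<circ> x) t \<in> source d"
  then have t: "t \<in> dI d" by (simp add: dI_def)
  have "(velocity (pt c \<circ> x) d has_vector_derivative
      - conn \<Gamma> d (tr c d (x t)) (velocity (pt c \<circ> x) d t) (velocity (pt c \<circ> x) d t)) (at t)"
    using has_vector_derivative_transform_within_open[OF curve_parallel_transfer[OF law d t geo[OF tI]] dI_open[OF d] t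
        curve_velocity[OF d, symmetric]]
    unfolding curve_velocity[OF d t, symmetric] .
  moreover have "- conn \<Gamma> d (tr c d (x t)) (velocity (pt c \<circ> x) d t) (velocity (pt c \<circ> x) d t) =
      (\<chi> i. - (\<Sum>j\<in>UNIV. \<Sum>k\<in>UNIV. \<Gamma> ((pt c \<circ> x) t) d i j k * velocity (pt c \<circ> x) d t $ j * velocity (pt c \<circ> x) d t $ k))"
    by (simp add: conn_def pt_tr[OF c d dI_dom[OF t]] vec_eq_iff)
  ultimately show "(velocity (pt c \<circ> x) d has_vector_derivative
      (\<chi> i. - (\<Sum>j\<in>UNIV. \<Sum>k\<in>UNIV. \<Gamma> ((pt c \<circ> x) t) d i j k * velocity (pt c \<circ> x) d t $ j * velocity (pt c \<circ> x) d t $ k))) (at t)"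
    by simp
qed

end

end

lemma linear_axis_expand:
  fixes f :: "real^'n \<Rightarrow> 'b::real_vector"
  assumes "linear f"
  shows "f u = (\<Sum>k\<in>UNIV. u $ k *\<^sub>R f (axis k 1))"
proof -
  have "u = (\<Sum>k\<in>UNIV. u $ k *\<^sub>R axis k 1)"
    by (simp add: basis_expansion scalar_mult_eq_scaleR[symmetric])
  then have "f u = f (\<Sum>k\<in>UNIV. u $ k *\<^sub>R axis k 1)" by simp
  then show ?thesis by (simp add: linear_sum[OF assms] linear_cmul[OF assms])
qed

lemma matrix_bilinear_linear:
  fixes B :: "real^'n \<Rightarrow> real^'n \<Rightarrow> real^'n"
  assumes "bilinear B"
  shows "linear (\<lambda>u. matrix (B u))"
  by (rule linearI) (simp_all add: matrix_def vec_eq_iff bilinear_ladd[OF assms] bilinear_lmul[OF assms])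

lemma vector_derivative_cong_open:
  assumes "open S" "x \<in> S" "\<And>y. y \<in> S \<Longrightarrow> f y = g y"
  shows "vector_derivative f (at x) = vector_derivative g (at x)"
proof -
  have "(f has_vector_derivative D) (at x) \<longleftrightarrow> (g has_vector_derivative D) (at x)" for D
    using assms by (metis has_vector_derivative_transform_within_open)
  then show ?thesis unfolding vector_derivative_def by simp
qed

lemma inner_transpose: "u \<bullet> (transpose M *v v) = (M *v u) \<bullet> v" for M :: "real^'n^'n"
  by (metis dot_lmul_matrix transpose_matrix_vector transpose_transpose inner_commute)

lemma inner_compat:
  fixes M h :: "real^'n^'n"
  shows "w \<bullet> ((transpose M ** h + h ** M) *v v) = (M *v w) \<bullet> (h *v v) + w \<bullet> (h *v (M *v v))"
  unfolding matrix_vector_mult_add_rdistrib inner_add_right matrix_vector_mul_assoc[symmetric] inner_transpose ..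

section \<open>The Levi-Civita connection in charts\<close>

context smooth_mfd begin

lemma metric_smooth: "tensor02 A g \<Longrightarrow> c \<in> A \<Longrightarrow> smooth_on (target c) (\<lambda>x. g (pt c x) c)"
  by (simp add: tensor02_def)

lemma metric_sym:
  "symmetric_tensor A g \<Longrightarrow> c \<in> A \<Longrightarrow> x \<in> target c \<Longrightarrow> transpose (g (pt c x) c) = g (pt c x) c"
  using pt_source[of x c] unfolding symmetric_tensor_def by blast

lemma dmetric_eq:
  assumes "tensor02 A g" "c \<in> A" "x \<in> target c"
  shows "dmetric g (pt c x) c k i j = frechet_derivative (\<lambda>x. g (pt c x) c) (at x) (axis k 1) $ i $ j"
  unfolding dmetric_def coord_pt[OF assms(3)]
  by (rule partial_entry[OF smooth_on_derivative[OF metric_smooth[OF assms(1,2)] assms(3)]])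

lemma levi_civita_smooth:
  assumes g: "pseudo_riemannian_metric A g" and c: "c \<in> A"
  shows "smooth_on (target c) (\<lambda>x. levi_civita g (pt c x) c i j k)"
proof -
  note o = chart_open(2)[OF c]
  have t: "tensor02 A g" using g by (simp add: pseudo_riemannian_metric_def)
  have inv: "invertible (g (pt c x) c)" if "x \<in> target c" for x
    using g c pt_source[OF that] by (simp add: pseudo_riemannian_metric_def)
  have dm: "smooth_on (target c) (\<lambda>x. dmetric g (pt c x) c k i j)" for k i j
  proof -
    have "smooth_on (target c) (\<lambda>x. frechet_derivative (\<lambda>x. g (pt c x) c) (at x) (axis k 1) $ i $ j)"
      by (rule smooth_on_matrix_entries[OF smooth_on_frechet[OF metric_smooth[OF t c]] o])
    then show ?thesis
      by (rule smooth_on_cong[OF o, THEN iffD2, rotated]) (rule dmetric_eq[OF t c])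
  qed
  have "smooth_on (target c) (\<lambda>x. matrix_inv (g (pt c x) c) $ i $ l *
        (dmetric g (pt c x) c j l k + dmetric g (pt c x) c k l j - dmetric g (pt c x) c l j k))" for l
    by (rule smooth_on_mult[OF smooth_on_matrix_inv[OF smooth_on_matrix_entries[OF metric_smooth[OF t c] o] o inv]
          smooth_on_diff[OF smooth_on_add[OF dm dm o] dm o] o])
  then show ?thesis
    unfolding levi_civita_def
    by (intro smooth_on_divide[OF smooth_on_sum[OF _ o] smooth_on_const o]) auto
qed

lemma levi_civita_conn_sym:
  assumes "pseudo_riemannian_metric A g" "c \<in> A" "x \<in> target c"
  shows "conn (levi_civita g) c x u v = conn (levi_civita g) c x v u"
  by (rule conn_sym) (rule levi_civita_metric(1)[OF mfd assms(1,2) pt_source[OF assms(3)]])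

lemma levi_civita_compat:
  assumes g: "pseudo_riemannian_metric A g" and c: "c \<in> A" and x: "x \<in> target c"
  shows "frechet_derivative (\<lambda>x. g (pt c x) c) (at x) u =
    transpose (matrix (conn (levi_civita g) c x u)) ** g (pt c x) c +
    g (pt c x) c ** matrix (conn (levi_civita g) c x u)"
proof -
  let ?h = "g (pt c x) c" and ?D = "frechet_derivative (\<lambda>x. g (pt c x) c) (at x)"
  let ?M = "\<lambda>u. matrix (conn (levi_civita g) c x u)"
  let ?R = "\<lambda>u. transpose (?M u) ** ?h + ?h ** ?M u"
  have t: "tensor02 A g" using g by (simp add: pseudo_riemannian_metric_def)
  have lD: "linear ?D" by (rule smooth_on_linear_frechet[OF metric_smooth[OF t c] x])
  have lM: "linear ?M" by (rule matrix_bilinear_linear[OF conn_bilinear])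
  note lT = bounded_linear.linear[OF bounded_linear_transpose]
  have lR: "linear ?R"
    by (rule linearI)
      (simp_all add: linear_add[OF lM] linear_cmul[OF lM] linear_add[OF lT] linear_cmul[OF lT] matrix_mult_linear scaleR_add_right)
  have "?D (axis k 1) = ?R (axis k 1)" for k
  proof -
    have M: "?M (axis k 1) $ l $ i = levi_civita g (pt c x) c l k i" for l i
      by (simp add: matrix_def conn_axis)
    have "?D (axis k 1) $ i $ j = ?R (axis k 1) $ i $ j" for i j
    proof -
      have "?D (axis k 1) $ i $ j = dmetric g (pt c x) c k i j" by (simp add: dmetric_eq[OF t c x])
      also have "\<dots> = (\<Sum>l\<in>UNIV. ?h $ l $ j * levi_civita g (pt c x) c l k i) +
          (\<Sum>l\<in>UNIV. ?h $ i $ l * levi_civita g (pt c x) c l k j)"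
        by (rule levi_civita_metric(2)[OF mfd g c pt_source[OF x]])
      also have "\<dots> = ?R (axis k 1) $ i $ j"
        by (simp add: matrix_matrix_mult_def transpose_def M mult.commute)
      finally show ?thesis .
    qed
    then show ?thesis by (simp add: vec_eq_iff)
  qed
  then show ?thesis
    using linear_axis_expand[OF lD, of u] linear_axis_expand[OF lR, of u] by simp
qed

lemma metric_transform:
  assumes "tensor02 A g" "c \<in> A" "d \<in> A" "x \<in> dom c d"
  shows "w \<bullet> (g (pt c x) c *v v) =
    frechet_derivative (tr c d) (at x) w \<bullet> (g (pt d (tr c d x)) d *v frechet_derivative (tr c d) (at x) v)"
proof -
  let ?J = "jac c d (pt c x)"
  have p: "pt c x \<in> source c \<inter> source d" using assms(2,4) by (simp add: dom_iff pt_source)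
  have "g (pt c x) c = transpose ?J ** g (pt c x) d ** ?J"
    using assms(1-3) p unfolding tensor02_def by blast
  then have "w \<bullet> (g (pt c x) c *v v) = w \<bullet> (transpose ?J *v (g (pt c x) d *v (?J *v v)))"
    by (simp add: matrix_vector_mul_assoc matrix_mul_assoc)
  also have "\<dots> = (?J *v w) \<bullet> (g (pt c x) d *v (?J *v v))"
    by (rule inner_transpose)
  finally show ?thesis by (simp add: jac_app[OF assms(2-4)] pt_tr[OF assms(2-4)])
qed

lemma matrix_conn: "matrix (conn \<Gamma> c x u) *v v = conn \<Gamma> c x u v"
  using conn_bilinear[of \<Gamma> c x] by (simp add: matrix_works bilinear_def)

text \<open>The defect \<open>E\<close> of the transformation law is symmetric, while compatibility with the metric makes
  \<open>g(E(u, v), J w)\<close> skew in \<open>v\<close>, \<open>w\<close>; so it vanishes.\<close>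

lemma levi_civita_law:
  assumes g: "pseudo_riemannian_metric A g"
  shows "conn_law (levi_civita g)"
  unfolding conn_law_def
proof (intro ballI allI)
  fix c d x u v assume c: "c \<in> A" and d: "d \<in> A" and x: "x \<in> dom c d"
  let ?J = "frechet_derivative (tr c d) (at x)" and ?y = "tr c d x"
  let ?D = "conn (levi_civita g) c x" and ?D' = "conn (levi_civita g) d ?y"
  let ?h = "g (pt c x) c" and ?h' = "g (pt d ?y) d"
  have t: "tensor02 A g" and s: "symmetric_tensor A g" using g by (auto simp: pseudo_riemannian_metric_def)
  have xt: "x \<in> target c" by (rule dom_target[OF x])
  have yt: "?y \<in> target d" by (rule tr_target[OF c d x])
  define E where "E u v = ?J (?D u v) - hes c d x u v - ?D' (?J u) (?J v)" for u v
  define K where "K u v w = E u v \<bullet> (?h' *v ?J w)" for u v w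
  have symh: "a \<bullet> (?h' *v b) = b \<bullet> (?h' *v a)" for a b
    by (rule symmetric_matrix_inner[OF metric_sym[OF s d yt]])
  have skew: "K u w v = - K u v w" for u v w
  proof -
    have dh: "((\<lambda>x. g (pt c x) c) has_derivative frechet_derivative (\<lambda>x. g (pt c x) c) (at x)) (at x)"
      by (rule smooth_on_derivative[OF metric_smooth[OF t c] xt])
    have "((\<lambda>z. w \<bullet> (g (pt c z) c *v v)) has_derivative
        (\<lambda>u. w \<bullet> (frechet_derivative (\<lambda>x. g (pt c x) c) (at x) u *v v))) (at x)"
      by (rule bounded_linear.has_derivative[OF bounded_linear_inner_right
            bounded_linear.has_derivative[OF bounded_bilinear.bounded_linear_left[OF bounded_bilinear_matrix_vector_mult] dh]])
    then have 1: "((\<lambda>z. frechet_derivative (tr c d) (at z) w \<bullet> (g (pt d (tr c d z)) d *v frechet_derivative (tr c d) (at z) v))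
        has_derivative (\<lambda>u. w \<bullet> (frechet_derivative (\<lambda>x. g (pt c x) c) (at x) u *v v))) (at x)"
      by (rule has_derivative_transform_within_open[OF _ dom_open[OF c d] x]) (rule metric_transform[OF t c d])
    let ?D'h = "frechet_derivative (\<lambda>x. g (pt d x) d) (at ?y)"
    have dh': "((\<lambda>z. g (pt d (tr c d z)) d) has_derivative (\<lambda>u. ?D'h (?J u))) (at x)"
      by (rule has_derivative_compose[OF tr_derivative[OF c d x] smooth_on_derivative[OF metric_smooth[OF t d] yt]])
    have 2: "((\<lambda>z. frechet_derivative (tr c d) (at z) w \<bullet> (g (pt d (tr c d z)) d *v frechet_derivative (tr c d) (at z) v))
        has_derivative (\<lambda>u. ?J w \<bullet> (?h' *v hes c d x u v + ?D'h (?J u) *v ?J v) + hes c d x u w \<bullet> (?h' *v ?J v))) (at x)"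
      by (rule has_derivative_inner[OF hes_derivative[OF c d x]
            bounded_bilinear.FDERIV[OF bounded_bilinear_matrix_vector_mult dh' hes_derivative[OF c d x]]])
    from fun_cong[OF has_derivative_unique[OF 1 2], of u]
    have eq: "w \<bullet> (frechet_derivative (\<lambda>x. g (pt c x) c) (at x) u *v v) =
        ?J w \<bullet> (?h' *v hes c d x u v + ?D'h (?J u) *v ?J v) + hes c d x u w \<bullet> (?h' *v ?J v)" .
    have l: "w \<bullet> (frechet_derivative (\<lambda>x. g (pt c x) c) (at x) u *v v) =
        ?J (?D u w) \<bullet> (?h' *v ?J v) + ?J w \<bullet> (?h' *v ?J (?D u v))"
    proof -
      have "w \<bullet> (frechet_derivative (\<lambda>x. g (pt c x) c) (at x) u *v v) =
          ?D u w \<bullet> (?h *v v) + w \<bullet> (?h *v ?D u v)"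
        unfolding levi_civita_compat[OF g c xt] inner_compat matrix_conn ..
      then show ?thesis by (simp only: metric_transform[OF t c d x])
    qed
    have r: "?J w \<bullet> (?D'h (?J u) *v ?J v) = ?D' (?J u) (?J w) \<bullet> (?h' *v ?J v) + ?J w \<bullet> (?h' *v ?D' (?J u) (?J v))"
      unfolding levi_civita_compat[OF g d yt] inner_compat matrix_conn ..
    have "K u w v + ?J w \<bullet> (?h' *v E u v) = 0"
      using eq unfolding l inner_add_right r
      by (simp add: K_def E_def inner_diff_left matrix_vector_mult_diff_distrib inner_diff_right)
    then show ?thesis unfolding K_def using symh[of "?J w" "E u v"] by simp
  qed
  have sym: "K u v w = K v u w" for u v w
    unfolding K_def E_def using levi_civita_conn_sym[OF g c xt, of u v] levi_civita_conn_sym[OF g d yt, of "?J u" "?J v"]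
      hes_sym[OF c d x, of u v] by simp
  \<comment> \<open>Symmetry in the first two arguments and skewness in the last two, applied
    alternately three times each, lead back to K u v w with the opposite sign.\<close>
  have K0: "K u v w = 0" for u v w
  proof -
    have "K u v w = - K u w v" by (rule skew)
    also have "\<dots> = - K w u v" by (simp add: sym[of u w])
    also have "\<dots> = K w v u" by (simp add: skew[of w u v])
    also have "\<dots> = K v w u" by (rule sym)
    also have "\<dots> = - K v u w" by (rule skew)
    also have "\<dots> = - K u v w" by (simp add: sym[of v u])
    finally show ?thesis by simp
  qed
  have px: "pt c x \<in> source c" "pt c x \<in> source d" using x c by (simp_all add: dom_iff pt_source)
  have "invertible ?h'" using g d pt_source[OF yt] by (simp add: pseudo_riemannian_metric_def)
  moreover have "invertible (jac c d (pt c x))" using jac_det[OF c d px] invertible_det_nz by blast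
  \<comment> \<open>Every vector e has the form h' J w, in particular e = E(u,v); the vanishing of K
    then gives E(u,v) length 0.\<close>
  ultimately have "?h' *v ?J (matrix_inv (jac c d (pt c x)) *v (matrix_inv ?h' *v e)) = e" for e
    by (simp add: jac_app[OF c d x, symmetric] matrix_vector_mul_assoc matrix_mul_assoc matrix_inv_right
        matrix_mul_assoc[of _ "jac c d (pt c x)", symmetric])
  then have "E u v \<bullet> E u v = 0" using K0[of u v] unfolding K_def by metis
  then have "E u v = 0" by (simp only: inner_eq_zero_iff)
  then show "?J (?D u v) = hes c d x u v + ?D' (?J u) (?J v)" unfolding E_def by (simp add: algebra_simps)
qed

end

lemma (in local_berwald) partial_velocity:
  assumes "x \<in> U" "v \<noteq> 0"
  shows "partial i (\<lambda>v. (F x v)\<^sup>2 / 2) v = dL (x, v) (0, axis i 1)"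
proof -
  have "((\<lambda>v. L (x, v)) has_derivative (\<lambda>h. dL (x, v) (0, h))) (at v)"
    by (rule has_derivative_compose[OF section_derivative dL]) (use assms in auto)
  from frechet_derivative_eqI[OF this] show ?thesis by (simp add: partial_def L_def)
qed

lemma (in local_berwald) partial_position:
  assumes "x \<in> U" "v \<noteq> 0"
  shows "partial i (\<lambda>x. (F x v)\<^sup>2 / 2) x = dL (x, v) (axis i 1, 0)"
proof -
  have "((\<lambda>x. L (x, v)) has_derivative (\<lambda>h. dL (x, v) (h, 0))) (at x)"
    by (rule has_derivative_compose[OF section_derivative' dL]) (use assms in auto)
  from frechet_derivative_eqI[OF this] show ?thesis by (simp add: partial_def L_def)
qed

section \<open>Each chart provides an instance of the local models\<close>

context smooth_mfd begin

lemma berwald_chart: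
  assumes F: "finsler_metric A F" and \<Gamma>: "associated_connection A F \<Gamma>" and c: "c \<in> A"
  shows "local_berwald (target c) (in_coord A F c) (conn \<Gamma> c)"
proof
  have aff: "affine_connection A \<Gamma>" and sym: "\<forall>p\<in>source c. \<forall>i j k. \<Gamma> p c i j k = \<Gamma> p c i k j"
    and tp: "transport_preserves A \<Gamma> F"
    using \<Gamma> c by (auto simp: associated_connection_def symmetric_connection_def)
  have Fp: "F p \<xi> \<ge> 0" "r \<ge> 0 \<Longrightarrow> F p (\<lambda>c. r *\<^sub>R \<xi> c) = r * F p \<xi>" "F p \<xi> = 0 \<Longrightarrow> \<xi> = (\<lambda>c. 0)"
    if "\<xi> \<in> tangent_space A p" for p \<xi> r
    using F that unfolding finsler_metric_def by blast+
  show "open (target c)" by (rule chart_open(2)[OF c])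
  show "smooth_on (target c \<times> - {0}) (\<lambda>(x, v). in_coord A F c x v)"
    using F c unfolding finsler_metric_def by blast
  show "in_coord A F c x (r *\<^sub>R v) = r * in_coord A F c x v" if "x \<in> target c" "0 \<le> r" for x r v
    using Fp(2)[OF tvec_tangent[OF c pt_source[OF that(1)]] that(2)] by (simp add: in_coord_def tvec_scaleR)
  show "0 < in_coord A F c x v" if x: "x \<in> target c" and v: "v \<noteq> 0" for x v
  proof -
    note T = tvec_tangent[OF c pt_source[OF x], of v]
    have "in_coord A F c x v \<noteq> 0"
    proof
      assume "in_coord A F c x v = 0"
      then have "tvec A c (pt c x) v = (\<lambda>c. 0)" unfolding in_coord_def by (rule Fp(3)[OF T])
      from fun_cong[OF this, of c] show False using v tvec_self[OF c pt_source[OF x], of v] by simp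
    qed
    then show ?thesis using Fp(1)[OF T] by (simp add: in_coord_def)
  qed
  show "smooth_on (target c) (\<lambda>x. conn \<Gamma> c x u v)" for u v
    by (rule conn_smooth[OF c]) (use aff c in \<open>auto simp: affine_connection_def\<close>)
  show "bilinear (conn \<Gamma> c x)" for x by (rule conn_bilinear)
  show "conn \<Gamma> c x u v = conn \<Gamma> c x v u" if "x \<in> target c" for x u v
    by (rule conn_sym) (use sym pt_source[OF that] in blast)
  fix I x \<xi> s t
  assume I: "open_interval I" and x: "smooth_on I x" "x ` I \<subseteq> target c"
    and \<xi>: "\<And>t. t \<in> I \<Longrightarrow> (\<xi> has_vector_derivative - conn \<Gamma> c (x t) (vector_derivative x (at t)) (\<xi> t)) (at t)"
    and s: "s \<in> I" and t: "t \<in> I"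
  have "parallel_along A \<Gamma> (pt c \<circ> x) I (\<lambda>t. tvec A c (pt c (x t)) (\<xi> t))"
    by (rule curve_parallel[OF c I x affine_connection_law[OF aff] \<xi>])
  with curve_smooth[OF c I x] s t tp
  have "F ((pt c \<circ> x) s) (tvec A c (pt c (x s)) (\<xi> s)) = F ((pt c \<circ> x) t) (tvec A c (pt c (x t)) (\<xi> t))"
    unfolding transport_preserves_def by blast
  then show "in_coord A F c (x s) (\<xi> s) = in_coord A F c (x t) (\<xi> t)"
    by (simp add: in_coord_def)
qed

text \<open>A coordinate solution of the geodesic equation lifts to a curve that satisfies it in
  every overlapping chart, because the Levi-Civita symbols obey \<open>conn_law\<close>. The lift is
  therefore a geodesic of g, and the equivalence can be applied to it.\<close>

lemma equiv_chart:
  assumes n: "CARD('n) \<ge> 2" and F: "finsler_metric A F" and \<Gamma>: "associated_connection A F \<Gamma>"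
    and g: "pseudo_riemannian_metric A g" and eq: "geodesically_equivalent A g F" and c: "c \<in> A"
  shows "local_equiv (target c) (in_coord A F c) (conn \<Gamma> c) (\<lambda>x. g (pt c x) c) (conn (levi_civita g) c)"
proof -
  interpret b: local_berwald "target c" "in_coord A F c" "conn \<Gamma> c" by (rule berwald_chart[OF F \<Gamma> c])
  show ?thesis
  proof
    show "2 \<le> CARD('n)" by (rule n)
    show "smooth_on (target c) (\<lambda>x. g (pt c x) c)"
      by (rule metric_smooth[OF _ c]) (use g in \<open>simp add: pseudo_riemannian_metric_def\<close>)
    show "transpose (g (pt c x) c) = g (pt c x) c" if "x \<in> target c" for x
      by (rule metric_sym[OF _ c that]) (use g in \<open>simp add: pseudo_riemannian_metric_def\<close>)
    show "invertible (g (pt c x) c)" if "x \<in> target c" for x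
      using g c pt_source[OF that] by (simp add: pseudo_riemannian_metric_def)
    show "smooth_on (target c) (\<lambda>x. conn (levi_civita g) c x u v)" for u v
      by (rule conn_smooth[where \<Gamma>="levi_civita g", OF c levi_civita_smooth[OF g c]])
    show "bilinear (conn (levi_civita g) c x)" for x by (rule conn_bilinear)
    show "conn (levi_civita g) c x u v = conn (levi_civita g) c x v u" if "x \<in> target c" for x u v
      by (rule levi_civita_conn_sym[OF g c that])
    show "frechet_derivative (\<lambda>x. g (pt c x) c) (at x) u =
        transpose (matrix (conn (levi_civita g) c x u)) ** g (pt c x) c +
        g (pt c x) c ** matrix (conn (levi_civita g) c x u)" if "x \<in> target c" for x u
      by (rule levi_civita_compat[OF g c that])
    fix I and y :: "real \<Rightarrow> real^'n"
    assume I: "open_interval I" and y: "smooth_on I y" "y ` I \<subseteq> target c"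
      and geo: "\<And>t. t \<in> I \<Longrightarrow> ((\<lambda>t. vector_derivative y (at t)) has_vector_derivative
         - conn (levi_civita g) c (y t) (vector_derivative y (at t)) (vector_derivative y (at t))) (at t)"
      and nz: "\<exists>t\<in>I. vector_derivative y (at t) \<noteq> 0"
    let ?\<gamma> = "pt c \<circ> y"
    have oI: "open I" using I by (simp add: open_interval_def)
    have "affine_geodesic A (levi_civita g) ?\<gamma> I"
      by (rule curve_affine_geodesic[OF c I y levi_civita_law[OF g] geo])
    moreover have "\<not> (\<exists>p. \<forall>t\<in>I. ?\<gamma> t = p)"
    proof
      assume "\<exists>p. \<forall>t\<in>I. ?\<gamma> t = p"
      then obtain p where p: "\<And>t. t \<in> I \<Longrightarrow> pt c (y t) = p" by auto
      have yp: "y t = coord c p" if "t \<in> I" for t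
        using p[OF that] coord_pt[of "y t" c] y(2) that by auto
      have "vector_derivative y (at t) = 0" if "t \<in> I" for t
        using vector_derivative_cong_open[OF oI that, of y "\<lambda>_. coord c p"] yp by simp
      then show False using nz by blast
    qed
    ultimately have "metric_geodesic A g ?\<gamma> I" by (simp add: metric_geodesic_def)
    then have "unparam_finsler_geodesic A F ?\<gamma> I" using eq unfolding geodesically_equivalent_def by blast
    then obtain J \<tau> where J: "open_interval J" "smooth_on J \<tau>" "\<forall>t\<in>J. deriv \<tau> t > 0" "\<tau> ` J = I"
      and fg: "finsler_geodesic A F (?\<gamma> \<circ> \<tau>) J"
      unfolding unparam_finsler_geodesic_def by blast
    have oJ: "open J" using J by (simp add: open_interval_def)
    have yU: "y (\<tau> s) \<in> target c" if "s \<in> J" for s using that J y by blast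
    have co: "(coord c \<circ> (?\<gamma> \<circ> \<tau>)) s = (y \<circ> \<tau>) s" if "s \<in> J" for s
      using coord_pt[OF yU[OF that]] by simp
    have vel: "velocity (?\<gamma> \<circ> \<tau>) c s = vector_derivative (y \<circ> \<tau>) (at s)" if "s \<in> J" for s
      unfolding velocity_def by (rule vector_derivative_cong_open[OF oJ that co])
    have EL: "velocity (?\<gamma> \<circ> \<tau>) c s \<noteq> 0 \<and>
        (\<forall>i. ((\<lambda>s. partial i (\<lambda>v. lagrangian A F c (coord c ((?\<gamma> \<circ> \<tau>) s)) v) (velocity (?\<gamma> \<circ> \<tau>) c s))
               has_real_derivative
               partial i (\<lambda>x. lagrangian A F c x (velocity (?\<gamma> \<circ> \<tau>) c s)) (coord c ((?\<gamma> \<circ> \<tau>) s))) (at s))"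
      if s: "s \<in> J" for s
    proof -
      have "(?\<gamma> \<circ> \<tau>) s \<in> source c" using pt_source[OF yU[OF s]] by simp
      then show ?thesis using fg c s unfolding finsler_geodesic_def by blast
    qed
    have cs: "coord c ((?\<gamma> \<circ> \<tau>) s) = y (\<tau> s)" if "s \<in> J" for s using co[OF that] by simp
    have nz': "vector_derivative (y \<circ> \<tau>) (at s) \<noteq> 0" if "s \<in> J" for s
      using EL[OF that] vel[OF that] by simp
    have "((\<lambda>s. b.dL (y (\<tau> s), vector_derivative (y \<circ> \<tau>) (at s)) (0, axis i 1)) has_real_derivative
        b.dL (y (\<tau> s), vector_derivative (y \<circ> \<tau>) (at s)) (axis i 1, 0)) (at s)" if s: "s \<in> J" for s i
    proof -
      have "partial i (\<lambda>x. lagrangian A F c x (velocity (?\<gamma> \<circ> \<tau>) c s)) (coord c ((?\<gamma> \<circ> \<tau>) s)) =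
          b.dL (y (\<tau> s), vector_derivative (y \<circ> \<tau>) (at s)) (axis i 1, 0)"
        unfolding cs[OF s] vel[OF s] lagrangian_def by (rule b.partial_position[OF yU[OF s] nz'[OF s]])
      moreover have "((\<lambda>s. partial i (\<lambda>v. lagrangian A F c (coord c ((?\<gamma> \<circ> \<tau>) s)) v) (velocity (?\<gamma> \<circ> \<tau>) c s))
               has_real_derivative
               partial i (\<lambda>x. lagrangian A F c x (velocity (?\<gamma> \<circ> \<tau>) c s)) (coord c ((?\<gamma> \<circ> \<tau>) s))) (at s)"
        using EL[OF s] by blast
      ultimately have 1: "((\<lambda>s. partial i (\<lambda>v. lagrangian A F c (coord c ((?\<gamma> \<circ> \<tau>) s)) v) (velocity (?\<gamma> \<circ> \<tau>) c s))
               has_real_derivative b.dL (y (\<tau> s), vector_derivative (y \<circ> \<tau>) (at s)) (axis i 1, 0)) (at s)"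
        by (simp only:)
      have 2: "partial i (\<lambda>v. lagrangian A F c (coord c ((?\<gamma> \<circ> \<tau>) s)) v) (velocity (?\<gamma> \<circ> \<tau>) c s) =
          b.dL (y (\<tau> s), vector_derivative (y \<circ> \<tau>) (at s)) (0, axis i 1)" if "s \<in> J" for s
        unfolding cs[OF that] vel[OF that] lagrangian_def by (rule b.partial_velocity[OF yU[OF that] nz'[OF that]])
      show ?thesis
        unfolding has_field_derivative_def
        by (rule has_derivative_transform_within_open[OF 1[unfolded has_field_derivative_def] oJ s 2])
    qed
    with J nz' show "\<exists>J \<tau>. open_interval J \<and> smooth_on J \<tau> \<and> (\<forall>t\<in>J. deriv \<tau> t > 0) \<and> \<tau> ` J = I \<and>
        (\<forall>s\<in>J. vector_derivative (y \<circ> \<tau>) (at s) \<noteq> 0 \<and>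
          (\<forall>i. ((\<lambda>s. b.dL (y (\<tau> s), vector_derivative (y \<circ> \<tau>) (at s)) (0, axis i 1)) has_real_derivative
             b.dL (y (\<tau> s), vector_derivative (y \<circ> \<tau>) (at s)) (axis i 1, 0)) (at s)))"
      by (intro exI[of _ J] exI[of _ \<tau>]) simp
  qed
qed

end

subsection \<open>Quadratic gauges\<close>

text \<open>The Gram matrix that polarization would give if the square of f were quadratic. It uses
  f only at coordinate vectors and their sums, which are nonzero, so it inherits smooth dependence
  on parameters from f.\<close>

definition polar :: "(real^'n \<Rightarrow> real) \<Rightarrow> real^'n^'n" where
  "polar f = (\<chi> i j. ((f (axis i 1 + axis j 1))\<^sup>2 - (f (axis i 1))\<^sup>2 - (f (axis j 1))\<^sup>2) / 2)"

lemma polar_sym: "transpose (polar f) = polar f"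
  by (simp add: polar_def transpose_def vec_eq_iff add.commute)

lemma quadratic_polar:
  assumes "quadratic f"
  shows "(f v)\<^sup>2 = v \<bullet> (polar f *v v)"
proof -
  obtain Q where Q: "\<And>v. (f v)\<^sup>2 = v \<bullet> (Q *v v)" using assms unfolding quadratic_def by blast
  have e: "axis i 1 \<bullet> (Q *v axis j 1) = Q $ i $ j" for i j
    by (simp add: inner_axis' matrix_vector_mult_basis column_def)
  have "polar f = (1/2) *\<^sub>R (Q + transpose Q)"
    by (simp add: polar_def Q vec_eq_iff transpose_def matrix_vector_right_distrib inner_add_left inner_add_right e)
  then have "v \<bullet> (polar f *v v) = (v \<bullet> (Q *v v) + v \<bullet> (transpose Q *v v)) / 2"
    by (simp add: scaleR_matrix_vector_assoc[symmetric] matrix_vector_mult_add_rdistrib inner_add_right)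
  also have "\<dots> = (f v)\<^sup>2" unfolding inner_transpose Q by (simp add: inner_commute)
  finally show ?thesis by simp
qed

lemma symmetric_matrix_eqI:
  fixes S T :: "real^'n^'n"
  assumes S: "transpose S = S" and T: "transpose T = T" and eq: "\<And>v. v \<bullet> (S *v v) = v \<bullet> (T *v v)"
  shows "S = T"
proof -
  have "u \<bullet> (S *v v) = u \<bullet> (T *v v)" for u v
    using eq[of "u + v"] eq[of u] eq[of v] symmetric_matrix_inner[OF S, of v u] symmetric_matrix_inner[OF T, of v u]
    by (simp add: matrix_vector_right_distrib inner_add_left inner_add_right)
  then have "S *v v = T *v v" for v by (metis vector_eq_ldot)
  then show ?thesis by (simp add: matrix_eq)
qed

text \<open>Parallel transport conjugates nearby tangent norms by an invertible linear map, so being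
  quadratic is a locally constant property along the segment from x to y.\<close>

lemma (in local_berwald) quadratic_ball:
  assumes B: "ball x r \<subseteq> U" and y: "y \<in> ball x r"
  shows "quadratic (F x) \<longleftrightarrow> quadratic (F y)"
proof -
  let ?z = "\<lambda>t. x + t *\<^sub>R (y - x)"
  have zU: "?z t \<in> U" if t: "t \<in> {0..1}" for t
  proof -
    have "norm (t *\<^sub>R (y - x)) \<le> norm (y - x)" using t by (simp add: mult_left_le_one_le)
    also have "\<dots> < r" using y by (simp add: dist_norm norm_minus_commute)
    finally show ?thesis using B by (auto simp: dist_norm subset_iff)
  qed
  have "quadratic (F (?z 0)) = quadratic (F (?z 1))"
  proof (rule connected_local_const[of "{0..1::real}" 0 1 "\<lambda>t. quadratic (F (?z t))"])
    show "\<forall>a\<in>{0..1}. eventually (\<lambda>b. quadratic (F (?z a)) = quadratic (F (?z b))) (at a within {0..1})"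
    proof
      fix a :: real assume a: "a \<in> {0..1}"
      obtain d P where d: "d > 0" and inU: "\<And>t. \<bar>t\<bar> < d \<Longrightarrow> ?z a + t *\<^sub>R (y - x) \<in> U"
        and det: "\<And>t. \<bar>t\<bar> < d \<Longrightarrow> det (P t) \<noteq> 0"
        and FP: "\<And>t v. \<bar>t\<bar> < d \<Longrightarrow> F (?z a + t *\<^sub>R (y - x)) (P t *v v) = F (?z a) v"
        by (rule transport[OF zU[OF a], of "y - x"]) blast
      have "quadratic (F (?z a)) = quadratic (F (?z b))" if b: "\<bar>b - a\<bar> < d" for b
      proof -
        have zb: "?z b = ?z a + (b - a) *\<^sub>R (y - x)" by (simp add: algebra_simps)
        have FP': "F (?z b) (P (b - a) *v v) = F (?z a) v" for v unfolding zb by (rule FP[OF b])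
        have inv: "invertible (P (b - a))" using det[OF b] invertible_det_nz by blast
        have 1: "F (?z a) (matrix_inv (P (b - a)) *v v) = F (?z b) v" for v
          using FP'[of "matrix_inv (P (b - a)) *v v"] by (simp add: matrix_vector_mul_assoc matrix_inv_right[OF inv])
        have "det (P (b - a)) * det (matrix_inv (P (b - a))) = 1"
          using matrix_inv_right[OF inv] by (metis det_I det_mul)
        then have 2: "det (matrix_inv (P (b - a))) \<noteq> 0" by auto
        show ?thesis using quadratic_transform[of "P (b - a)" "F (?z b)" "F (?z a)", OF det[OF b] FP']
          quadratic_transform[of "matrix_inv (P (b - a))" "F (?z a)" "F (?z b)", OF 2 1] by blast
      qed
      then show "eventually (\<lambda>b. quadratic (F (?z a)) = quadratic (F (?z b))) (at a within {0..1})"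
        unfolding eventually_at using d by (intro exI[of _ d]) (auto simp: dist_real_def)
    qed
  qed auto
  then show ?thesis by simp
qed

subsection \<open>Gluing\<close>

text \<open>The two global conclusions rest on this: \<open>F\<close> is quadratic in all tangent
  spaces or in none, and the factor \<mu> is the same at all points.\<close>

lemma (in smooth_mfd) locally_constant:
  fixes f :: "'a \<Rightarrow> 'b"
  assumes conn: "connected (UNIV :: 'a set)"
    and f: "\<And>c x r y. c \<in> A \<Longrightarrow> ball x r \<subseteq> target c \<Longrightarrow> y \<in> ball x r \<Longrightarrow> f (pt c x) = f (pt c y)"
  shows "f p = f q"
proof (rule connected_local_const[OF conn UNIV_I UNIV_I], rule ballI)
  fix p
  obtain c where c: "c \<in> A" "p \<in> source c" by (rule chart_at)
  obtain r where r: "r > 0" "ball (coord c p) r \<subseteq> target c"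
    using chart_open(2)[OF c(1)] coord_target[OF c(2)] open_contains_ball by blast
  let ?V = "source c \<inter> coord c -` ball (coord c p) r"
  have "open ?V"
    by (rule continuous_open_preimage[OF coord_continuous[OF c(1)] chart_open(1)[OF c(1)] open_ball])
  moreover have "p \<in> ?V" using c r by simp
  moreover have "f p = f q" if "q \<in> ?V" for q
    using f[OF c(1) r(2), of "coord c q"] that by (simp add: pt_coord[OF c(1)] c(2))
  ultimately show "\<forall>\<^sub>F q in at p within UNIV. f p = f q"
    unfolding eventually_at_topological by blast
qed

locale global_equiv = smooth_mfd A
  for A :: "('a::{t2_space,second_countable_topology}, 'n::finite) chart set" +
  fixes F :: "('a, 'n) finsler" and \<Gamma> :: "('a, 'n) connection"
    and g :: "'a \<Rightarrow> ('a, 'n) chart \<Rightarrow> real^'n^'n"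
  assumes conn: "connected (UNIV :: 'a set)" and n: "CARD('n) \<ge> 2" and F: "finsler_metric A F"
    and \<Gamma>: "associated_connection A F \<Gamma>" and g: "pseudo_riemannian_metric A g"
    and eq: "geodesically_equivalent A g F"
begin

abbreviation "FF c \<equiv> in_coord A F c"
abbreviation "CC c \<equiv> conn \<Gamma> c"
abbreviation "HH c \<equiv> \<lambda>x. g (pt c x) c"
abbreviation "DD c \<equiv> conn (levi_civita g) c"

lemma ch: "c \<in> A \<Longrightarrow> local_equiv (target c) (FF c) (CC c) (HH c) (DD c)"
  by (rule equiv_chart[OF n F \<Gamma> g eq])

lemma cb: "c \<in> A \<Longrightarrow> local_berwald (target c) (FF c) (CC c)"
  by (rule berwald_chart[OF F \<Gamma>])

section \<open>Compatibility of the local solutions on overlaps of charts\<close>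

definition "lpsi c = local_equiv.\<psi> (FF c) (HH c)"
definition "lsol c = local_equiv.sol (FF c) (HH c)"
definition "lgrad c = local_equiv.grad (CC c) (DD c)"
definition "llam c = local_equiv.lam (FF c) (CC c) (HH c) (DD c)"

context
  fixes c d x
  assumes c: "c \<in> A" and d: "d \<in> A" and x: "x \<in> dom c d"
begin

abbreviation "JJ \<equiv> jac c d (pt c x)"

lemma xt: "x \<in> target c" and yt: "tr c d x \<in> target d"
  and px: "pt c x \<in> source c" "pt c x \<in> source d"
  using x c d by (auto simp: dom_iff pt_source tr_target)

lemma JJ: "det JJ \<noteq> 0"
  by (rule jac_det[OF c d px])

lemma FF_change: "FF d (tr c d x) (JJ *v v) = FF c x v"
  using in_coord_change[OF c d px, of F v] by (simp add: tr_def coord_pt[OF xt])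

lemma HH_change: "HH c x = transpose JJ ** HH d (tr c d x) ** JJ"
proof -
  have "tensor02 A g" using g by (simp add: pseudo_riemannian_metric_def)
  then have "g (pt c x) c = transpose JJ ** g (pt c x) d ** JJ"
    using c d px unfolding tensor02_def by blast
  then show ?thesis by (simp only: pt_tr[OF c d x])
qed

text \<open>Under a change of chart the square root of the metric determinant and
  \<open>maxdet\<close> are scaled by reciprocal powers of the Jacobian determinant, so the
  logarithms cancel.\<close>

lemma psi_change: "lpsi c x = lpsi d (tr c d x)"
proof -
  interpret c: local_equiv "target c" "FF c" "CC c" "HH c" "DD c" by (rule ch[OF c])
  interpret d: local_equiv "target d" "FF d" "CC d" "HH d" "DD d" by (rule ch[OF d])
  have h: "det (HH d (tr c d x)) \<noteq> 0" using d.hinv[OF yt] invertible_det_nz by blast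
  define j where "j = \<bar>det JJ\<bar>"
  have j: "j > 0" using JJ by (simp add: j_def)
  have "\<bar>det (HH c x)\<bar> = j * (\<bar>det (HH d (tr c d x))\<bar> * j)"
    unfolding j_def by (subst HH_change) (simp only: det_mul det_transpose abs_mult mult_ac)
  then have 1: "ln \<bar>det (HH c x)\<bar> = 2 * ln j + ln \<bar>det (HH d (tr c d x))\<bar>"
    using j h by (simp add: ln_mult)
  have "maxdet (FF d (tr c d x)) = j * maxdet (FF c x)"
    unfolding j_def by (rule maxdet_transform[OF c.gauge[OF xt] d.gauge[OF yt] JJ FF_change])
  then have 2: "ln (maxdet (FF d (tr c d x))) = ln j + ln (maxdet (FF c x))"
    using j gauge.maxdet_pos[OF c.gauge[OF xt]] by (simp add: ln_mult)
  show ?thesis unfolding lpsi_def c.\<psi>_def d.\<psi>_def 1 2 by (simp add: add_divide_distrib)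
qed

lemma sol_change: "lsol d (tr c d x) = JJ ** lsol c x ** transpose JJ"
proof -
  interpret c: local_equiv "target c" "FF c" "CC c" "HH c" "DD c" by (rule ch[OF c])
  interpret d: local_equiv "target d" "FF d" "CC d" "HH d" "DD d" by (rule ch[OF d])
  have iJ: "invertible JJ" using JJ invertible_det_nz by blast
  let ?Hc = "HH c x" and ?Hd = "HH d (tr c d x)"
  let ?X = "JJ ** matrix_inv ?Hc ** transpose JJ"
  have "?X ** ?Hd ** JJ = JJ ** matrix_inv ?Hc ** (transpose JJ ** ?Hd ** JJ)"
    by (simp add: matrix_mul_assoc)
  also have "\<dots> = JJ ** (matrix_inv ?Hc ** ?Hc)" by (simp add: HH_change[symmetric] matrix_mul_assoc)
  also have "\<dots> = JJ" by (simp add: matrix_inv_left[OF c.hinv[OF xt]])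
  finally have "?X ** ?Hd ** JJ ** matrix_inv JJ = JJ ** matrix_inv JJ" by simp
  then have "?X ** ?Hd = mat 1"
    by (simp add: matrix_mul_assoc[symmetric] matrix_inv_right[OF iJ])
  then have "?X ** ?Hd ** matrix_inv ?Hd = matrix_inv ?Hd" by simp
  then have "?X = matrix_inv ?Hd"
    by (simp add: matrix_mul_assoc[symmetric] matrix_inv_right[OF d.hinv[OF yt]])
  then show ?thesis
    using psi_change unfolding lsol_def c.sol_def d.sol_def lpsi_def by (simp add: matrix_mult_linear)
qed

end

text \<open>Differentiating the equality of the potentials makes \<phi> a covector field. This
  bypasses the traces of the connections, whose transformation involves second derivatives of the
  transition map.\<close>

lemma grad_change:
  assumes c: "c \<in> A" and d: "d \<in> A" and x: "x \<in> dom c d"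
  shows "lgrad c x = transpose (jac c d (pt c x)) *v lgrad d (tr c d x)"
proof -
  interpret c: local_equiv "target c" "FF c" "CC c" "HH c" "DD c" by (rule ch[OF c])
  interpret d: local_equiv "target d" "FF d" "CC d" "HH d" "DD d" by (rule ch[OF d])
  let ?J = "frechet_derivative (tr c d) (at x)"
  have 1: "(lpsi c has_derivative c.\<phi> x) (at x)" unfolding lpsi_def by (rule c.\<psi>_derivative[OF xt[OF c d x]])
  have "((\<lambda>x. lpsi d (tr c d x)) has_derivative (\<lambda>u. d.\<phi> (tr c d x) (?J u))) (at x)"
    by (rule has_derivative_compose[OF tr_derivative[OF c d x]])
      (simp only: lpsi_def, rule d.\<psi>_derivative[OF yt[OF c d x]])
  then have 2: "(lpsi c has_derivative (\<lambda>u. d.\<phi> (tr c d x) (?J u))) (at x)"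
    by (rule has_derivative_transform_within_open[OF _ dom_open[OF c d] x]) (rule psi_change[OF c d, symmetric])
  have "c.\<phi> x u = d.\<phi> (tr c d x) (?J u)" for u
    by (rule fun_cong[OF has_derivative_unique[OF 1 2]])
  then have "u \<bullet> lgrad c x = u \<bullet> (transpose (jac c d (pt c x)) *v lgrad d (tr c d x))" for u
    unfolding inner_transpose jac_app[OF c d x]
    by (simp add: lgrad_def c.grad[symmetric] d.grad[symmetric] inner_commute)
  then show ?thesis by (metis vector_eq_ldot)
qed

lemma lam_change:
  assumes c: "c \<in> A" and d: "d \<in> A" and x: "x \<in> dom c d"
  shows "llam d (tr c d x) = jac c d (pt c x) *v llam c x"
proof -
  interpret c: local_equiv "target c" "FF c" "CC c" "HH c" "DD c" by (rule ch[OF c])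
  interpret d: local_equiv "target d" "FF d" "CC d" "HH d" "DD d" by (rule ch[OF d])
  have l: "llam c x = - (lsol c x *v lgrad c x)" "llam d y = - (lsol d y *v lgrad d y)" for x y
    by (simp_all add: llam_def c.lam_def d.lam_def lsol_def lgrad_def)
  show ?thesis
    unfolding l sol_change[OF c d x] grad_change[OF c d x] linear_neg[OF matrix_vector_mul_linear]
      matrix_vector_mul_assoc matrix_mul_assoc ..
qed

definition "ga p c = lsol c (coord c p)"
text \<open>The value 0 for charts away from p is the convention built into
  \<open>tangent_space\<close>.\<close>

definition "gl p c = (if c \<in> A \<and> p \<in> source c then llam c (coord c p) else 0)"

lemma ga_chart: "x \<in> target c \<Longrightarrow> ga (pt c x) c = lsol c x"
  by (simp add: ga_def coord_pt)

lemma gl_chart: "c \<in> A \<Longrightarrow> x \<in> target c \<Longrightarrow> gl (pt c x) c = llam c x"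
  by (simp add: gl_def coord_pt pt_source)

lemma lsol_smooth: "c \<in> A \<Longrightarrow> smooth_on (target c) (lsol c)"
  unfolding lsol_def by (rule local_equiv.sol_smooth[OF ch])

lemma llam_smooth: "c \<in> A \<Longrightarrow> smooth_on (target c) (llam c)"
  unfolding llam_def by (rule local_equiv.lam_smooth[OF ch])

lemma coord_tr: "c \<in> A \<Longrightarrow> p \<in> source c \<Longrightarrow> tr c d (coord c p) = coord d p"
  by (simp add: tr_def pt_coord)

lemma ga_tensor: "tensor20 A ga"
  unfolding tensor20_def
proof (intro conjI ballI)
  fix c d p assume c: "c \<in> A" and d: "d \<in> A" and p: "p \<in> source c \<inter> source d"
  show "ga p d = jac c d p ** ga p c ** transpose (jac c d p)"
    using sol_change[OF c d dom_coord, of p] p c by (simp add: ga_def coord_tr pt_coord)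
next
  fix c assume c: "c \<in> A"
  show "smooth_on (target c) (\<lambda>x. ga (pt c x) c)"
    by (rule smooth_on_cong[OF chart_open(2)[OF c] ga_chart, THEN iffD2]) (use lsol_smooth[OF c] in auto)
qed

lemma ga_symmetric: "symmetric_tensor A ga"
  unfolding symmetric_tensor_def ga_def lsol_def
  using local_equiv.sol_sym[OF ch coord_target] by blast

lemma gl_vector: "vector_field A gl"
  unfolding vector_field_def
proof (intro conjI allI ballI)
  fix p
  have "gl p d = jac c d p *v gl p c" if "c \<in> A" "d \<in> A" "p \<in> source c \<inter> source d" for c d
    using lam_change[OF that(1,2) dom_coord, of p] that by (simp add: gl_def coord_tr pt_coord)
  then show "gl p \<in> tangent_space A p"
    unfolding tangent_space_def mem_Collect_eq by (intro conjI ballI impI allI) (auto simp only: gl_def if_False)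
next
  fix c assume c: "c \<in> A"
  show "smooth_on (target c) (\<lambda>x. gl (pt c x) c)"
    by (rule smooth_on_cong[OF chart_open(2)[OF c] gl_chart[OF c], THEN iffD2]) (use llam_smooth[OF c] in auto)
qed

lemma cov_ga:
  assumes c: "c \<in> A" and p: "p \<in> source c"
  shows "cov_tensor20 \<Gamma> ga p c i j k =
    gl p c $ i * (if j = k then 1 else 0) + gl p c $ j * (if i = k then 1 else 0)"
proof -
  interpret c: local_equiv "target c" "FF c" "CC c" "HH c" "DD c" by (rule ch[OF c])
  let ?x = "coord c p"
  have x: "?x \<in> target c" and px: "pt c ?x = p" using c p by (auto simp: pt_coord)
  have d: "(lsol c has_derivative frechet_derivative (lsol c) (at ?x)) (at ?x)"
    by (rule smooth_on_derivative[OF lsol_smooth[OF c] x])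
  have "partial k (\<lambda>x. ga (pt c x) c $ i $ j) ?x = partial k (\<lambda>x. lsol c x $ i $ j) ?x"
    by (rule partial_cong[OF chart_open(2)[OF c] x]) (simp add: ga_chart)
  also have "\<dots> = frechet_derivative (lsol c) (at ?x) (axis k 1) $ i $ j" by (rule partial_entry[OF d])
  also have "\<dots> = (outer (llam c ?x) (axis k 1) + outer (axis k 1) (llam c ?x) -
      c.Cm ?x (axis k 1) ** lsol c ?x - lsol c ?x ** transpose (c.Cm ?x (axis k 1))) $ i $ j"
    using c.sol_derivative[OF x, of "axis k 1"] by (simp add: lsol_def llam_def)
  finally have P: "partial k (\<lambda>x. ga (pt c x) c $ i $ j) ?x = \<dots>" .
  have Cm: "c.Cm ?x (axis k 1) $ i $ s = \<Gamma> p c i k s" for i s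
    by (simp add: c.Cm_def matrix_def conn_axis px)
  have ax: "axis k 1 $ j = (if j = k then 1 else 0 :: real)" for j by (simp add: axis_def)
  show ?thesis
    unfolding cov_tensor20_def P
    using c p by (simp add: matrix_matrix_mult_def transpose_def Cm outer_def ga_def gl_def ax mult.commute)
qed

lemma cov_gl:
  assumes c: "c \<in> A" and p: "p \<in> source c"
  shows "cov_vec \<Gamma> gl p c i j =
    (frechet_derivative (llam c) (at (coord c p)) (axis j 1) + CC c (coord c p) (axis j 1) (llam c (coord c p))) $ i"
proof -
  let ?x = "coord c p"
  have x: "?x \<in> target c" and px: "pt c ?x = p" using c p by (auto simp: pt_coord)
  have "partial j (\<lambda>x. gl (pt c x) c $ i) ?x = partial j (\<lambda>x. llam c x $ i) ?x"
    by (rule partial_cong[OF chart_open(2)[OF c] x]) (simp add: gl_chart[OF c])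
  also have "\<dots> = frechet_derivative (llam c) (at ?x) (axis j 1) $ i"
    by (rule partial_component[OF smooth_on_derivative[OF llam_smooth[OF c] x]])
  finally show ?thesis
    using c p by (simp add: cov_vec_def conn_axis_left px gl_def)
qed

section \<open>Quadratic tangent norms and the Riemannian case\<close>

lemma quadratic_change:
  assumes c: "c \<in> A" and d: "d \<in> A" and x: "x \<in> dom c d" and q: "quadratic (FF c x)"
  shows "quadratic (FF d (tr c d x))"
  by (rule quadratic_transform[OF JJ[OF c d x] FF_change[OF c d x] q])

definition "quad p \<longleftrightarrow> (\<exists>c\<in>A. p \<in> source c \<and> quadratic (FF c (coord c p)))"

lemma quad_chart:
  assumes c: "c \<in> A" and p: "p \<in> source c"
  shows "quad p \<longleftrightarrow> quadratic (FF c (coord c p))"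
proof
  assume "quad p"
  then obtain d where d: "d \<in> A" "p \<in> source d" "quadratic (FF d (coord d p))" unfolding quad_def by blast
  then show "quadratic (FF c (coord c p))"
    using quadratic_change[OF d(1) c dom_coord[OF d(2) p] d(3)] by (simp add: coord_tr)
qed (use assms quad_def in blast)

lemma quad_constant: "quad p \<longleftrightarrow> quad q"
proof (rule locally_constant[OF conn])
  fix c x r y assume c: "c \<in> A" and B: "ball x r \<subseteq> target c" and y: "y \<in> ball x r"
  have "x \<in> ball x r" using y by (metis centre_in_ball dist_norm mem_ball norm_ge_zero order_le_less_trans)
  then have xy: "x \<in> target c" "y \<in> target c" using B y by blast+
  show "quad (pt c x) = quad (pt c y)"
    unfolding quad_chart[OF c pt_source[OF xy(1)]] quad_chart[OF c pt_source[OF xy(2)]] coord_pt[OF xy(1)] coord_pt[OF xy(2)]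
    by (rule local_berwald.quadratic_ball[OF cb[OF c] B y])
qed

text \<open>The metric is the polarization of the square of \<open>F\<close>. Its transformation law
  follows because a symmetric matrix is determined by its quadratic form, and that form is the
  chart-independent square of \<open>F\<close>.\<close>

lemma quad_riemannian:
  assumes "\<And>p. quad p"
  shows "riemannian A F"
proof -
  define k where "k p c = polar (FF c (coord c p))" for p and c :: "('a, 'n) chart"
  have form: "v \<bullet> (k p c *v v) = (FF c (coord c p) v)\<^sup>2" if "c \<in> A" "p \<in> source c" for c p v
    using quadratic_polar[of "FF c (coord c p)" v] assms[of p] quad_chart[OF that] by (simp add: k_def)
  have sym: "transpose (k p c) = k p c" for p c by (simp add: k_def polar_sym)
  have smooth: "smooth_on (target c) (\<lambda>x. k (pt c x) c)" if c: "c \<in> A" for c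
  proof -
    interpret c: local_berwald "target c" "FF c" "CC c" by (rule cb[OF c])
    note o = chart_open(2)[OF c]
    have s: "smooth_on (target c) (\<lambda>x. (FF c x v)\<^sup>2)" if v: "v \<noteq> 0" for v
    proof -
      have "smooth_on (target c) (\<lambda>x. (\<lambda>(x, v). FF c x v) (x, v))"
        by (rule smooth_on_compose[OF c.Fsm smooth_on_Pair[OF smooth_on_id[OF o] smooth_on_const o] o c.TU])
          (use v in auto)
      then have "smooth_on (target c) (\<lambda>x. FF c x v)" by simp
      from smooth_on_mult[OF this this o] show ?thesis by (simp add: power2_eq_square)
    qed
    \<comment> \<open>\<open>F\<close> is smooth only off the zero section, so the vectors entering
      \<open>polar\<close> must not vanish.\<close>
    have ax: "axis i 1 \<noteq> (0 :: real^'n)" "axis i 1 + axis j 1 \<noteq> (0 :: real^'n)" for i j :: 'n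
    proof -
      show "axis i 1 \<noteq> (0 :: real^'n)" by (simp add: axis_eq_0_iff)
      have "(axis i 1 + axis j 1 :: real^'n) $ i > 0" by (simp add: axis_def)
      then show "axis i 1 + axis j 1 \<noteq> (0 :: real^'n)" by (metis less_irrefl zero_index)
    qed
    have "smooth_on (target c) (\<lambda>x. polar (FF c x))"
      unfolding polar_def
      by (intro smooth_on_vec_lambda smooth_on_divide[OF _ smooth_on_const] smooth_on_diff s ax o) simp
    then show ?thesis
      by (rule smooth_on_cong[OF o, THEN iffD2, rotated]) (simp add: k_def coord_pt)
  qed
  have t: "k p c = transpose (jac c d p) ** k p d ** jac c d p"
    if c: "c \<in> A" and d: "d \<in> A" and p: "p \<in> source c \<inter> source d" for c d p
  proof (rule symmetric_matrix_eqI[OF sym])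
    show "transpose (transpose (jac c d p) ** k p d ** jac c d p) = transpose (jac c d p) ** k p d ** jac c d p"
      by (simp add: matrix_transpose_mul sym matrix_mul_assoc)
    fix v
    have "v \<bullet> ((transpose (jac c d p) ** k p d ** jac c d p) *v v) =
        v \<bullet> (transpose (jac c d p) *v (k p d *v (jac c d p *v v)))"
      by (simp add: matrix_vector_mul_assoc matrix_mul_assoc)
    also have "\<dots> = (FF d (coord d p) (jac c d p *v v))\<^sup>2" unfolding inner_transpose using d p by (simp add: form)
    also have "\<dots> = v \<bullet> (k p c *v v)" using c d p by (simp add: in_coord_change form)
    finally show "v \<bullet> (k p c *v v) = v \<bullet> ((transpose (jac c d p) ** k p d ** jac c d p) *v v)" by simp
  qed
  have pos: "v \<bullet> (k p c *v v) > 0" if c: "c \<in> A" and p: "p \<in> source c" and v: "v \<noteq> 0" for c p v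
    using local_berwald.Fpos[OF cb[OF c] coord_target[OF p] v] by (simp add: form[OF c p])
  have "riemannian_metric A k"
    unfolding riemannian_metric_def tensor02_def symmetric_tensor_def
    using t smooth sym pos by blast
  moreover have "F p \<xi> = sqrt (\<xi> c \<bullet> (k p c *v \<xi> c))"
    if \<xi>: "\<xi> \<in> tangent_space A p" and c: "c \<in> A" and p: "p \<in> source c" for p \<xi> c
  proof -
    have "FF c (coord c p) (\<xi> c) = F p \<xi>"
      using tangent_tvec[OF \<xi> c p] by (simp add: in_coord_def pt_coord[OF c p])
    moreover have "F p \<xi> \<ge> 0" using F \<xi> unfolding finsler_metric_def by blast
    ultimately show ?thesis by (simp add: form[OF c p])
  qed
  ultimately show ?thesis unfolding riemannian_def by blast
qed

text \<open>The normalized trace of the covariant derivative of \<lambda>. Defined this way it is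
  smooth before anything is known about its being constant.\<close>

definition "fac c x = (\<Sum>k\<in>UNIV. (frechet_derivative (llam c) (at x) (axis k 1) + CC c x (axis k 1) (llam c x)) $ k) / CARD('n)"

lemma fac_smooth:
  assumes c: "c \<in> A"
  shows "smooth_on (target c) (fac c)"
proof -
  interpret c: local_berwald "target c" "FF c" "CC c" by (rule cb[OF c])
  note o = chart_open(2)[OF c]
  have "smooth_on (target c) (\<lambda>x. CC c x (axis k 1) (llam c x))" for k
    by (rule smooth_on_bilinear_field[OF o o c.Csm c.Cbil smooth_on_id[OF o] _ smooth_on_const llam_smooth[OF c]]) auto
  then have "smooth_on (target c) (\<lambda>x. (frechet_derivative (llam c) (at x) (axis k 1) + CC c x (axis k 1) (llam c x)) $ k)" for k
    by (intro smooth_on_nth[OF smooth_on_add[OF smooth_on_frechet[OF llam_smooth[OF c]] _ o] o])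
  then show ?thesis
    unfolding fac_def
    by (intro smooth_on_divide[OF smooth_on_sum[OF _ o] smooth_on_const o]) auto
qed

lemma fac:
  assumes nr: "\<not> riemannian A F" and c: "c \<in> A" and x: "x \<in> target c"
  shows "frechet_derivative (llam c) (at x) v + CC c x v (llam c x) = fac c x *\<^sub>R v"
    and "\<not> quadratic (FF c x)"
proof -
  interpret c: local_equiv "target c" "FF c" "CC c" "HH c" "DD c" by (rule ch[OF c])
  have "\<not> quad (pt c x)" using quad_constant quad_riemannian nr by blast
  then show nq: "\<not> quadratic (FF c x)"
    using quad_chart[OF c pt_source[OF x]] by (simp add: coord_pt[OF x])
  have "frechet_derivative (lsol c) (at y) u =
      outer (llam c y) u + outer u (llam c y) - c.Cm y u ** lsol c y - lsol c y ** transpose (c.Cm y u)"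
    if "y \<in> target c" for y u
    using c.sol_derivative[OF that] by (simp add: lsol_def llam_def)
  from c.hessian_proportional[OF n nq x lsol_smooth[OF c] llam_smooth[OF c] this]
  show "frechet_derivative (llam c) (at x) v + CC c x v (llam c x) = fac c x *\<^sub>R v"
    unfolding fac_def .
qed

text \<open>By the transformation law of \<Gamma>, the covariant derivative of \<lambda> changes as
  a map of tangent vectors. Both sides are then multiples of the nonzero vector J v, and the factors
  can be compared.\<close>

lemma fac_change:
  assumes nr: "\<not> riemannian A F" and c: "c \<in> A" and d: "d \<in> A" and x: "x \<in> dom c d"
  shows "fac c x = fac d (tr c d x)"
proof -
  let ?J = "frechet_derivative (tr c d) (at x)" and ?y = "tr c d x"
  let ?v = "axis undefined 1 :: real^'n"
  have law: "conn_law \<Gamma>"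
    using \<Gamma> by (intro affine_connection_law) (simp add: associated_connection_def symmetric_connection_def)
  have lin: "linear ?J" by (rule has_derivative_linear[OF tr_derivative[OF c d x]])
  have dl: "(llam c has_derivative frechet_derivative (llam c) (at x)) (at x)"
    by (rule smooth_on_derivative[OF llam_smooth[OF c] xt[OF c d x]])
  have dl': "(llam d has_derivative frechet_derivative (llam d) (at ?y)) (at ?y)"
    by (rule smooth_on_derivative[OF llam_smooth[OF d] yt[OF c d x]])
  have 1: "((\<lambda>z. llam d (tr c d z)) has_derivative (\<lambda>v. frechet_derivative (llam d) (at ?y) (?J v))) (at x)"
    by (rule has_derivative_compose[OF tr_derivative[OF c d x] dl'])
  have lc: "llam d (tr c d z) = frechet_derivative (tr c d) (at z) (llam c z)" if "z \<in> dom c d" for z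
    using lam_change[OF c d that] by (simp add: jac_app[OF c d that])
  have "((\<lambda>z. frechet_derivative (tr c d) (at z) (llam c z)) has_derivative
      (\<lambda>v. hes c d x v (llam c x) + ?J (frechet_derivative (llam c) (at x) v))) (at x)"
    unfolding hes_def by (rule has_derivative_frechet_apply[OF tr_smooth[OF c d] dom_open[OF c d] x dl])
  then have 2: "((\<lambda>z. llam d (tr c d z)) has_derivative
      (\<lambda>v. hes c d x v (llam c x) + ?J (frechet_derivative (llam c) (at x) v))) (at x)"
    by (rule has_derivative_transform_within_open[OF _ dom_open[OF c d] x]) (rule lc[symmetric])
  have e: "frechet_derivative (llam d) (at ?y) (?J ?v) = hes c d x ?v (llam c x) + ?J (frechet_derivative (llam c) (at x) ?v)"
    by (rule fun_cong[OF has_derivative_unique[OF 1 2]])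
  have "fac d ?y *\<^sub>R ?J ?v = frechet_derivative (llam d) (at ?y) (?J ?v) + CC d ?y (?J ?v) (llam d ?y)"
    by (rule fac(1)[OF nr d yt[OF c d x], symmetric])
  also have "\<dots> = ?J (frechet_derivative (llam c) (at x) ?v) + (hes c d x ?v (llam c x) + CC d ?y (?J ?v) (?J (llam c x)))"
    unfolding e lc[OF x] by simp
  also have "\<dots> = ?J (frechet_derivative (llam c) (at x) ?v) + ?J (CC c x ?v (llam c x))"
    unfolding law[unfolded conn_law_def, rule_format, OF c d x] ..
  also have "\<dots> = ?J (fac c x *\<^sub>R ?v)"
    unfolding linear_add[OF lin, symmetric] fac(1)[OF nr c xt[OF c d x]] ..
  also have "\<dots> = fac c x *\<^sub>R ?J ?v" by (rule linear_cmul[OF lin])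
  finally have "fac d ?y *\<^sub>R ?J ?v = fac c x *\<^sub>R ?J ?v" .
  moreover have "?J ?v \<noteq> 0"
  proof
    assume "?J ?v = 0"
    then have "jac c d (pt c x) *v ?v = 0" by (simp add: jac_app[OF c d x])
    moreover have "invertible (jac c d (pt c x))" using JJ[OF c d x] invertible_det_nz by blast
    ultimately have "?v = 0" by (metis invertible_left_inverse matrix_left_invertible_ker)
    then show False by (simp add: axis_eq_0_iff)
  qed
  ultimately show ?thesis by simp
qed

lemma fac_constant:
  assumes nr: "\<not> riemannian A F"
  obtains \<mu> where "\<And>c p. c \<in> A \<Longrightarrow> p \<in> source c \<Longrightarrow> fac c (coord c p) = \<mu>"
proof -
  \<comment> \<open>By \<open>fac_change\<close> the value does not depend on the chart selected at
    p.\<close>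
  define m where "m p = (SOME r. \<exists>c\<in>A. p \<in> source c \<and> r = fac c (coord c p))" for p
  have m: "m p = fac c (coord c p)" if c: "c \<in> A" and p: "p \<in> source c" for c p
    unfolding m_def
  proof (rule some_equality)
    show "\<exists>d\<in>A. p \<in> source d \<and> fac c (coord c p) = fac d (coord d p)" using that by blast
    fix r assume "\<exists>d\<in>A. p \<in> source d \<and> r = fac d (coord d p)"
    then obtain d where d: "d \<in> A" "p \<in> source d" "r = fac d (coord d p)" by blast
    show "r = fac c (coord c p)"
      using fac_change[OF nr d(1) c dom_coord[OF d(2) p]] d by (simp add: coord_tr)
  qed
  have mc: "m p = m q" for p q
  proof (rule locally_constant[OF conn])
    fix c x r y assume c: "c \<in> A" and B: "ball x r \<subseteq> target c" and y: "y \<in> ball x r"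
    have x: "x \<in> ball x r" using y by (metis centre_in_ball dist_norm mem_ball norm_ge_zero order_le_less_trans)
    then have xy: "x \<in> target c" "y \<in> target c" using B y by blast+
    have "(fac c has_derivative (\<lambda>h. 0)) (at z within ball x r)" if "z \<in> ball x r" for z
    proof -
      have z: "z \<in> target c" using that B by blast
      show ?thesis
        by (rule has_derivative_at_withinI[OF local_berwald.hessian_factor_constant[OF cb[OF c] n fac(2)[OF nr c z] z
                llam_smooth[OF c] fac_smooth[OF c] fac(1)[OF nr c]]])
    qed
    then have "\<exists>k. \<forall>z\<in>ball x r. fac c z = k" by (intro has_derivative_zero_constant convex_ball)
    then have "fac c x = fac c y" using x y by metis
    then show "m (pt c x) = m (pt c y)"
      using m[OF c pt_source[OF xy(1)]] m[OF c pt_source[OF xy(2)]] xy by (simp add: coord_pt)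
  qed
  show thesis
    by (rule that[of "m undefined"]) (metis m mc)
qed

text \<open>If \<lambda> vanishes identically, the Levi-Civita connection is \<Gamma>. A geodesic of
  g then has zero covariant acceleration for \<Gamma>, so its Euler-Lagrange defect vanishes in the
  given parameter.\<close>

lemma affine_if_zero:
  assumes z: "\<And>p. gl p = (\<lambda>c. 0)"
  shows "affine_equivalent A g F"
  unfolding affine_equivalent_def
proof (intro allI impI)
  fix \<gamma> I assume mg: "metric_geodesic A g \<gamma> I"
  then have ag: "affine_geodesic A (levi_civita g) \<gamma> I" by (simp add: metric_geodesic_def)
  then have sc: "smooth_curve A \<gamma> I" by (simp add: affine_geodesic_def)
  have "unparam_finsler_geodesic A F \<gamma> I" using mg eq unfolding geodesically_equivalent_def by blast
  then obtain J \<tau> where J: "open_interval J" "smooth_on J \<tau>" "\<tau> ` J = I"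
    and fg: "finsler_geodesic A F (\<gamma> \<circ> \<tau>) J"
    unfolding unparam_finsler_geodesic_def by blast
  have oI: "open I" using sc by (simp add: smooth_curve_def open_interval_def)
  show "finsler_geodesic A F \<gamma> I"
    unfolding finsler_geodesic_def
  proof (intro conjI ballI impI allI sc)
    fix c t assume c: "c \<in> A" and t: "t \<in> I" and \<gamma>t: "\<gamma> t \<in> source c"
    interpret c: local_equiv "target c" "FF c" "CC c" "HH c" "DD c" by (rule ch[OF c])
    let ?K = "{t \<in> I. \<gamma> t \<in> source c}"
    let ?y = "coord c \<circ> \<gamma>"
    have "?K = I \<inter> \<gamma> -` source c" by auto
    moreover have "open (I \<inter> \<gamma> -` source c)"
      by (rule continuous_open_preimage[OF _ oI chart_open(1)[OF c]]) (use sc in \<open>simp add: smooth_curve_def\<close>)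
    ultimately have oK: "open ?K" by simp
    have tK: "t \<in> ?K" using t \<gamma>t by simp
    have ys: "smooth_on ?K ?y" using sc c unfolding smooth_curve_def by blast
    have dy: "(?y has_vector_derivative velocity \<gamma> c s) (at s)" if "s \<in> ?K" for s
      unfolding velocity_def
      using has_vector_derivative_real[OF smooth_on_derivative[OF ys that]] vector_derivative_works differentiableI_vector by blast
    obtain s where s: "s \<in> J" "\<tau> s = t" using J t by blast
    \<comment> \<open>The reparametrized curve is an extremal and hence has nonzero velocity; by the
      chain rule so has the original curve.\<close>
    show v: "velocity \<gamma> c t \<noteq> 0"
    proof
      assume v0: "velocity \<gamma> c t = 0"
      have "(?y has_vector_derivative 0) (at (\<tau> s))" using dy[OF tK] v0 s by simp
      from vector_diff_chain_at[OF has_vector_derivative_real[OF smooth_on_derivative[OF J(2) s(1)]] this]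
      have "(?y \<circ> \<tau> has_vector_derivative 0) (at s)" by (simp only: scaleR_zero_right)
      then have "velocity (\<gamma> \<circ> \<tau>) c s = 0"
        unfolding velocity_def by (simp add: vector_derivative_at comp_assoc)
      moreover have "velocity (\<gamma> \<circ> \<tau>) c s \<noteq> 0"
        using fg c s \<gamma>t unfolding finsler_geodesic_def by auto
      ultimately show False by blast
    qed
    have x: "?y t \<in> target c" using \<gamma>t by simp
    have lam0: "c.lam (?y t) = 0"
      using fun_cong[OF z, of "\<gamma> t" c] c \<gamma>t by (simp add: gl_def llam_def)
    have "(velocity \<gamma> c has_vector_derivative - DD c (?y t) (velocity \<gamma> c t) (velocity \<gamma> c t)) (at t)"
    proof -
      have "(velocity \<gamma> c has_vector_derivative
          (\<chi> i. - (\<Sum>j\<in>UNIV. \<Sum>k\<in>UNIV. levi_civita g (\<gamma> t) c i j k * velocity \<gamma> c t $ j * velocity \<gamma> c t $ k))) (at t)"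
        using ag c t \<gamma>t unfolding affine_geodesic_def by blast
      moreover have "(\<chi> i. - (\<Sum>j\<in>UNIV. \<Sum>k\<in>UNIV. levi_civita g (\<gamma> t) c i j k * velocity \<gamma> c t $ j * velocity \<gamma> c t $ k)) =
          - DD c (?y t) (velocity \<gamma> c t) (velocity \<gamma> c t)"
        by (simp add: conn_def vec_eq_iff pt_coord[OF c \<gamma>t])
      ultimately show ?thesis by simp
    qed
    then have dv: "(velocity \<gamma> c has_vector_derivative - CC c (?y t) (velocity \<gamma> c t) (velocity \<gamma> c t)) (at t)"
      by (simp only: c.lam_zero[OF x lam0])
    have p: "(?y t, velocity \<gamma> c t) \<in> target c \<times> - {0}" using x v by simp
    fix i
    have "((\<lambda>s. c.dL (?y s, velocity \<gamma> c s) (0, axis i 1)) has_real_derivative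
        c.dL (?y t, velocity \<gamma> c t) (axis i 1, 0) +
        gauge.hess (FF c (?y t)) (velocity \<gamma> c t) (axis i 1)
          (- CC c (?y t) (velocity \<gamma> c t) (velocity \<gamma> c t) + CC c (?y t) (velocity \<gamma> c t) (velocity \<gamma> c t))) (at t)"
      by (rule c.euler_lagrange_derivative[OF dy[OF tK] dv p])
    moreover have "gauge.hess (FF c (?y t)) (velocity \<gamma> c t) (axis i 1) 0 = 0"
      by (rule linear_0[OF gauge.hess_linear(1)[OF c.gauge[OF x] v]])
    ultimately have 1: "((\<lambda>s. c.dL (?y s, velocity \<gamma> c s) (0, axis i 1)) has_real_derivative
        c.dL (?y t, velocity \<gamma> c t) (axis i 1, 0)) (at t)" by simp
    \<comment> \<open>The momenta agree with the derivatives \<open>dL\<close> only at nonzero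
      velocities, so the velocity must be nonzero on a neighbourhood of t before their time
      derivatives can be compared.\<close>
    have "continuous (at t) (velocity \<gamma> c)" using dv has_vector_derivative_continuous by blast
    then have "\<forall>\<^sub>F s in at t. velocity \<gamma> c s \<noteq> 0"
      unfolding continuous_at using v by (rule tendsto_imp_eventually_ne)
    then obtain S where S: "open S" "t \<in> S" "\<And>s. s \<in> S \<Longrightarrow> s \<noteq> t \<Longrightarrow> velocity \<gamma> c s \<noteq> 0"
      unfolding eventually_at_topological by blast
    have nz: "velocity \<gamma> c s \<noteq> 0" if "s \<in> S" for s using S(3)[OF that] v by (cases "s = t") auto
    have "((\<lambda>s. partial i (\<lambda>v. lagrangian A F c (coord c (\<gamma> s)) v) (velocity \<gamma> c s)) has_real_derivative
        c.dL (?y t, velocity \<gamma> c t) (axis i 1, 0)) (at t)"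
      unfolding has_field_derivative_def
    proof (rule has_derivative_transform_within_open[OF 1[unfolded has_field_derivative_def] open_Int[OF oK S(1)]])
      show "t \<in> ?K \<inter> S" using tK S(2) by blast
      fix s assume "s \<in> ?K \<inter> S"
      then show "c.dL (?y s, velocity \<gamma> c s) (0, axis i 1) =
          partial i (\<lambda>v. lagrangian A F c (coord c (\<gamma> s)) v) (velocity \<gamma> c s)"
        unfolding lagrangian_def using c.partial_velocity[of "coord c (\<gamma> s)" "velocity \<gamma> c s" i] nz by auto
    qed
    moreover have "partial i (\<lambda>x. lagrangian A F c x (velocity \<gamma> c t)) (coord c (\<gamma> t)) =
        c.dL (?y t, velocity \<gamma> c t) (axis i 1, 0)"
      unfolding lagrangian_def using c.partial_position[OF x v, of i] by simp
    ultimately show "((\<lambda>s. partial i (\<lambda>v. lagrangian A F c (coord c (\<gamma> s)) v) (velocity \<gamma> c s)) has_real_derivative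
        partial i (\<lambda>x. lagrangian A F c x (velocity \<gamma> c t)) (coord c (\<gamma> t))) (at t)"
      by simp
  qed
qed

end

lemma riemannian_pseudo:
  assumes "riemannian_metric A g"
  shows "pseudo_riemannian_metric A g"
proof -
  have "invertible (g p c)" if "c \<in> A" "p \<in> source c" for c p
  proof -
    have "v = 0" if "g p c *v v = 0" for v
    proof (rule ccontr)
      assume "v \<noteq> 0"
      then have "v \<bullet> (g p c *v v) > 0" using assms \<open>c \<in> A\<close> \<open>p \<in> source c\<close> unfolding riemannian_metric_def by blast
      then show False using that by simp
    qed
    then show ?thesis by (metis invertible_left_inverse matrix_left_invertible_ker)
  qed
  then show ?thesis using assms by (simp add: riemannian_metric_def pseudo_riemannian_metric_def)
qed

theorem theorem2:
  fixes A :: "('a::{t2_space,second_countable_topology}, 'n::finite) chart set"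
    and F :: "('a, 'n) finsler"
    and \<Gamma> :: "('a, 'n) connection"
    and g :: "'a \<Rightarrow> ('a, 'n) chart \<Rightarrow> real^'n^'n"
  assumes "smooth_manifold A"
    and "connected (UNIV :: 'a set)"
    and "CARD('n) \<ge> 2"
    and "finsler_metric A F"
    and "essentially_berwald A F"
    and "associated_connection A F \<Gamma>"
    and "riemannian_metric A g \<or> pseudo_riemannian_metric A g"
    and "geodesically_equivalent A g F"
    and "\<not> affine_equivalent A g F"
  shows "\<exists>(\<mu>::real) (a :: 'a \<Rightarrow> ('a, 'n) chart \<Rightarrow> real^'n^'n) (lam :: 'a \<Rightarrow> ('a, 'n) tangent).
      tensor20 A a \<and> symmetric_tensor A a \<and>
      vector_field A lam \<and> (\<exists>p. lam p \<noteq> (\<lambda>c. 0)) \<and>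
      (\<forall>c\<in>A. \<forall>p \<in> source c. \<forall>i j k.
         cov_tensor20 \<Gamma> a p c i j k =
           lam p c $ i * (if j = k then 1 else 0) + lam p c $ j * (if i = k then 1 else 0)) \<and>
      (\<forall>c\<in>A. \<forall>p \<in> source c. \<forall>i j.
         cov_vec \<Gamma> lam p c i j = \<mu> * (if i = j then 1 else 0))"
proof -
  interpret global_equiv A F \<Gamma> g
    using assms riemannian_pseudo by unfold_locales auto
  have nr: "\<not> riemannian A F" using assms(5) by (simp add: essentially_berwald_def)
  obtain \<mu> where \<mu>: "\<And>c p. c \<in> A \<Longrightarrow> p \<in> source c \<Longrightarrow> fac c (coord c p) = \<mu>"
    by (rule fac_constant[OF nr]) blast
  \<comment> \<open>Here the failure of affine equivalence enters.\<close>
  have "\<exists>p. gl p \<noteq> (\<lambda>c. 0)" using affine_if_zero assms(9) by blast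
  moreover have "cov_vec \<Gamma> gl p c i j = \<mu> * (if i = j then 1 else 0)" if "c \<in> A" "p \<in> source c" for c p i j
    unfolding cov_gl[OF that] fac(1)[OF nr that(1) coord_target[OF that(2)]] \<mu>[OF that] by (simp add: axis_def)
  ultimately show ?thesis
    using ga_tensor ga_symmetric gl_vector cov_ga by (intro exI[of _ \<mu>] exI[of _ ga] exI[of _ gl]) blast
qed

end
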